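(* Fix $0<\varepsilon<1/2$ and assume the Generalized Riemann Hypothesis and that $\sum_{0<\gamma\le X}|\zeta'(\rho)|^{-2}\ll X$. Let $N\ge4$ be a natural number, let $\beta>0$, and let $f:\mathbb R\to\mathbb C$ have support in $[0,\beta)$, with $f\in C^1(0,\beta)$, $f'$ absolutely continuous on $(0,\beta)$ (so that $f|_{(0,\beta)}\in W^{2,1}(0,\beta)$), $f(\beta^-)=f'(\beta^-)=0$, and $f''$ bounded in a neighbourhood of the origin. Then $$\sum_{\substack{1<q\le N^{1-2\varepsilon}\\ (N,q)=1}}\frac1{\varphi(q)}\left|\sum_{\chi\ne\chi_0}\overline{\chi^*}(N)\sum_{n\le N\beta}\ \sum_{m\le N\beta-n}\Lambda(n)\chi^*(n)\mu(m)\log(m)f\!\left(\frac{n+m}{N}\right)\right|\ll_\varepsilon N^{2-\varepsilon}E_1(f''),$$ where $$E_1(f''):=\int_0^\beta|f''(w)|\left(1+|\log w|^3\right)\left(1+w^{5/2+\varepsilon}\right)dw,$$ and the implicit constant depends only on $\varepsilon$.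
   Context: $\Lambda$ is the von Mangoldt function, $\mu$ the M\"obius function, $\varphi$ Euler's totient. Sums $\sum_{n\le A}$ run over integers $0<n\le A$. $\sum_{\chi\ne\chi_0}$ is over all non-principal Dirichlet characters modulo $q$, and $\chi^*$ denotes the primitive character inducing $\chi$. GRH: all non-trivial zeros (those with $0<\mathrm{Re}(s)<1$) of $\zeta(s)$ and of all Dirichlet $L$-functions have real part $1/2$. $\rho=\frac12+i\gamma$ runs over the non-trivial zeros of $\zeta(s)$. The assumption $\sum_{0<\gamma\le X}|\zeta'(\rho)|^{-2}\ll X$ (a weak form of the Gonek--Hejhal conjecture) is for $X\to\infty$ and includes that all non-trivial zeros of $\zeta$ are simple. *)

theory Defs
  imports
    "HOL-Complex_Analysis.Complex_Analysis"
    "HOL-Number_Theory.Number_Theory"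
    "HOL-Computational_Algebra.Squarefree"
    "HOL-Library.Landau_Symbols"
begin

definition moebius_mu :: "nat \<Rightarrow> 'a :: ring_1" where
  "moebius_mu n = (if squarefree n then (- 1) ^ card (prime_factors n) else 0)"


text \<open>Since the characters modulo \<open>q\<close> are functions on all of \<open>nat\<close> vanishing off the units,
  distinct characters are distinct as functions. For \<open>q = 1\<close> the only one is constantly 1.\<close>

definition dirichlet_character :: "nat \<Rightarrow> (nat \<Rightarrow> complex) \<Rightarrow> bool" where
  "dirichlet_character q chi \<longleftrightarrow>
     q > 0 \<and>
     (\<forall>a b. chi (a * b) = chi a * chi b) \<and>
     (\<forall>a. chi (a + q) = chi a) \<and>
     (\<forall>a. chi a \<noteq> 0 \<longleftrightarrow> coprime a q)"

definition principal_character :: "nat \<Rightarrow> nat \<Rightarrow> complex" where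
  "principal_character q a = (if coprime a q then 1 else 0)"

definition induces :: "nat \<Rightarrow> (nat \<Rightarrow> complex) \<Rightarrow> nat \<Rightarrow> (nat \<Rightarrow> complex) \<Rightarrow> bool" where
  "induces d \<psi> q chi \<longleftrightarrow>
     d dvd q \<and> dirichlet_character d \<psi> \<and> dirichlet_character q chi \<and>
     (\<forall>a. coprime a q \<longrightarrow> chi a = \<psi> a)"

definition primitive_character :: "nat \<Rightarrow> (nat \<Rightarrow> complex) \<Rightarrow> bool" where
  "primitive_character q chi \<longleftrightarrow>
     dirichlet_character q chi \<and> (\<forall>d \<psi>. induces d \<psi> q chi \<longrightarrow> d = q)"

text \<open>The unique primitive character inducing \<open>chi\<close>. It vanishes only on integers that are not
  coprime to the conductor, so it may be nonzero where \<open>chi\<close> is zero.\<close>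

definition primitive_inducing :: "nat \<Rightarrow> (nat \<Rightarrow> complex) \<Rightarrow> nat \<Rightarrow> complex" where
  "primitive_inducing q chi = (THE \<psi>. \<exists>d. primitive_character d \<psi> \<and> induces d \<psi> q chi)"


text \<open>The meromorphic continuation to the whole plane of the Dirichlet series of \<open>chi\<close>.
  Requiring \<open>nicely_meromorphic_on\<close> (value 0 at poles, no removable singularities) makes it
  unique as a total function.\<close>

definition dirichlet_L :: "(nat \<Rightarrow> complex) \<Rightarrow> complex \<Rightarrow> complex" where
  "dirichlet_L chi =
     (THE F. F nicely_meromorphic_on UNIV \<and>
        (\<forall>s. Re s > 1 \<longrightarrow> (\<lambda>n. chi (Suc n) / of_nat (Suc n) powr s) sums F s))"

definition riemann_zeta :: "complex \<Rightarrow> complex" where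
  "riemann_zeta = dirichlet_L (\<lambda>_. 1)"

definition nontrivial_zeros :: "(complex \<Rightarrow> complex) \<Rightarrow> complex set" where
  "nontrivial_zeros F = {s. 0 < Re s \<and> Re s < 1 \<and> F s = 0}"

definition generalized_riemann_hypothesis :: bool where
  "generalized_riemann_hypothesis \<longleftrightarrow>
     (\<forall>\<rho>\<in>nontrivial_zeros riemann_zeta. Re \<rho> = 1 / 2) \<and>
     (\<forall>q chi. dirichlet_character q chi \<longrightarrow>
        (\<forall>\<rho>\<in>nontrivial_zeros (dirichlet_L chi). Re \<rho> = 1 / 2))"

text \<open>The simplicity of the zeros has to be demanded separately, because a zero of higher
  order would contribute \<open>1 / 0 = 0\<close> to the sum.\<close>

definition weak_gonek_hejhal :: bool where
  "weak_gonek_hejhal \<longleftrightarrow>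
     (\<forall>\<rho>\<in>nontrivial_zeros riemann_zeta. zorder riemann_zeta \<rho> = 1) \<and>
     (\<lambda>X::real. \<Sum>\<rho> | \<rho> \<in> nontrivial_zeros riemann_zeta \<and> 0 < Im \<rho> \<and> Im \<rho> \<le> X.
        1 / (cmod (deriv riemann_zeta \<rho>))\<^sup>2) \<in> O[at_top](\<lambda>X. X)"


text \<open>Absolute continuity of a function on an interval \<open>I\<close>; the library's
  \<open>absolutely_continuous\<close> is about measures. An element \<open>(a, b)\<close> of \<open>D\<close> stands for the
  interval with endpoints \<open>a\<close> and \<open>b\<close>.\<close>

definition abs_continuous_on :: "real set \<Rightarrow> (real \<Rightarrow> complex) \<Rightarrow> bool" where
  "abs_continuous_on I g \<longleftrightarrow>
     (\<forall>e>0. \<exists>d>0. \<forall>D :: (real \<times> real) set.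
        finite D \<and> (\<forall>(a, b)\<in>D. a \<le> b \<and> {a..b} \<subseteq> I) \<and>
        disjoint_family_on (\<lambda>(a, b). {a<..<b}) D \<and>
        (\<Sum>(a, b)\<in>D. b - a) < d \<longrightarrow>
        (\<Sum>(a, b)\<in>D. norm (g b - g a)) < e)"

text \<open>Here \<open>h\<close> is meant to be a second derivative that exists almost everywhere, so
  integrals and bounds are taken with respect to \<open>lebesgue\<close> (not \<open>lborel\<close>), where altering \<open>h\<close>
  on a null set is harmless.\<close>

definition E1 :: "real \<Rightarrow> real \<Rightarrow> (real \<Rightarrow> complex) \<Rightarrow> real" where
  "E1 \<epsilon> \<beta> h =
     (LINT w:{0<..<\<beta>}|lebesgue. norm (h w) * (1 + \<bar>ln w\<bar> ^ 3) * (1 + w powr (5 / 2 + \<epsilon>)))"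

text \<open>\<open>f'\<close> is the derivative of \<open>f\<close> on the open interval and \<open>f''\<close> is (a version of) the almost
  everywhere derivative of \<open>f'\<close>. Support is not closed, and \<open>f\<close> may jump at 0.\<close>

definition admissible ::
    "real \<Rightarrow> (real \<Rightarrow> complex) \<Rightarrow> (real \<Rightarrow> complex) \<Rightarrow> (real \<Rightarrow> complex) \<Rightarrow> bool" where
  "admissible \<beta> f f' f'' \<longleftrightarrow>
     {x. f x \<noteq> 0} \<subseteq> {0..<\<beta>} \<and>
     (\<forall>x\<in>{0<..<\<beta>}. (f has_vector_derivative f' x) (at x)) \<and>
     continuous_on {0<..<\<beta>} f' \<and>
     abs_continuous_on {0<..<\<beta>} f' \<and>
     (AE x in lebesgue. x \<in> {0<..<\<beta>} \<longrightarrow> (f' has_vector_derivative f'' x) (at x)) \<and>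
     (f \<longlongrightarrow> 0) (at_left \<beta>) \<and>
     (f' \<longlongrightarrow> 0) (at_left \<beta>) \<and>
     (\<exists>\<delta>>0. \<exists>B. AE x in lebesgue. x \<in> {0<..<\<beta>} \<and> x < \<delta> \<longrightarrow> norm (f'' x) \<le> B)"

end

theory Submission
  imports Defs "HOL-Real_Asymp.Real_Asymp"
begin

text \<open>Since \<open>f x\<close> is the integral of \<open>max 0 (w - x) * f'' w\<close>, the double sum is an integral of
  \<open>f'' w / N\<close> against the Riesz mean of \<open>\<Lambda> \<psi> * (\<mu> log)\<close> (additive convolution) at \<open>w N\<close>. Summation by
  parts in both variables bounds this mean by \<open>Y\<close> times the product of the partial sums of the two
  factors up to \<open>Y\<close>. GRH gives both of these the size \<open>Y powr (1/2 + \<delta>)\<close>, up to a small power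
  of \<open>q\<close>: away from the critical line \<open>L'/L\<close> and the derivative of \<open>1/\<zeta>\<close> are of size
  \<open>(q (1 + \<bar>t\<bar>)) powr \<delta>\<close>, and Perron's formula applies. The trivial bound for the sum over the at most
  \<open>totient q\<close> characters and over \<open>q \<le> N powr (1 - 2\<epsilon>)\<close> then suffices.\<close>

section \<open>Analytic continuation of Dirichlet L-functions\<close>

text \<open>The delicate point is uniformity in the modulus with arbitrarily small exponents. The
  continuation through Hurwitz zeta functions makes the polynomial dependence of L(s, chi) on q and
  s explicit. Borel-Caratheodory turns this into log L(s, chi) = O(log(q |t|)) to the right of the
  critical line; exponentiating that would give 1/zeta only a fixed power of |t|, so a three circles
  argument lowers it to a power \<theta> < 1 of the logarithm. Such a logarithm exists on discs
  reaching from Re s > 1 to Re s = 1/2 only if the line Re s = 1 carries no zeros, which a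
  hypothesis on 0 < Re s < 1 does not contain; hence the detour through Landau's theorem. On the
  side of f, the second derivative exists only almost everywhere and f may jump at 0, so Taylor's
  formula is anchored at the right end \<beta>, where f and f' vanish, and rests on the fundamental
  theorem of calculus for absolutely continuous functions. The exponents finally add up to (1 - 2
  \<epsilon>) + (1 + 8 \<eta>) + \<eta> at most, with \<eta> = \<epsilon> / 16: range of q, the two
  partial sums, the conductor.\<close>

lemma holomorphic_on_integral_param:
  fixes f :: "complex \<Rightarrow> real \<Rightarrow> complex"
  assumes U: "open U"
    and cont: "continuous_on (U \<times> {0..1}) (\<lambda>(s, v). f s v)"
    and hol: "\<And>v. v \<in> {0..1} \<Longrightarrow> (\<lambda>s. f s v) holomorphic_on U"
  shows "(\<lambda>s. integral {0..1} (f s)) holomorphic_on U"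
proof -
  \<comment> \<open>Morera's theorem: exchanging the integral over v with the one along each side of
    a triangle leaves, for every fixed v, an integral that vanishes by Cauchy's theorem.\<close>
  have "(\<lambda>s. integral {0..1} (f s)) analytic_on U"
  proof (rule Morera_triangle[OF _ U])
    show "continuous_on U (\<lambda>s. integral {0..1} (f s))"
      using integral_continuous_on_param[of U 0 1 f] cont by simp
    fix a b c
    show "convex hull {a, b, c} \<subseteq> U \<longrightarrow>
       contour_integral (linepath a b) (\<lambda>s. integral {0..1} (f s)) +
       contour_integral (linepath b c) (\<lambda>s. integral {0..1} (f s)) +
       contour_integral (linepath c a) (\<lambda>s. integral {0..1} (f s)) = 0"
    proof
      assume sub: "convex hull {a, b, c} \<subseteq> U"
      have lin: "contour_integral (linepath x y) (\<lambda>s. integral {0..1} (f s)) =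
          integral {0..1} (\<lambda>v. contour_integral (linepath x y) (\<lambda>s. f s v))"
        and cl: "continuous_on {0..1} (\<lambda>v. contour_integral (linepath x y) (\<lambda>s. f s v))"
        if xy: "x \<in> {a, b, c}" "y \<in> {a, b, c}" for x y
      proof -
        have seg: "closed_segment x y \<subseteq> U"
          using sub xy by (meson closed_segment_subset_convex_hull hull_inc subset_trans)
        have lp: "linepath x y t \<in> U" if "t \<in> {0..1}" for t
          using seg linepath_in_path[of t x y] that by blast
        have c1: "continuous_on ({0..1} \<times> {0..1}) (\<lambda>(t, v). f (linepath x y t) v)"
          unfolding split_beta'
          by (rule continuous_on_compose2[OF cont[unfolded split_beta'], of _ "\<lambda>z. (linepath x y (fst z), snd z)", simplified])
             (use lp in \<open>auto intro!: continuous_intros simp: linepath_def\<close>)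
        have c2: "continuous_on (cbox (0, 0) (1::real, 1::real)) (\<lambda>(t, v). f (linepath x y t) v * (y - x))"
          using c1 unfolding split_beta' by (auto intro!: continuous_intros simp: cbox_Pair_eq)
        have c3: "continuous_on (cbox (0, 0) (1::real, 1::real)) (\<lambda>(v, t). f (linepath x y t) v * (y - x))"
        proof -
          have "continuous_on (cbox (0, 0) (1::real, 1::real)) ((\<lambda>(t, v). f (linepath x y t) v * (y - x)) \<circ> prod.swap)"
            by (rule continuous_on_compose[OF continuous_on_swap]) (use c2 in \<open>simp add: swap_cbox_Pair\<close>)
          thus ?thesis by (simp add: o_def split_beta')
        qed
        have "contour_integral (linepath x y) (\<lambda>s. integral {0..1} (f s)) =
              integral {0..1} (\<lambda>t. integral {0..1} (f (linepath x y t)) * (y - x))"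
          by (simp add: contour_integral_integral)
        also have "\<dots> = integral (cbox 0 1) (\<lambda>t. integral (cbox 0 1) (\<lambda>v. f (linepath x y t) v * (y - x)))"
          by simp
        also have "\<dots> = integral (cbox 0 1) (\<lambda>v. integral (cbox 0 1) (\<lambda>t. f (linepath x y t) v * (y - x)))"
          by (rule integral_swap_continuous[OF c2])
        also have "\<dots> = integral {0..1} (\<lambda>v. contour_integral (linepath x y) (\<lambda>s. f s v))"
          by (simp add: contour_integral_integral)
        finally show "contour_integral (linepath x y) (\<lambda>s. integral {0..1} (f s)) =
          integral {0..1} (\<lambda>v. contour_integral (linepath x y) (\<lambda>s. f s v))" .
        show "continuous_on {0..1} (\<lambda>v. contour_integral (linepath x y) (\<lambda>s. f s v))"
          using integral_continuous_on_param[of "{0..1}" 0 1 "\<lambda>v t. f (linepath x y t) v * (y - x)"] c3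
          by (simp add: contour_integral_integral cbox_Pair_eq)
      qed
      note ii = integrable_continuous_real[OF cl]
      have "integral {0..1} (\<lambda>v. contour_integral (linepath a b) (\<lambda>s. f s v)) +
            integral {0..1} (\<lambda>v. contour_integral (linepath b c) (\<lambda>s. f s v)) +
            integral {0..1} (\<lambda>v. contour_integral (linepath c a) (\<lambda>s. f s v)) =
            integral {0..1} (\<lambda>v. contour_integral (linepath a b) (\<lambda>s. f s v) +
              contour_integral (linepath b c) (\<lambda>s. f s v) + contour_integral (linepath c a) (\<lambda>s. f s v))"
        using ii[of a b] ii[of b c] ii[of c a] by (simp add: integral_add integrable_add)
      also have "\<dots> = integral {0..1} (\<lambda>v::real. 0)"
      proof (rule integral_cong)
        fix v :: real assume v: "v \<in> {0..1}"
        have h: "(\<lambda>s. f s v) holomorphic_on convex hull {a, b, c}"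
          using hol[OF v] sub holomorphic_on_subset by blast
        from Cauchy_theorem_triangle[OF h]
        have i0: "((\<lambda>s. f s v) has_contour_integral 0) (linepath a b +++ linepath b c +++ linepath c a)" .
        have hcab: "(\<lambda>s. f s v) contour_integrable_on linepath x y" if "x \<in> {a,b,c}" "y \<in> {a,b,c}" for x y
          proof (rule contour_integrable_continuous_linepath)
            have "closed_segment x y \<subseteq> convex hull {a, b, c}"
              using that by (meson closed_segment_subset_convex_hull hull_inc)
            thus "continuous_on (closed_segment x y) (\<lambda>s. f s v)"
              using holomorphic_on_imp_continuous_on[OF h] continuous_on_subset by blast
          qed
        show "contour_integral (linepath a b) (\<lambda>s. f s v) +
              contour_integral (linepath b c) (\<lambda>s. f s v) + contour_integral (linepath c a) (\<lambda>s. f s v) = 0"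
          using contour_integral_unique[OF i0] hcab[of a b] hcab[of b c] hcab[of c a]
          by (simp add: contour_integrable_joinI add.assoc)
      qed
      finally show "contour_integral (linepath a b) (\<lambda>s. integral {0..1} (f s)) +
       contour_integral (linepath b c) (\<lambda>s. integral {0..1} (f s)) +
       contour_integral (linepath c a) (\<lambda>s. integral {0..1} (f s)) = 0"
        using lin[of a b] lin[of b c] lin[of c a] by simp
    qed
  qed
  thus ?thesis by (rule analytic_imp_holomorphic)
qed

section \<open>Hurwitz zeta function and its continuation\<close>

definition hurwitz :: "complex \<Rightarrow> real \<Rightarrow> complex" where
  "hurwitz s a = (\<Sum>n. complex_of_real (real n + a) powr (-s))"

lemma norm_of_real_powr: "a \<ge> 0 \<Longrightarrow> norm (complex_of_real a powr s) = a powr Re s"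
  by (simp add: norm_powr_real_powr)

lemma of_nat_add_of_real_nonzero: "a > 0 \<Longrightarrow> complex_of_nat n + complex_of_real a \<noteq> 0"
  by (metis add_nonneg_pos less_irrefl of_nat_0_le_iff of_real_add of_real_eq_0_iff of_real_of_nat_eq)

text \<open>Uniformity in s and a together is what the joint continuity of \<open>hurwitz\<close>
  rests on. The term n = 0 is unbounded as a tends to 0, but a single term does not disturb uniform
  convergence; therefore the majorant n^(-\<sigma>) is required only eventually.\<close>

lemma hurwitz_uniform_limit:
  assumes "\<sigma> > 1"
  shows "uniform_limit ({s. Re s > \<sigma>} \<times> {0<..})
     (\<lambda>N (s, a). \<Sum>n<N. complex_of_real (real n + a) powr (-s)) (\<lambda>(s, a). hurwitz s a) sequentially"
proof -
  have "uniform_limit ({s. Re s > \<sigma>} \<times> {0<..})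
     (\<lambda>N z. \<Sum>n<N. complex_of_real (real n + snd z) powr (- fst z))
     (\<lambda>z. \<Sum>n. complex_of_real (real n + snd z) powr (- fst z)) sequentially"
  proof (rule Weierstrass_m_test_ev)
    show "\<forall>\<^sub>F n in sequentially. \<forall>z\<in>{s. Re s > \<sigma>} \<times> {0<..}.
       norm (complex_of_real (real n + snd z) powr (- fst z)) \<le> real n powr (-\<sigma>)"
      using eventually_gt_at_top[of 0]
    proof eventually_elim
      case (elim n)
      show ?case
      proof clarify
        fix s :: complex and a :: real assume s: "Re s > \<sigma>" and a: "a > 0"
        have "norm (complex_of_real (real n + a) powr (- s)) = (real n + a) powr (- Re s)"
          using a by (subst norm_of_real_powr) auto
        also have "\<dots> \<le> (real n + a) powr (-\<sigma>)"
          using s a elim by (intro powr_mono) auto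
        also have "\<dots> \<le> real n powr (-\<sigma>)"
          using a elim assms by (intro powr_mono2') auto
        finally show "norm (complex_of_real (real n + snd (s, a)) powr - fst (s, a)) \<le> real n powr (-\<sigma>)"
          by simp
      qed
    qed
    show "summable (\<lambda>n. real n powr (-\<sigma>))"
      using assms by (simp add: summable_real_powr_iff)
  qed
  thus ?thesis by (simp add: hurwitz_def split_beta')
qed

lemma hurwitz_sums:
  assumes "Re s > 1" "a > 0"
  shows "(\<lambda>n. complex_of_real (real n + a) powr (-s)) sums hurwitz s a"
proof -
  define \<sigma> where "\<sigma> = (1 + Re s) / 2"
  have "\<sigma> > 1" "Re s > \<sigma>" using assms by (auto simp: \<sigma>_def)
  from tendsto_uniform_limitI[OF hurwitz_uniform_limit[OF this(1)], of "(s, a)"] this assms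
  show ?thesis by (simp add: sums_def)
qed

lemma hurwitz_continuous: "continuous_on ({s. Re s > 1} \<times> {0<..}) (\<lambda>(s, a). hurwitz s a)"
proof -
  have op: "open ({s. Re s > \<sigma>} \<times> {0::real<..})" for \<sigma>
    by (intro open_Times open_halfspace_Re_gt) auto
  have c: "continuous_on ({s. Re s > \<sigma>} \<times> {0<..}) (\<lambda>(s, a). hurwitz s a)" if "\<sigma> > 1" for \<sigma>
    by (rule uniform_limit_theorem[OF _ hurwitz_uniform_limit[OF that]])
       (use that in \<open>auto simp: split_beta' of_nat_add_of_real_nonzero intro!: always_eventually continuous_intros\<close>)
  show ?thesis
  proof (rule continuous_at_imp_continuous_on, clarify)
    fix s :: complex and a :: real assume "Re s > 1" "a > 0"
    hence "(s, a) \<in> {z. Re z > (1 + Re s) / 2} \<times> {0<..}" "(1 + Re s) / 2 > 1" by auto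
    with c[of "(1 + Re s) / 2"] op[of "(1 + Re s) / 2"]
    show "isCont (\<lambda>(s, a). hurwitz s a) (s, a)"
      using continuous_on_eq_continuous_at by blast
  qed
qed

lemma hurwitz_holomorphic:
  assumes a: "a > 0"
  shows "(\<lambda>s. hurwitz s a) holomorphic_on {s. Re s > 1}"
proof (rule holomorphic_uniform_sequence[OF open_halfspace_Re_gt])
  show "(\<lambda>s. \<Sum>n<N. complex_of_real (real n + a) powr (-s)) holomorphic_on {s. Re s > 1}" for N
    using a by (auto intro!: holomorphic_intros)
  fix x :: complex assume "x \<in> {s. Re s > 1}"
  define d where "d = (Re x - 1) / 3"
  have d: "d > 0" using \<open>x \<in> _\<close> by (auto simp: d_def)
  have sub: "cball x d \<subseteq> {s. Re s > 1 + d}"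
  proof
    fix y assume "y \<in> cball x d"
    hence "Re x - Re y \<le> d" using complex_Re_le_cmod[of "x - y"] by (auto simp: dist_norm)
    hence "Re x - Re y \<le> (Re x - 1) / 3" by (simp add: d_def)
    thus "y \<in> {s. Re s > 1 + d}" using d unfolding d_def by (simp add: field_simps)
  qed
  have "uniform_limit ({s. Re s > 1 + d} \<times> {0<..})
     (\<lambda>N (s, a). \<Sum>n<N. complex_of_real (real n + a) powr (-s)) (\<lambda>(s, a). hurwitz s a) sequentially"
    using d by (intro hurwitz_uniform_limit) auto
  hence "uniform_limit (cball x d) (\<lambda>N s. \<Sum>n<N. complex_of_real (real n + a) powr (-s)) (\<lambda>s. hurwitz s a) sequentially"
    unfolding uniform_limit_iff
    apply (elim all_forward imp_forward eventually_mono) using sub a by fastforce+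
  thus "\<exists>d>0. cball x d \<subseteq> {s. Re s > 1} \<and> uniform_limit (cball x d)
      (\<lambda>N s. \<Sum>n<N. complex_of_real (real n + a) powr (-s)) (\<lambda>s. hurwitz s a) sequentially"
    using sub d by (intro exI[of _ d]) fastforce
qed

text \<open>\<open>hurwitz_cont k\<close> continues \<open>(s - 1) \<zeta>(s, a)\<close> to \<open>Re s > 1 - k\<close>: integrate by parts in
  \<open>\<integral> \<zeta>(s, a + v) dv = a powr (1 - s) / (s - 1)\<close> over \<open>0 \<le> v \<le> 1\<close>, where
  \<open>d/dv \<zeta>(s, a + v) = - s \<zeta>(s + 1, a + v)\<close>.\<close>

fun hurwitz_cont :: "nat \<Rightarrow> complex \<Rightarrow> real \<Rightarrow> complex" where
  "hurwitz_cont 0 s a = (s - 1) * hurwitz s a"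
| "hurwitz_cont (Suc k) s a = complex_of_real a powr (1 - s) +
     (s - 1) * integral {0..1} (\<lambda>v. complex_of_real (1 - v) * hurwitz_cont k (s + 1) (a + v))"

text \<open>Holomorphy in s alone would not survive the induction: the recursion integrates over the
  second argument, so joint continuity in s and a has to be carried along.\<close>

lemma hurwitz_cont_regular:
  "continuous_on ({s. Re s > 1 - real k} \<times> {0<..}) (\<lambda>(s, a). hurwitz_cont k s a) \<and>
   (\<forall>a>0. (\<lambda>s. hurwitz_cont k s a) holomorphic_on {s. Re s > 1 - real k})"
proof (induction k)
  case 0
  show ?case
    using hurwitz_continuous hurwitz_holomorphic
    by (auto simp: split_beta' intro!: continuous_intros holomorphic_intros)
next
  case (Suc k)
  let ?U = "{s. Re s > 1 - real (Suc k)}"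
  note c = conjunct1[OF Suc, unfolded split_beta']
  have c2: "continuous_on ((?U \<times> {0<..}) \<times> {0..1}) (\<lambda>z. complex_of_real (1 - snd z) * hurwitz_cont k (fst (fst z) + 1) (snd (fst z) + snd z))"
    by (intro continuous_intros continuous_on_compose2[OF c, of _ "\<lambda>z. (fst (fst z) + 1, snd (fst z) + snd z)", simplified]) auto
  have "continuous_on (?U \<times> {0<..}) (\<lambda>z. integral {0..1} (\<lambda>v. complex_of_real (1 - v) * hurwitz_cont k (fst z + 1) (snd z + v)))"
    using integral_continuous_on_param[of "?U \<times> {0<..}" 0 1 "\<lambda>z v. complex_of_real (1 - v) * hurwitz_cont k (fst z + 1) (snd z + v)"] c2
    by (simp add: split_beta')
  hence 1: "continuous_on (?U \<times> {0<..}) (\<lambda>(s, a). hurwitz_cont (Suc k) s a)"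
    by (auto simp: split_beta' intro!: continuous_intros)
  have 2: "(\<lambda>s. hurwitz_cont (Suc k) s a) holomorphic_on ?U" if a: "a > 0" for a
  proof -
    have "(\<lambda>s. integral {0..1} (\<lambda>v. complex_of_real (1 - v) * hurwitz_cont k (s + 1) (a + v))) holomorphic_on ?U"
    proof (rule holomorphic_on_integral_param[OF open_halfspace_Re_gt])
      show "continuous_on (?U \<times> {0..1}) (\<lambda>(s, v). complex_of_real (1 - v) * hurwitz_cont k (s + 1) (a + v))"
        unfolding split_beta'
        using a by (intro continuous_intros continuous_on_compose2[OF c, of _ "\<lambda>z. (fst z + 1, a + snd z)", simplified]) auto
      fix v :: real assume v: "v \<in> {0..1}"
      have "(\<lambda>s. hurwitz_cont k s (a + v)) \<circ> (\<lambda>s. s + 1) holomorphic_on ?U"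
        by (rule holomorphic_on_compose_gen[where t = "{s. Re s > 1 - real k}"])
           (use Suc v a in \<open>auto intro!: holomorphic_intros\<close>)
      thus "(\<lambda>s. complex_of_real (1 - v) * hurwitz_cont k (s + 1) (a + v)) holomorphic_on ?U"
        by (auto intro!: holomorphic_intros simp: o_def)
    qed
    thus ?thesis using a by (auto intro!: holomorphic_intros)
  qed
  show ?case using 1 2 by blast
qed

text \<open>Integration by parts done term by term: each integrand has an explicit antiderivative,
  the boundary values telescope, and the last one, (N + a)^(1 - s), tends to 0. Termwise integration
  is allowed because the series converges uniformly in v.\<close>

lemma hurwitz_cont_Suc_0:
  assumes s: "Re s > 1" and a: "a > 0"
  shows "hurwitz_cont (Suc 0) s a = hurwitz_cont 0 s a"
proof -
  have s0: "s \<noteq> 0" "s \<noteq> 1" using s by auto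
  define x where "x = (\<lambda>n::nat. real n + a)"
  have x: "x n > 0" for n using a by (auto simp: x_def)
  \<comment> \<open>The antiderivative of (1 - z) (x n + z)^(-s - 1) found by one integration by
    parts; it is stated for complex z so that the rules of complex differentiation apply.\<close>
  define A where "A = (\<lambda>n z. (-(1 - z) * (of_real (x n) + z) powr (-s) + (of_real (x n) + z) powr (1 - s) / (s - 1)) / s)"
  define f where "f = (\<lambda>n v. complex_of_real (1 - v) * complex_of_real (real n + (a + v)) powr (-(s + 1)))"
  have int_f: "(f n has_integral A n 1 - A n 0) {0..1}" for n
  proof -
    have "(f n has_integral A n (of_real 1) - A n (of_real 0)) {0..1}"
    proof (rule fundamental_theorem_of_calculus)
      fix v :: real assume v: "v \<in> {0..1}"
      have nn: "complex_of_real (x n) + complex_of_real v \<notin> \<real>\<^sub>\<le>\<^sub>0"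
        using x[of n] v by (auto simp: complex_nonpos_Reals_iff)
      have "(A n has_field_derivative f n v) (at (of_real v))"
        unfolding A_def f_def using nn s0
        by (auto intro!: derivative_eq_intros simp: divide_simps x_def) (simp add: algebra_simps)
      thus "((\<lambda>v. A n (complex_of_real v)) has_vector_derivative f n v) (at v within {0..1})"
        by (rule has_vector_derivative_real_field)
    qed auto
    thus ?thesis by simp
  qed
  have ul: "uniform_limit {0..1} (\<lambda>N v. \<Sum>n<N. f n v) (\<lambda>v. complex_of_real (1 - v) * hurwitz (s + 1) (a + v)) sequentially"
  proof -
    have "uniform_limit ({s. Re s > 3/2} \<times> {0<..})
     (\<lambda>N (s, a). \<Sum>n<N. complex_of_real (real n + a) powr (-s)) (\<lambda>(s, a). hurwitz s a) sequentially"
      using hurwitz_uniform_limit[of "3/2"] by simp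
    hence u1: "uniform_limit {0..1} (\<lambda>N v. \<Sum>n<N. complex_of_real (real n + (a + v)) powr (-(s+1))) (\<lambda>v. hurwitz (s+1) (a + v)) sequentially"
      using uniform_limit_compose'[of _ _ _ _ "\<lambda>v. (s + 1, a + v)" "{0..1}"] s a by fastforce
    show ?thesis
      unfolding uniform_limit_iff
    proof (intro allI impI)
      fix e :: real assume "e > 0"
      with u1 have "\<forall>\<^sub>F N in sequentially. \<forall>v\<in>{0..1}. dist (\<Sum>n<N. complex_of_real (real n + (a + v)) powr (-(s+1))) (hurwitz (s+1) (a + v)) < e"
        unfolding uniform_limit_iff by blast
      thus "\<forall>\<^sub>F N in sequentially. \<forall>v\<in>{0..1}. dist (\<Sum>n<N. f n v) (complex_of_real (1 - v) * hurwitz (s + 1) (a + v)) < e"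
      proof eventually_elim
        case (elim N)
        show ?case
        proof
          fix v :: real assume v: "v \<in> {0..1}"
          have "dist (\<Sum>n<N. f n v) (complex_of_real (1 - v) * hurwitz (s + 1) (a + v)) =
            norm (complex_of_real (1 - v) * ((\<Sum>n<N. complex_of_real (real n + (a + v)) powr (-(s+1))) - hurwitz (s+1) (a + v)))"
            by (simp add: dist_norm f_def sum_distrib_left right_diff_distrib)
          also have "\<dots> = (1 - v) * dist (\<Sum>n<N. complex_of_real (real n + (a + v)) powr (-(s+1))) (hurwitz (s+1) (a + v))"
            using v unfolding norm_mult dist_norm by (simp only: norm_of_real) simp
          also have "\<dots> \<le> 1 * dist (\<Sum>n<N. complex_of_real (real n + (a + v)) powr (-(s+1))) (hurwitz (s+1) (a + v))"
            using v by (intro mult_right_mono) auto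
          also have "\<dots> < e" using elim v by simp
          finally show "dist (\<Sum>n<N. f n v) (complex_of_real (1 - v) * hurwitz (s + 1) (a + v)) < e" .
        qed
      qed
    qed
  qed
  have contf: "continuous_on {0..1} (\<lambda>v. \<Sum>n<N. f n v)" for N
    unfolding f_def using a
    by (intro continuous_intros) (auto simp del: of_real_add)
  obtain I J where IJ: "\<And>N. ((\<lambda>v. \<Sum>n<N. f n v) has_integral I N) {0..1}"
      "((\<lambda>v. complex_of_real (1 - v) * hurwitz (s + 1) (a + v)) has_integral J) {0..1}" "I \<longlonglongrightarrow> J"
    using uniform_limit_integral[OF ul contf sequentially_bot] by blast
  have I: "I N = (\<Sum>n<N. A n 1 - A n 0)" for N
    by (rule has_integral_unique[OF IJ(1)]) (intro has_integral_sum int_f, auto)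
  have A: "A n 1 - A n 0 = (of_real (x n) powr (-s) + (of_real (x (Suc n)) powr (1 - s) - of_real (x n) powr (1 - s)) / (s - 1)) / s" for n
  proof -
    have xs: "complex_of_real (x (Suc n)) = of_real (x n) + 1" by (simp add: x_def)
    show ?thesis unfolding xs by (simp add: A_def diff_divide_distrib add_divide_distrib)
  qed
  have I': "I N = ((\<Sum>n<N. of_real (x n) powr (-s)) + (of_real (x N) powr (1 - s) - of_real (x 0) powr (1 - s)) / (s - 1)) / s" for N
    unfolding I A sum_divide_distrib[symmetric] sum.distrib
    by (simp only: sum_lessThan_telescope[of "\<lambda>n. complex_of_real (x n) powr (1 - s)"])
  have lim0: "(\<lambda>N. complex_of_real (x N) powr (1 - s)) \<longlonglongrightarrow> 0"
  proof (rule tendsto_norm_zero_cancel)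
    have "filterlim x at_top sequentially"
      unfolding x_def using filterlim_real_sequentially
      by (rule filterlim_at_top_mono) (use a in auto)
    hence "(\<lambda>N. x N powr (1 - Re s)) \<longlonglongrightarrow> 0"
      using s by (intro tendsto_neg_powr) auto
    thus "(\<lambda>N. norm (complex_of_real (x N) powr (1 - s))) \<longlonglongrightarrow> 0"
      using x by (simp add: norm_of_real_powr less_imp_le)
  qed
  have "I \<longlonglongrightarrow> (hurwitz s a + (0 - of_real (x 0) powr (1 - s)) / (s - 1)) / s"
    unfolding I' using hurwitz_sums[OF s a] s0
    by (intro tendsto_intros lim0) (auto simp: sums_def x_def)
  from LIMSEQ_unique[OF IJ(3) this]
  have J: "J = (hurwitz s a - of_real a powr (1 - s) / (s - 1)) / s" by (simp add: x_def)
  have "((\<lambda>v. s * (complex_of_real (1 - v) * hurwitz (s + 1) (a + v))) has_integral s * J) {0..1}"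
    using has_integral_mult_right[OF IJ(2)] .
  hence "integral {0..1} (\<lambda>v. s * (complex_of_real (1 - v) * hurwitz (s + 1) (a + v))) = s * J"
    by (rule integral_unique)
  hence "hurwitz_cont (Suc 0) s a = complex_of_real a powr (1 - s) + (s - 1) * (s * J)"
    using s0 by (simp add: mult_ac)
  thus ?thesis using s0 by (simp add: J divide_simps)
qed

lemma hurwitz_cont_Suc: "Re s > 1 - real k \<Longrightarrow> a > 0 \<Longrightarrow> hurwitz_cont (Suc k) s a = hurwitz_cont k s a"
proof (induction k arbitrary: s a)
  case 0
  thus ?case using hurwitz_cont_Suc_0 by simp
next
  case (Suc k)
  have "hurwitz_cont (Suc (Suc k)) s a = of_real a powr (1 - s) + (s - 1) * integral {0..1} (\<lambda>v. complex_of_real (1 - v) * hurwitz_cont (Suc k) (s + 1) (a + v))"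
    by simp
  also have "integral {0..1} (\<lambda>v. complex_of_real (1 - v) * hurwitz_cont (Suc k) (s + 1) (a + v)) =
             integral {0..1} (\<lambda>v. complex_of_real (1 - v) * hurwitz_cont k (s + 1) (a + v))"
    using Suc by (intro integral_cong arg_cong2[of _ _ _ _ "(*)"] refl Suc.IH) auto
  finally show ?case by simp
qed

lemma hurwitz_cont_stable:
  assumes "Re s > 1 - real k" "a > 0" "k \<le> m"
  shows "hurwitz_cont m s a = hurwitz_cont k s a"
  using assms(3)
proof (induction rule: dec_induct)
  case (step n)
  thus ?case using hurwitz_cont_Suc[of n s a] assms by simp
qed simp

text \<open>The entire function \<open>(s - 1) \<zeta>(s, a)\<close>.\<close>

definition hurwitz_entire :: "complex \<Rightarrow> real \<Rightarrow> complex" where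
  "hurwitz_entire s a = hurwitz_cont (nat \<lceil>2 - Re s\<rceil>) s a"

lemma hurwitz_entire_eq_hz:
  assumes "Re s > 1 - real k" "a > 0"
  shows "hurwitz_entire s a = hurwitz_cont k s a"
proof -
  have 1: "Re s > 1 - real (nat \<lceil>2 - Re s\<rceil>)" by linarith
  show ?thesis
    unfolding hurwitz_entire_def using hurwitz_cont_stable[OF assms] hurwitz_cont_stable[OF 1 assms(2)]
    by (metis nle_le)
qed

lemma hurwitz_entire_holomorphic:
  assumes a: "a > 0"
  shows "(\<lambda>s. hurwitz_entire s a) holomorphic_on UNIV"
proof -
  have "(\<lambda>s. hurwitz_entire s a) holomorphic_on {s. Re s > 1 - real k}" for k
    using hurwitz_cont_regular[of k] a hurwitz_entire_eq_hz[OF _ a] by (metis (no_types, lifting) holomorphic_transform mem_Collect_eq)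
  hence "(\<lambda>s. hurwitz_entire s a) holomorphic_on (\<Union>k. {s. Re s > 1 - real k})"
    by (intro holomorphic_on_UN_open open_halfspace_Re_gt) auto
  also have "(\<Union>k. {s. Re s > 1 - real k}) = UNIV"
  proof -
    have "\<exists>k. Re s > 1 - real k" for s by (metis diff_less_eq reals_Archimedean2 add.commute)
    thus ?thesis by auto
  qed
  finally show ?thesis .
qed

text \<open>In \<open>hurwitz_cont 1\<close> the factor s - 1 removes the integral and leaves a^0.
  The value is the residue of the Hurwitz zeta function at its pole.\<close>

lemma hurwitz_entire_1: "a > 0 \<Longrightarrow> hurwitz_entire 1 a = 1"
  by (subst hurwitz_entire_eq_hz[of 1]) auto

section \<open>Dirichlet characters and the continuation of their L-functions\<close>

lemma dirichlet_character_mod: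
  assumes "dirichlet_character q chi"
  shows "chi (a + k * q) = chi a"
proof (induction k)
  case (Suc k)
  have "chi (a + Suc k * q) = chi ((a + k * q) + q)" by (simp add: algebra_simps)
  also have "\<dots> = chi (a + k * q)" using assms unfolding dirichlet_character_def by blast
  finally show ?case using Suc by simp
qed simp

lemma dirichlet_character_cong:
  assumes "dirichlet_character q chi" "[a = b] (mod q)"
  shows "chi a = chi b"
proof -
  have "chi a = chi (a mod q)" for a
    using dirichlet_character_mod[OF assms(1), of "a mod q" "a div q"] by simp
  thus ?thesis using assms(2) by (metis cong_def)
qed

lemma dirichlet_character_1: "dirichlet_character q chi \<Longrightarrow> chi (Suc 0) = 1"
proof -
  assume chi: "dirichlet_character q chi"
  hence m: "\<forall>a b. chi (a * b) = chi a * chi b" and nz: "chi (Suc 0) \<noteq> 0"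
    unfolding dirichlet_character_def by auto
  show ?thesis using m[rule_format, of "Suc 0" "Suc 0"] nz by simp
qed

lemma dirichlet_character_power: "dirichlet_character q chi \<Longrightarrow> chi (a ^ k) = chi a ^ k"
proof (induction k)
  case (Suc k)
  thus ?case unfolding dirichlet_character_def by simp
qed (simp add: dirichlet_character_1)

lemma dirichlet_character_norm:
  assumes "dirichlet_character q chi"
  shows "norm (chi a) = (if coprime a q then 1 else 0)"
proof (cases "coprime a q")
  case True
  have q: "q > 0" using assms by (auto simp: dirichlet_character_def)
  have "[a ^ totient q = 1] (mod q)" using True euler_theorem by blast
  from dirichlet_character_cong[OF assms this]
  have "chi a ^ totient q = 1" using assms by (simp add: dirichlet_character_power dirichlet_character_1)
  moreover have "totient q > 0" using q by simp
  ultimately have "norm (chi a) = 1"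
    using power_eq_1_iff[of "norm (chi a)" "totient q"] by (simp flip: norm_power)
  thus ?thesis using True by simp
next
  case False
  thus ?thesis using assms unfolding dirichlet_character_def by auto
qed

lemma dirichlet_character_norm_le: "dirichlet_character q chi \<Longrightarrow> norm (chi a) \<le> 1"
  by (simp add: dirichlet_character_norm)

lemma dirichlet_character_trivial: "dirichlet_character (Suc 0) (\<lambda>_. 1)"
  by (simp add: dirichlet_character_def)

text \<open>This is (s - 1) L(s, chi), with the series split into residue classes modulo q. The
  representatives run over 1..q and not over 0..q-1, which keeps the Hurwitz parameter r / q
  positive.\<close>

definition L_entire :: "nat \<Rightarrow> (nat \<Rightarrow> complex) \<Rightarrow> complex \<Rightarrow> complex" where
  "L_entire q chi s = (\<Sum>r\<in>{1..q}. chi r * of_nat q powr (-s) * hurwitz_entire s (real r / real q))"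

lemma L_entire_holomorphic:
  assumes "dirichlet_character q chi"
  shows "L_entire q chi holomorphic_on UNIV"
  unfolding L_entire_def using assms
  by (auto intro!: holomorphic_intros hurwitz_entire_holomorphic simp: dirichlet_character_def)

lemma summable_nat_powr:
  assumes "Re s > 1"
  shows "summable (\<lambda>n. norm (of_nat (Suc n) powr (-s) :: complex))"
proof -
  have "summable (\<lambda>n. real n powr (- Re s))"
    using assms by (simp add: summable_real_powr_iff)
  hence "summable (\<lambda>n. real (Suc n) powr (- Re s))"
    by (subst summable_Suc_iff)
  moreover have "norm (of_nat (Suc n) powr (-s) :: complex) = real (Suc n) powr (- Re s)" for n
    using norm_of_real_powr[of "real (Suc n)" "-s"] by (simp del: of_nat_Suc)
  ultimately show ?thesis by (simp del: of_nat_Suc)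
qed

text \<open>Absolute convergence allows the series to be summed in blocks of length q, each of which
  takes one term from each of the q Hurwitz series.\<close>

lemma L_entire_sums:
  assumes chi: "dirichlet_character q chi" and s: "Re s > 1"
  shows "(\<lambda>n. chi (Suc n) / of_nat (Suc n) powr s) sums (L_entire q chi s / (s - 1))"
proof -
  have q: "q > 0" using chi by (auto simp: dirichlet_character_def)
  have s1: "s \<noteq> 1" using s by auto
  define g where "g = (\<lambda>n. chi (Suc n) * of_nat (Suc n) powr (-s))"
  have "summable (\<lambda>n. norm (g n))"
  proof (rule summable_comparison_test'[OF summable_nat_powr[OF s]])
    show "norm (norm (g n)) \<le> norm (of_nat (Suc n) powr (-s) :: complex)" for n
      using dirichlet_character_norm_le[OF chi, of "Suc n"]
      by (simp add: g_def norm_mult mult_left_le_one_le del: of_nat_Suc)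
  qed
  hence g: "g sums suminf g" by (simp add: summable_norm_cancel summable_sums)
  have "(\<lambda>n. sum g {n * q..<n * q + q}) sums suminf g"
    by (rule sums_group[OF g q])
  moreover have "(\<lambda>n. sum g {n * q..<n * q + q}) sums
      (\<Sum>r\<in>{1..q}. chi r * of_nat q powr (-s) * hurwitz s (real r / real q))"
  proof -
    have "(\<lambda>n. \<Sum>r\<in>{1..q}. chi r * of_nat q powr (-s) * of_real (real n + real r / real q) powr (-s)) sums
      (\<Sum>r\<in>{1..q}. chi r * of_nat q powr (-s) * hurwitz s (real r / real q))"
      using q by (intro sums_sum sums_mult hurwitz_sums s) auto
    moreover have "(\<Sum>r\<in>{1..q}. chi r * of_nat q powr (-s) * of_real (real n + real r / real q) powr (-s)) =
        sum g {n * q..<n * q + q}" for n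
    proof (rule sum.reindex_bij_witness[of _ "\<lambda>m. Suc m - n * q" "\<lambda>r. n * q + r - 1"])
      fix r assume r: "r \<in> {1..q}"
      \<comment> \<open>Index m of g carries the integer m + 1, so the class r in block n sits at m
        = n q + r - 1.\<close>
      hence eq: "Suc (n * q + r - 1) = r + n * q" by simp
      have "complex_of_nat q powr (-s) * of_real (real n + real r / real q) powr (-s) =
         (of_real (real q) * of_real (real n + real r / real q)) powr (-s)"
        using q by (subst powr_times_real) auto
      also have "complex_of_real (real q) * of_real (real n + real r / real q) = of_real (real (r + n * q))"
        unfolding of_real_mult[symmetric] using q by (intro arg_cong[where f = of_real]) (simp add: field_simps)
      finally show "g (n * q + r - 1) = chi r * of_nat q powr (-s) * of_real (real n + real r / real q) powr (-s)"
        unfolding g_def eq dirichlet_character_mod[OF chi] by (simp add: mult.assoc)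
    qed auto
    ultimately show ?thesis by simp
  qed
  ultimately have "suminf g = (\<Sum>r\<in>{1..q}. chi r * of_nat q powr (-s) * hurwitz s (real r / real q))"
    using sums_unique2 by blast
  also have "\<dots> = L_entire q chi s / (s - 1)"
    unfolding L_entire_def sum_divide_distrib
  proof (rule sum.cong, goal_cases)
    case (2 r)
    hence "hurwitz_entire s (real r / real q) = (s - 1) * hurwitz s (real r / real q)"
      using q s by (subst hurwitz_entire_eq_hz[of 0]) auto
    thus ?case using s1 by simp
  qed auto
  finally show ?thesis using g by (simp add: g_def powr_minus field_simps)
qed

text \<open>A difference that vanishes near 2 vanishes off a discrete set by the identity theorem.
  At the remaining points both functions are in normal form, so equality in a punctured
  neighbourhood forces the same pole or the same limit, hence the same value.\<close>

lemma nicely_meromorphic_unique: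
  assumes F: "F nicely_meromorphic_on UNIV" and G: "G nicely_meromorphic_on UNIV"
    and eq: "\<And>s. Re s > 1 \<Longrightarrow> F s = G s"
  shows "F = G"
proof
  fix z
  have mer: "F meromorphic_on UNIV" "G meromorphic_on UNIV"
    using F G by (auto simp: nicely_meromorphic_on_def)
  have fr: "\<exists>\<^sub>F s in at 2. F s - G s = 0"
  proof -
    have "eventually (\<lambda>s. s \<in> {s. Re s > 1}) (at (2 :: complex))"
      by (rule eventually_at_in_open'[OF open_halfspace_Re_gt]) auto
    hence "eventually (\<lambda>s. F s - G s = 0) (at 2)"
      by eventually_elim (use eq in auto)
    thus ?thesis by (intro eventually_frequently) auto
  qed
  have "(\<forall>\<^sub>\<approx>x\<in>UNIV. F x - G x = 0) \<or> (\<forall>\<^sub>\<approx>x\<in>UNIV. F x - G x \<noteq> 0)"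
    using mer by (intro meromorphic_imp_constant_or_avoid meromorphic_intros) auto
  hence ev: "\<forall>\<^sub>\<approx>x\<in>UNIV. F x = G x"
    using fr by (auto simp: eventually_cosparse_open_eq frequently_def)
  hence ev': "eventually (\<lambda>x. F x = G x) (at z)"
    by (auto simp: eventually_cosparse_open_eq)
  hence "is_pole F z \<longleftrightarrow> is_pole G z" by (intro is_pole_cong) auto
  moreover have "(F \<longlongrightarrow> c) (at z) \<longleftrightarrow> (G \<longlongrightarrow> c) (at z)" for c
    by (rule tendsto_cong[OF ev'])
  ultimately show "F z = G z"
  proof -
    assume p: "is_pole F z \<longleftrightarrow> is_pole G z" and l: "\<And>c. (F \<longlongrightarrow> c) (at z) \<longleftrightarrow> (G \<longlongrightarrow> c) (at z)"
    have Fz: "(is_pole F z \<and> F z = 0) \<or> F \<midarrow>z\<rightarrow> F z" and Gz: "(is_pole G z \<and> G z = 0) \<or> G \<midarrow>z\<rightarrow> G z"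
      using F G by (auto simp: nicely_meromorphic_on_def)
    have np: "\<not> is_pole G z" if "G \<midarrow>z\<rightarrow> c" for c
      using that not_tendsto_and_filterlim_at_infinity[of "at z" G c] by (auto simp: is_pole_def)
    from Fz show ?thesis
    proof
      assume "is_pole F z \<and> F z = 0"
      thus ?thesis using Gz p np by auto
    next
      assume "F \<midarrow>z\<rightarrow> F z"
      hence "G \<midarrow>z\<rightarrow> F z" using l by simp
      thus ?thesis using Gz np LIM_unique by blast
    qed
  qed
qed

text \<open>The definite description in \<open>dirichlet_L\<close> is resolved by exhibiting
  \<open>L_entire q chi s / (s - 1)\<close> with its singularity at 1 put into normal form;
  uniqueness is \<open>nicely_meromorphic_unique\<close>.\<close>

lemma dirichlet_L_props:
  assumes chi: "dirichlet_character q chi"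
  shows "dirichlet_L chi nicely_meromorphic_on UNIV"
    and "\<And>s. Re s > 1 \<Longrightarrow> (\<lambda>n. chi (Suc n) / of_nat (Suc n) powr s) sums dirichlet_L chi s"
    and "\<And>s. s \<noteq> 1 \<Longrightarrow> dirichlet_L chi s = L_entire q chi s / (s - 1)"
proof -
  define F where "F = remove_sings (\<lambda>s. L_entire q chi s / (s - 1))"
  have ana: "L_entire q chi analytic_on A" for A
    using L_entire_holomorphic[OF chi] analytic_on_holomorphic by blast
  have F1: "F nicely_meromorphic_on UNIV"
    unfolding F_def by (intro remove_sings_nicely_meromorphic meromorphic_intros analytic_on_imp_meromorphic_on ana)
  have F3: "F s = L_entire q chi s / (s - 1)" if "s \<noteq> 1" for s
    unfolding F_def using that by (intro remove_sings_at_analytic analytic_intros ana) auto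
  have F2: "(\<lambda>n. chi (Suc n) / of_nat (Suc n) powr s) sums F s" if "Re s > 1" for s
    using L_entire_sums[OF chi that] F3[of s] that by fastforce
  have "dirichlet_L chi = F"
    unfolding dirichlet_L_def
  proof (rule the_equality)
    fix G assume G: "G nicely_meromorphic_on UNIV \<and>
        (\<forall>s. Re s > 1 \<longrightarrow> (\<lambda>n. chi (Suc n) / of_nat (Suc n) powr s) sums G s)"
    show "G = F"
    proof (rule nicely_meromorphic_unique)
      show "G s = F s" if "Re s > 1" for s
        using G F2[OF that] that sums_unique2[of _ "G s" "F s"] by auto
    qed (use F1 G in auto)
  qed (use F1 F2 in auto)
  thus "dirichlet_L chi nicely_meromorphic_on UNIV"
     "\<And>s. Re s > 1 \<Longrightarrow> (\<lambda>n. chi (Suc n) / of_nat (Suc n) powr s) sums dirichlet_L chi s"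
     "\<And>s. s \<noteq> 1 \<Longrightarrow> dirichlet_L chi s = L_entire q chi s / (s - 1)"
    using F1 F2 F3 by auto
qed

lemma dirichlet_L_holomorphic_away:
  assumes "dirichlet_character q chi"
  shows "dirichlet_L chi holomorphic_on (- {1})"
proof -
  have "(\<lambda>s. L_entire q chi s / (s - 1)) holomorphic_on (- {1})"
    using L_entire_holomorphic[OF assms] by (auto intro!: holomorphic_intros intro: holomorphic_on_subset)
  thus ?thesis by (rule holomorphic_transform) (simp add: dirichlet_L_props(3)[OF assms])
qed

text \<open>Multiplication by an a coprime to q with chi a \<noteq> 1 permutes the reduced residues,
  hence it multiplies the sum by chi a without changing it.\<close>

lemma character_sum_zero:
  assumes chi: "dirichlet_character q chi" and np: "chi \<noteq> principal_character q"
  shows "(\<Sum>r\<in>{1..q}. chi r) = 0"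
proof -
  have q: "q > 0" using chi by (auto simp: dirichlet_character_def)
  obtain a where a: "coprime a q" "chi a \<noteq> 1"
  proof -
    from np obtain a where "chi a \<noteq> principal_character q a" by blast
    hence "coprime a q" "chi a \<noteq> 1"
      using chi unfolding principal_character_def dirichlet_character_def by (auto split: if_splits)
    thus ?thesis using that by blast
  qed
  have "chi a * (\<Sum>r\<in>totatives q. chi r) = (\<Sum>r\<in>totatives q. chi (a * r))"
    using chi by (simp add: sum_distrib_left dirichlet_character_def)
  also have "\<dots> = (\<Sum>r\<in>totatives q. chi r)"
  proof (cases "q = 1")
    \<comment> \<open>For q = 1 the set of totatives is {1} while a * r mod q is 0, so the
      permutation used in the other case does not act on it.\<close>
    case True
    hence "totatives q = {Suc 0}" by (simp add: totatives_def) auto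
    moreover have "chi (a * Suc 0) = chi (Suc 0)"
      by (rule dirichlet_character_cong[OF chi]) (simp add: True)
    ultimately show ?thesis by simp
  next
    case False
    hence q1: "q > 1" using q by simp
    have b: "bij_betw (\<lambda>r. a * r mod q) (totatives q) (totatives q)"
    proof (rule bij_betw_imageI)
      show inj: "inj_on (\<lambda>r. a * r mod q) (totatives q)"
      proof (rule inj_onI)
        fix x y assume xy: "x \<in> totatives q" "y \<in> totatives q" "a * x mod q = a * y mod q"
        hence "[x = y] (mod q)" using cong_mult_lcancel_nat[of a q x y] a(1) by (simp add: cong_def)
        thus "x = y" using totatives_less[OF xy(1) q1] totatives_less[OF xy(2) q1]
          by (simp add: cong_def)
      qed
      have "(\<lambda>r. a * r mod q) ` totatives q \<subseteq> totatives q"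
      proof clarify
        fix r assume r: "r \<in> totatives q"
        have cop: "coprime (a * r mod q) q" using a(1) r by (simp add: totatives_def)
        moreover have "a * r mod q \<noteq> 0" using cop q1 by (intro notI) simp
        ultimately show "a * r mod q \<in> totatives q" using q by (simp add: totatives_def less_imp_le)
      qed
      thus "(\<lambda>r. a * r mod q) ` totatives q = totatives q"
        using inj by (intro endo_inj_surj) auto
    qed
    have "(\<Sum>r\<in>totatives q. chi (a * r)) = (\<Sum>r\<in>totatives q. chi (a * r mod q))"
      by (intro sum.cong refl dirichlet_character_cong[OF chi]) (simp add: cong_def)
    also have "\<dots> = (\<Sum>r\<in>totatives q. chi r)"
      by (rule sum.reindex_bij_betw[OF b])
    finally show ?thesis .
  qed
  finally have "(\<Sum>r\<in>totatives q. chi r) = 0" using a(2) by simp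
  moreover have "(\<Sum>r\<in>{1..q}. chi r) = (\<Sum>r\<in>totatives q. chi r)"
    using chi by (intro sum.mono_neutral_right) (auto simp: totatives_def dirichlet_character_def)
  ultimately show ?thesis by simp
qed

text \<open>The residue at 1 is the character sum over a period divided by q, which vanishes. So
  \<open>L_entire\<close> has a zero at 1, the quotient tends to the derivative there, and the
  normal form of \<open>dirichlet_L\<close> takes this limit as its value.\<close>

lemma dirichlet_L_holomorphic:
  assumes chi: "dirichlet_character q chi" and np: "chi \<noteq> principal_character q"
  shows "dirichlet_L chi holomorphic_on UNIV"
proof -
  have q: "q > 0" using chi by (auto simp: dirichlet_character_def)
  have hol: "L_entire q chi holomorphic_on UNIV" by (rule L_entire_holomorphic[OF chi])
  have "L_entire q chi 1 = (\<Sum>r\<in>{1..q}. chi r * of_nat q powr (-1))"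
    unfolding L_entire_def using q by (intro sum.cong) (auto simp: hurwitz_entire_1)
  also have "\<dots> = 0" by (simp only: sum_distrib_right[symmetric] character_sum_zero[OF assms] mult_zero_left)
  finally have 0: "L_entire q chi 1 = 0" .
  have "(L_entire q chi has_field_derivative deriv (L_entire q chi) 1) (at 1)"
    using hol by (intro holomorphic_derivI) auto
  hence "(\<lambda>s. L_entire q chi s / (s - 1)) \<midarrow>1\<rightarrow> deriv (L_entire q chi) 1"
    by (simp add: has_field_derivative_iff 0)
  also have "?this \<longleftrightarrow> dirichlet_L chi \<midarrow>1\<rightarrow> deriv (L_entire q chi) 1"
    by (intro tendsto_cong) (auto simp: eventually_at_filter dirichlet_L_props(3)[OF chi])
  finally have lim: "dirichlet_L chi \<midarrow>1\<rightarrow> deriv (L_entire q chi) 1" .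
  hence "\<not> is_pole (dirichlet_L chi) 1"
    unfolding is_pole_def using not_tendsto_and_filterlim_at_infinity[of "at 1" "dirichlet_L chi"] by auto
  hence "dirichlet_L chi analytic_on {1}"
    using nicely_meromorphic_on_imp_analytic_at[OF dirichlet_L_props(1)[OF chi]] by simp
  moreover have "dirichlet_L chi analytic_on (- {1})"
    using dirichlet_L_holomorphic_away[OF chi] by (subst analytic_on_open) auto
  ultimately have "dirichlet_L chi analytic_on ({1} \<union> - {1})"
    by (simp only: analytic_on_Un)
  thus ?thesis by (simp add: analytic_imp_holomorphic)
qed

section \<open>Growth of L-functions for Re s >= 1/2\<close>

lemma norm_hurwitz_le:
  assumes s: "Re s \<ge> 3 / 2" and b: "b > 0"
  shows "norm (hurwitz s b) \<le> b powr (- Re s) + (\<Sum>n. real n powr (-3/2))"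
proof -
  have sZ: "summable (\<lambda>n. real n powr (-3/2))" by (simp add: summable_real_powr_iff)
  \<comment> \<open>Only the term n = 0 can be large when b is small, so it is kept apart from an
    absolute constant.\<close>
  have le: "(real n + b) powr (- Re s) \<le> (if n = 0 then b powr (- Re s) else 0) + real n powr (-3/2)" for n
  proof (cases "n = 0")
    case False
    have "(real n + b) powr (- Re s) \<le> (real n + b) powr (-3/2)"
      using s b False by (intro powr_mono) auto
    also have "\<dots> \<le> real n powr (-3/2)"
      using b False by (intro powr_mono2') auto
    finally show ?thesis using False by simp
  qed auto
  have nrm: "norm (complex_of_real (real n + b) powr (-s)) = (real n + b) powr (- Re s)" for n
    using b by (subst norm_of_real_powr) auto
  have s1: "(\<lambda>n. (if n = 0 then b powr (- Re s) else 0) + real n powr (-3/2)) sums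
     (b powr (- Re s) + (\<Sum>n. real n powr (-3/2)))"
    by (intro sums_add summable_sums sZ) (rule sums_single)
  have sm: "summable (\<lambda>n. norm (complex_of_real (real n + b) powr (-s)))"
    unfolding nrm by (rule summable_comparison_test'[OF sums_summable[OF s1]]) (use le in auto)
  have "norm (hurwitz s b) \<le> (\<Sum>n. norm (complex_of_real (real n + b) powr (-s)))"
    unfolding hurwitz_def by (rule summable_norm[OF sm])
  also have "\<dots> \<le> (\<Sum>n. (if n = 0 then b powr (- Re s) else 0) + real n powr (-3/2))"
    using sm unfolding nrm by (intro suminf_le le sums_summable[OF s1])
  also have "\<dots> = b powr (- Re s) + (\<Sum>n. real n powr (-3/2))"
    using s1 by (rule sums_unique[symmetric])
  finally show ?thesis .
qed

text \<open>One step of the continuation, \<open>hurwitz_cont 1\<close>, reaches Re s > 0 and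
  involves only the convergent series at s + 1. With a >= 1/q the large term a^(-Re s - 1) is at
  most q^(Re s + 1), and the prefactor q^(-s) brings this down to q; summing over q classes gives
  q^2. Any polynomial bound would serve, as only its logarithm enters later.\<close>

lemma L_entire_bound:
  "\<exists>C>0. \<forall>q chi s. dirichlet_character q chi \<longrightarrow> Re s \<ge> 1 / 2 \<longrightarrow>
     norm (L_entire q chi s) \<le> C * real q ^ 2 * (1 + norm s) ^ 2"
proof -
  define Z where "Z = (\<Sum>n. real n powr (-3/2))"
  have Z: "Z \<ge> 0" unfolding Z_def by (intro suminf_nonneg) (auto simp: summable_real_powr_iff)
  have "norm (L_entire q chi s) \<le> (1 + Z) * real q ^ 2 * (1 + norm s) ^ 2"
    if chi: "dirichlet_character q chi" and s: "Re s \<ge> 1 / 2" for q chi s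
  proof -
    have q: "q \<ge> 1" using chi by (auto simp: dirichlet_character_def Suc_le_eq)
    have trm: "norm (chi r * of_nat q powr (-s) * hurwitz_entire s (real r / real q)) \<le> real q * (1 + Z) * (1 + norm s)^2"
      if r: "r \<in> {1..q}" for r
    proof -
      define a where "a = real r / real q"
      have a: "a > 0" "a \<le> 1" "a \<ge> 1 / real q" using r q by (auto simp: a_def divide_simps)
      define W where "W = a powr (- Re s - 1)"
      have W0: "W \<ge> 0" by (simp add: W_def)
      have "W \<le> (1 / real q) powr (- Re s - 1)"
        unfolding W_def using a q s by (intro powr_mono2') auto
      also have "\<dots> = real q powr (Re s + 1)"
        using q by (simp add: powr_divide powr_minus_divide powr_diff powr_add)
      finally have W: "W \<le> real q powr (Re s + 1)" .
      have qW: "real q powr (- Re s) * W \<le> real q"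
      proof -
        have "real q powr (- Re s) * W \<le> real q powr (- Re s) * real q powr (Re s + 1)"
          using W by (intro mult_left_mono) auto
        also have "\<dots> = real q" using q by (simp flip: powr_add)
        finally show ?thesis .
      qed
      have q1: "real q powr (- Re s) \<le> 1"
        using q s powr_mono[of "- Re s" 0 "real q"] by simp
      have contH: "continuous_on {0..1} (\<lambda>v. complex_of_real (1 - v) * (s * hurwitz (s + 1) (a + v)))"
        using s a hurwitz_continuous
        by (intro continuous_intros continuous_on_compose2[OF hurwitz_continuous[unfolded split_beta'], of _ "\<lambda>v. (s + 1, a + v)", simplified]) auto
      have "norm (integral {0..1} (\<lambda>v. complex_of_real (1 - v) * (s * hurwitz (s + 1) (a + v)))) \<le>
              (norm s * (W + Z)) * (1 - 0)"
      proof (rule integral_bound[OF _ contH])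
        fix v :: real assume v: "v \<in> {0..1}"
        have "norm (hurwitz (s + 1) (a + v)) \<le> (a + v) powr (- Re (s + 1)) + Z"
          unfolding Z_def using a v s by (intro norm_hurwitz_le) auto
        also have "(a + v) powr (- Re (s + 1)) \<le> a powr (- Re (s + 1))"
          using a v s by (intro powr_mono2') auto
        also have "\<dots> = W" by (simp add: W_def)
        finally have H: "norm (hurwitz (s + 1) (a + v)) \<le> W + Z" by simp
        have "norm (complex_of_real (1 - v) * (s * hurwitz (s + 1) (a + v))) = (1 - v) * (norm s * norm (hurwitz (s + 1) (a + v)))"
          using v unfolding norm_mult by (simp only: norm_of_real) simp
        also have "\<dots> \<le> 1 * (norm s * (W + Z))"
          using v H W0 Z by (intro mult_mono) auto
        finally show "norm (complex_of_real (1 - v) * (s * hurwitz (s + 1) (a + v))) \<le> norm s * (W + Z)" by simp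
      qed simp
      hence int: "norm (integral {0..1} (\<lambda>v. complex_of_real (1 - v) * (s * hurwitz (s + 1) (a + v)))) \<le> norm s * (W + Z)"
        by simp
      have "hurwitz_entire s a = of_real a powr (1 - s) + (s - 1) * integral {0..1} (\<lambda>v. complex_of_real (1 - v) * (s * hurwitz (s + 1) (a + v)))"
        using s a by (subst hurwitz_entire_eq_hz[of 1]) auto
      also have "norm \<dots> \<le> norm (complex_of_real a powr (1 - s)) + norm (s - 1) * (norm s * (W + Z))"
        using int by (intro norm_triangle_le add_mono) (auto simp: norm_mult intro!: mult_left_mono)
      also have "norm (complex_of_real a powr (1 - s)) = a powr (1 - Re s)"
        using a by (subst norm_of_real_powr) auto
      also have "\<dots> \<le> W"
        unfolding W_def using a s by (intro powr_mono') auto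
      finally have he: "norm (hurwitz_entire s a) \<le> W + norm (s - 1) * (norm s * (W + Z))" by simp
      have nq: "norm (of_nat q powr (-s) :: complex) = real q powr (- Re s)"
        using norm_of_real_powr[of "real q" "-s"] by simp
      have "norm (chi r * of_nat q powr (-s) * hurwitz_entire s a) \<le> 1 * real q powr (- Re s) * (W + norm (s - 1) * (norm s * (W + Z)))"
        unfolding norm_mult nq using he dirichlet_character_norm_le[OF chi, of r]
        by (intro mult_mono) auto
      also have "\<dots> = real q powr (- Re s) * W + norm (s - 1) * norm s * (real q powr (- Re s) * W + real q powr (- Re s) * Z)"
        by (simp add: algebra_simps)
      also have "\<dots> \<le> real q + (1 + norm s) * norm s * (real q + 1 * Z)"
        using qW q1 Z W0 norm_triangle_ineq4[of s 1] by (intro add_mono mult_mono) auto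
      also have "\<dots> \<le> real q * (1 + Z) + (1 + norm s) * norm s * (real q * (1 + Z))"
      proof -
        have "real q + 1 * Z \<le> real q * (1 + Z)" using q Z mult_right_mono[of 1 "real q" Z] by (simp add: algebra_simps)
        moreover have "real q \<le> real q * (1 + Z)" using q Z by simp
        ultimately show ?thesis by (intro add_mono mult_left_mono) auto
      qed
      also have "\<dots> = real q * (1 + Z) * (1 + norm s + norm s ^ 2)" by (simp add: algebra_simps power2_eq_square)
      also have "\<dots> \<le> real q * (1 + Z) * (1 + norm s)^2"
        using Z by (intro mult_left_mono) (auto simp: power2_eq_square algebra_simps)
      finally show ?thesis by (simp add: a_def)
    qed
    have "norm (L_entire q chi s) \<le> (\<Sum>r\<in>{1..q}. real q * (1 + Z) * (1 + norm s)^2)"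
      unfolding L_entire_def by (rule sum_norm_le[OF trm])
    also have "\<dots> = (1 + Z) * real q ^ 2 * (1 + norm s) ^ 2" by (simp add: power2_eq_square)
    finally show ?thesis .
  qed
  thus ?thesis using Z by (intro exI[of _ "1 + Z"]) auto
qed

text \<open>Division by s - 1 is harmless away from 1. Near 1 a non-principal L-function is
  holomorphic, so the maximum principle on the disc of radius 1/4 carries the bound inwards from the
  boundary; 2 + |s| in place of 1 + |s| pays for moving from boundary points to s. For principal
  characters the condition on Im s keeps clear of the pole.\<close>

lemma dirichlet_L_bound:
  "\<exists>C>0. \<forall>q chi s. dirichlet_character q chi \<longrightarrow> Re s \<ge> 1 / 2 \<longrightarrow>
     chi \<noteq> principal_character q \<or> \<bar>Im s\<bar> \<ge> 1 \<longrightarrow>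
     norm (dirichlet_L chi s) \<le> C * real q ^ 2 * (2 + norm s) ^ 2"
proof -
  obtain C where C: "C > 0" "\<And>q chi s. dirichlet_character q chi \<Longrightarrow> Re s \<ge> 1 / 2 \<Longrightarrow>
     norm (L_entire q chi s) \<le> C * real q ^ 2 * (1 + norm s) ^ 2"
    using L_entire_bound by blast
  have far: "norm (dirichlet_L chi s) \<le> 4 * C * real q ^ 2 * (1 + norm s) ^ 2"
    if chi: "dirichlet_character q chi" and s: "Re s \<ge> 1 / 2" "norm (s - 1) \<ge> 1 / 4" for q chi s
  proof -
    have "s \<noteq> 1" using s by auto
    hence "norm (dirichlet_L chi s) = norm (L_entire q chi s) / norm (s - 1)"
      by (simp add: dirichlet_L_props(3)[OF chi] norm_divide)
    also have "\<dots> \<le> (C * real q ^ 2 * (1 + norm s) ^ 2) / (1/4)"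
      using C(2)[OF chi s(1)] s(2) C(1) by (intro frac_le) auto
    finally show ?thesis by simp
  qed
  have "norm (dirichlet_L chi s) \<le> 4 * C * real q ^ 2 * (2 + norm s) ^ 2"
    if chi: "dirichlet_character q chi" and s: "Re s \<ge> 1 / 2" and alt: "chi \<noteq> principal_character q \<or> \<bar>Im s\<bar> \<ge> 1" for q chi s
  proof (cases "norm (s - 1) \<ge> 1 / 4")
    case True
    have "4 * C * real q ^ 2 * (1 + norm s) ^ 2 \<le> 4 * C * real q ^ 2 * (2 + norm s) ^ 2"
      using C by (intro mult_left_mono power_mono) auto
    thus ?thesis using far[OF chi s True] by simp
  next
    case False
    have "\<bar>Im s\<bar> < 1" using False abs_Im_le_cmod[of "s - 1"] by simp
    hence np: "chi \<noteq> principal_character q" using alt by auto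
    note hol = dirichlet_L_holomorphic[OF chi np]
    have sp: "norm s > 1 / 2" using False norm_triangle_ineq2[of 1 "1 - s"] by (simp add: norm_minus_commute)
    show ?thesis
    proof (rule maximum_modulus_frontier[of "dirichlet_L chi" "ball 1 (1/4)"])
      fix z :: complex assume "z \<in> frontier (ball 1 (1/4))"
      hence z: "norm (z - 1) = 1 / 4" by (simp add: dist_norm norm_minus_commute)
      have "Re z \<ge> 1 / 2" using z abs_Re_le_cmod[of "z - 1"] by auto
      hence "norm (dirichlet_L chi z) \<le> 4 * C * real q ^ 2 * (1 + norm z) ^ 2"
        using far[OF chi] z by simp
      also have "\<dots> \<le> 4 * C * real q ^ 2 * (2 + norm s) ^ 2"
      proof (intro mult_left_mono power_mono)
        show "1 + norm z \<le> 2 + norm s" using z sp norm_triangle_ineq2[of z 1] by simp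
      qed (use C(1) in auto)
      finally show "norm (dirichlet_L chi z) \<le> 4 * C * real q ^ 2 * (2 + norm s) ^ 2" .
    qed (use False hol in \<open>auto simp: dist_norm norm_minus_commute intro: holomorphic_on_subset
          intro!: holomorphic_on_imp_continuous_on\<close>)
  qed
  thus ?thesis using C(1) by (intro exI[of _ "4 * C"]) auto
qed

section \<open>Dirichlet series\<close>

text \<open>The sum starts at n = 0, where \<open>of_nat 0 powr (-s)\<close> is 0 by
  convention.\<close>

definition dirichlet_series :: "(nat \<Rightarrow> complex) \<Rightarrow> complex \<Rightarrow> complex" where
  "dirichlet_series a s = (\<Sum>n. a n * of_nat n powr (-s))"

text \<open>\<sigma> is any upper bound for the abscissa of absolute convergence, not the abscissa
  itself, so the property passes to smaller coefficients and survives a factor log n.\<close>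

definition abs_conv_beyond :: "(nat \<Rightarrow> complex) \<Rightarrow> real \<Rightarrow> bool" where
  "abs_conv_beyond a \<sigma> \<longleftrightarrow> (\<forall>x>\<sigma>. summable (\<lambda>n. norm (a n) * real n powr (-x)))"

lemma norm_of_nat_powr: "norm (of_nat n powr s :: complex) = real n powr Re s"
  using norm_of_real_powr[of "real n" s] by simp

lemma dirichlet_series_abs_summable:
  "abs_conv_beyond a \<sigma> \<Longrightarrow> Re s > \<sigma> \<Longrightarrow> summable (\<lambda>n. norm (a n * of_nat n powr (-s)))"
  by (simp add: abs_conv_beyond_def norm_mult norm_of_nat_powr)

lemma dirichlet_series_sums:
  "abs_conv_beyond a \<sigma> \<Longrightarrow> Re s > \<sigma> \<Longrightarrow> (\<lambda>n. a n * of_nat n powr (-s)) sums dirichlet_series a s"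
  unfolding dirichlet_series_def by (rule summable_sums[OF summable_norm_cancel[OF dirichlet_series_abs_summable]])

lemma ln_le_powr_div: "n > 0 \<Longrightarrow> d > 0 \<Longrightarrow> ln (real n) \<le> real n powr d / d"
  by (intro ln_powr_bound) auto

lemma abs_conv_beyond_ln:
  assumes "abs_conv_beyond a \<sigma>"
  shows "abs_conv_beyond (\<lambda>n. of_real (ln (real n)) * a n) \<sigma>"
  unfolding abs_conv_beyond_def
proof (intro allI impI)
  fix x assume x: "x > \<sigma>"
  \<comment> \<open>Half of the room between \<sigma> and x absorbs the logarithm; the other half is
    left for convergence.\<close>
  define d where "d = (x - \<sigma>) / 2"
  have d: "d > 0" "x - d > \<sigma>" using x by (auto simp: d_def field_simps)
  have s: "summable (\<lambda>n. inverse d * (norm (a n) * real n powr (-(x - d))))"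
    using assms d by (intro summable_mult) (auto simp: abs_conv_beyond_def)
  show "summable (\<lambda>n. norm (of_real (ln (real n)) * a n) * real n powr (-x))"
  proof (rule summable_comparison_test'[OF s])
    fix n :: nat
    show "norm (norm (of_real (ln (real n)) * a n) * real n powr (-x)) \<le> inverse d * (norm (a n) * real n powr (-(x - d)))"
    proof (cases "n = 0")
      case False
      have "\<bar>ln (real n)\<bar> \<le> real n powr d / d" using ln_le_powr_div[of n d] False d by simp
      hence "norm (a n) * real n powr (-x) * \<bar>ln (real n)\<bar> \<le> norm (a n) * real n powr (-x) * (real n powr d / d)"
        by (intro mult_left_mono) auto
      also have "\<dots> = inverse d * (norm (a n) * (real n powr (-x) * real n powr d))"
        by (simp add: field_simps)
      also have "real n powr (-x) * real n powr d = real n powr (-(x - d))"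
        by (simp flip: powr_add)
      finally show ?thesis by (simp add: norm_mult mult_ac)
    qed auto
  qed
qed

lemma abs_conv_beyond_mono:
  assumes "abs_conv_beyond a \<sigma>" "\<And>n. norm (b n) \<le> norm (a n)" "\<sigma> \<le> \<tau>"
  shows "abs_conv_beyond b \<tau>"
  unfolding abs_conv_beyond_def
proof (intro allI impI)
  fix x assume "x > \<tau>"
  hence s: "summable (\<lambda>n. norm (a n) * real n powr (-x))"
    using assms by (auto simp: abs_conv_beyond_def)
  show "summable (\<lambda>n. norm (b n) * real n powr (-x))"
    by (rule summable_comparison_test'[OF s]) (use assms(2) in \<open>auto intro!: mult_right_mono\<close>)
qed

lemma abs_conv_beyond_bounded:
  assumes "\<And>n. norm (a n) \<le> 1"
  shows "abs_conv_beyond a 1"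
  by (rule abs_conv_beyond_mono[of "\<lambda>_. 1"]) (use assms in \<open>auto simp: abs_conv_beyond_def summable_real_powr_iff\<close>)

text \<open>Term-by-term differentiation, justified on a disc of radius half the distance to the
  line Re s = \<sigma>, where one summable majorant serves all points.\<close>

lemma dirichlet_series_has_derivative:
  assumes a: "abs_conv_beyond a \<sigma>" and s: "Re s > \<sigma>"
  shows "(dirichlet_series a has_field_derivative dirichlet_series (\<lambda>n. - (of_real (ln (real n)) * a n)) s) (at s)"
proof -
  define S where "S = {s. Re s > \<sigma>}"
  have S: "open S" unfolding S_def by (rule open_halfspace_Re_gt)
  define f where "f = (\<lambda>n s. a n * of_nat n powr (-s) :: complex)"
  define f' where "f' = (\<lambda>n s. - (of_real (ln (real n)) * a n) * of_nat n powr (-s) :: complex)"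
  have "\<exists>g g'. \<forall>x \<in> S. ((\<lambda>n. f n x) sums g x) \<and> ((\<lambda>n. f' n x) sums g' x) \<and> (g has_field_derivative g' x) (at x)"
  proof (rule series_and_derivative_comparison_complex[OF S])
    show "(f n has_field_derivative f' n x) (at x)" if "x \<in> S" for n x
    proof (cases "n = 0")
      case False
      hence eq: "complex_of_nat n powr (-z) = exp (- z * of_real (ln (real n)))" for z
        by (simp add: powr_def Ln_of_nat)
      show ?thesis unfolding f_def f'_def eq
        by (auto intro!: derivative_eq_intros)
    qed (simp add: f_def f'_def)
    fix x assume x: "x \<in> S"
    define d where "d = (Re x - \<sigma>) / 2"
    have d: "d > 0" "Re x - d > \<sigma>" using x by (auto simp: d_def S_def field_simps)
    define h where "h = (\<lambda>n. norm (a n) * real n powr (-(Re x - d)))"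
    have sh: "summable h" using a d unfolding h_def abs_conv_beyond_def by auto
    have "norm (f n y) \<le> norm (complex_of_real (h n))" if "y \<in> ball x d" for n y
    proof (cases "n = 0")
      case False
      have "Re y \<ge> Re x - d" using that complex_Re_le_cmod[of "x - y"] by (auto simp: dist_norm)
      hence "norm (a n) * real n powr (- Re y) \<le> norm (a n) * real n powr (-(Re x - d))"
        using False by (intro mult_left_mono powr_mono) auto
      thus ?thesis by (simp add: f_def h_def norm_mult norm_of_nat_powr)
    qed (simp add: f_def)
    moreover have "summable (\<lambda>n. complex_of_real (h n))" by (rule summable_of_real[OF sh])
    moreover have "range (\<lambda>n. complex_of_real (h n)) \<subseteq> \<real>\<^sub>\<ge>\<^sub>0" by (auto simp: h_def)
    ultimately show "\<exists>d h. 0 < d \<and> summable h \<and> range h \<subseteq> \<real>\<^sub>\<ge>\<^sub>0 \<and>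
             (\<forall>\<^sub>F n in sequentially. \<forall>y\<in>ball x d \<inter> S. cmod (f n y) \<le> cmod (h n))"
      using d by (intro exI[of _ d] exI[of _ "\<lambda>n. complex_of_real (h n)"]) auto
  qed
  then obtain g g' where g: "\<And>x. x \<in> S \<Longrightarrow> (\<lambda>n. f n x) sums g x" "\<And>x. x \<in> S \<Longrightarrow> (\<lambda>n. f' n x) sums g' x"
     "\<And>x. x \<in> S \<Longrightarrow> (g has_field_derivative g' x) (at x)" by blast
  have eq: "g x = dirichlet_series a x" "g' x = dirichlet_series (\<lambda>n. - (of_real (ln (real n)) * a n)) x" if "x \<in> S" for x
    using sums_unique[OF g(1)[OF that]] sums_unique[OF g(2)[OF that]] by (simp_all add: dirichlet_series_def f_def f'_def)
  have sS: "s \<in> S" using s by (simp add: S_def)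
  show ?thesis
    using has_field_derivative_transform_within_open[OF g(3)[OF sS] S sS eq(1)] eq(2)[OF sS] by simp
qed

lemma dirichlet_series_holomorphic: "abs_conv_beyond a \<sigma> \<Longrightarrow> dirichlet_series a holomorphic_on {s. Re s > \<sigma>}"
  by (subst holomorphic_on_open[OF open_halfspace_Re_gt]) (use dirichlet_series_has_derivative in blast)

lemma dirichlet_series_minus: "dirichlet_series (\<lambda>n. - a n) s = - dirichlet_series a s" if "abs_conv_beyond a \<sigma>" "Re s > \<sigma>"
  using sums_unique[OF sums_minus[OF dirichlet_series_sums[OF that]]] by (simp add: dirichlet_series_def)

text \<open>Absolute convergence makes the product a sum over pairs (m, n), which is regrouped by
  the value k = m n.\<close>

lemma dirichlet_series_mult:
  assumes a: "abs_conv_beyond a \<sigma>" and b: "abs_conv_beyond b \<sigma>" and s: "Re s > \<sigma>"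
  shows "dirichlet_series a s * dirichlet_series b s = dirichlet_series (\<lambda>n. \<Sum>d | d dvd n. a d * b (n div d)) s"
proof -
  define fa where "fa = (\<lambda>n. a n * of_nat n powr (-s) :: complex)"
  define fb where "fb = (\<lambda>n. b n * of_nat n powr (-s) :: complex)"
  have A: "(fa has_sum dirichlet_series a s) UNIV" "summable (\<lambda>n. norm (fa n))"
    unfolding fa_def using dirichlet_series_abs_summable[OF a s] dirichlet_series_sums[OF a s] by (auto intro: norm_summable_imp_has_sum)
  have B: "(fb has_sum dirichlet_series b s) UNIV" "summable (\<lambda>n. norm (fb n))"
    unfolding fb_def using dirichlet_series_abs_summable[OF b s] dirichlet_series_sums[OF b s] by (auto intro: norm_summable_imp_has_sum)
  have nA: "(\<lambda>n. norm (fa n)) summable_on UNIV" and nB: "(\<lambda>n. norm (fb n)) summable_on UNIV"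
    using A(2) B(2) by (auto intro!: norm_summable_imp_summable_on)
  have sm: "(\<lambda>(m, n). fa m * fb n) summable_on (UNIV \<times> UNIV)"
  proof (rule abs_summable_summable)
    show "(\<lambda>x. norm (case x of (m, n) \<Rightarrow> fa m * fb n)) summable_on UNIV \<times> UNIV"
    proof (rule summable_on_SigmaI)
      show "((\<lambda>n. norm (case (m, n) of (m, n) \<Rightarrow> fa m * fb n)) has_sum (norm (fa m) * infsum (\<lambda>n. norm (fb n)) UNIV)) UNIV" for m
        using has_sum_cmult_right[OF has_sum_infsum[OF nB], of "norm (fa m)"] by (simp add: norm_mult)
      show "(\<lambda>m. norm (fa m) * infsum (\<lambda>n. norm (fb n)) UNIV) summable_on UNIV"
        using nA by (intro summable_on_cmult_left)
    qed auto
  qed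
  have "((\<lambda>(m, n). fa m * fb n) has_sum dirichlet_series a s * dirichlet_series b s) (UNIV \<times> UNIV)"
  proof (rule has_sum_SigmaI[OF _ _ sm])
    show "((\<lambda>n. case (m, n) of (m, n) \<Rightarrow> fa m * fb n) has_sum fa m * dirichlet_series b s) UNIV" for m
      using has_sum_cmult_right[OF B(1)] by simp
    show "((\<lambda>m. fa m * dirichlet_series b s) has_sum dirichlet_series a s * dirichlet_series b s) UNIV"
      using has_sum_cmult_left[OF A(1)] .
  qed
  \<comment> \<open>The index 0 contributes nothing and has to go before the regrouping: 0 has
    infinitely many divisors.\<close>
  also have "?this \<longleftrightarrow> ((\<lambda>(m, n). fa m * fb n) has_sum dirichlet_series a s * dirichlet_series b s) ({0<..} \<times> {0<..})"
    by (rule has_sum_cong_neutral) (auto simp: fa_def fb_def)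
  also have "\<dots> \<longleftrightarrow> ((\<lambda>(k, d). fa d * fb (k div d)) has_sum dirichlet_series a s * dirichlet_series b s) (Sigma {0<..} (\<lambda>k. {d. d dvd k}))"
    by (rule has_sum_reindex_bij_witness[of _ "\<lambda>(k, d). (d, k div d)" "\<lambda>(m, n). (m * n, m)"])
       (auto intro: Nat.gr0I elim!: dvdE)
  finally have "((\<lambda>k. \<Sum>d | d dvd k. fa d * fb (k div d)) has_sum dirichlet_series a s * dirichlet_series b s) {0<..}"
    by (rule has_sum_SigmaD) (auto intro!: has_sum_finiteI)
  also have "?this \<longleftrightarrow> ((\<lambda>k. (\<Sum>d | d dvd k. a d * b (k div d)) * of_nat k powr (-s)) has_sum dirichlet_series a s * dirichlet_series b s) UNIV"
  proof (rule has_sum_cong_neutral)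
    fix k :: nat assume "k \<in> {0<..} \<inter> UNIV"
    hence k: "k > 0" by simp
    show "(\<Sum>d | d dvd k. fa d * fb (k div d)) = (\<Sum>d | d dvd k. a d * b (k div d)) * of_nat k powr (-s)"
      unfolding sum_distrib_right
    proof (rule sum.cong[OF refl])
      fix d assume "d \<in> {d. d dvd k}"
      then obtain e where e: "k = d * e" by auto
      have "d > 0" using e k by (cases d) auto
      moreover have "of_nat k powr (-s) = of_nat d powr (-s) * (of_nat e powr (-s) :: complex)"
        using powr_times_real[of "of_nat d" "of_nat e" "-s"] unfolding e by (simp)
      ultimately show "fa d * fb (k div d) = a d * b (k div d) * of_nat k powr (-s)"
        by (simp add: fa_def fb_def e mult_ac)
    qed
  qed auto
  finally show ?thesis unfolding dirichlet_series_def by (rule sums_unique[OF has_sum_imp_sums])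
qed

text \<open>Its purpose is to pin down the constant of integration in
  \<open>dirichlet_L_eq_exp\<close>: along the real axis everything but the term n = 1 decays like
  2^(-x).\<close>

lemma dirichlet_series_tendsto_at_top:
  assumes a: "abs_conv_beyond a \<sigma>"
  shows "((\<lambda>x. dirichlet_series a (complex_of_real x)) \<longlongrightarrow> a 1) at_top"
proof -
  define x0 where "x0 = \<bar>\<sigma>\<bar> + 1"
  have x0: "x0 > \<sigma>" "x0 \<ge> 1" by (auto simp: x0_def)
  define Z where "Z = (\<Sum>n. norm (a n) * real n powr (-x0))"
  have sZ: "summable (\<lambda>n. norm (a n) * real n powr (-x0))" using a x0 by (auto simp: abs_conv_beyond_def)
  have bd: "norm (dirichlet_series a (complex_of_real x) - a 1) \<le> Z * 2 powr (x0 - x)" if x: "x \<ge> x0" for x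
  proof -
    define t where "t = (\<lambda>n. a n * of_nat n powr (- complex_of_real x))"
    have st: "t sums dirichlet_series a (of_real x)" unfolding t_def using x x0 by (intro dirichlet_series_sums[OF a]) auto
    have s1: "(\<lambda>n. if n = 1 then t 1 else 0) sums t 1" by (rule sums_single)
    have "t 1 = a 1" by (simp add: t_def)
    hence s2: "(\<lambda>n. t n - (if n = 1 then t 1 else 0)) sums (dirichlet_series a (of_real x) - a 1)"
      using sums_diff[OF st s1] by simp
    have le: "norm (t n - (if n = 1 then t 1 else 0)) \<le> norm (a n) * real n powr (-x0) * 2 powr (x0 - x)" for n
    proof (cases "n < 2")
      case True
      hence "n = 0 \<or> n = 1" by auto
      thus ?thesis by (auto simp: t_def)
    next
      case False
      have "norm (t n) = norm (a n) * real n powr (-x0) * real n powr (x0 - x)"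
        by (simp add: t_def norm_mult norm_of_nat_powr flip: powr_add)
      also have "\<dots> \<le> norm (a n) * real n powr (-x0) * 2 powr (x0 - x)"
        using False x by (intro mult_left_mono powr_mono2') auto
      finally show ?thesis using False by simp
    qed
    have "norm (\<Sum>n. t n - (if n = 1 then t 1 else 0)) \<le> (\<Sum>n. norm (a n) * real n powr (-x0) * 2 powr (x0 - x))"
      by (intro norm_suminf_le le summable_mult2 sZ)
    also have "\<dots> = Z * 2 powr (x0 - x)" unfolding Z_def by (rule suminf_mult2[symmetric, OF sZ])
    also have "(\<Sum>n. t n - (if n = 1 then t 1 else 0)) = dirichlet_series a (of_real x) - a 1"
      using sums_unique[OF s2] by simp
    finally show ?thesis .
  qed
  have "((\<lambda>x. Z * 2 powr (x0 - x)) \<longlongrightarrow> 0) at_top" by real_asymp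
  moreover have "\<forall>\<^sub>F x in at_top. norm (dirichlet_series a (complex_of_real x) - a 1) \<le> Z * 2 powr (x0 - x)"
    using eventually_ge_at_top[of x0] by eventually_elim (rule bd)
  ultimately have "((\<lambda>x. dirichlet_series a (complex_of_real x) - a 1) \<longlongrightarrow> 0) at_top"
    by (metis Lim_null_comparison)
  thus ?thesis by (simp add: LIM_zero_iff)
qed

section \<open>Logarithmic derivative, logarithm and reciprocal of L-functions\<close>

lemma dirichlet_L_eq_dser:
  assumes chi: "dirichlet_character q chi" and s: "Re s > 1"
  shows "dirichlet_L chi s = dirichlet_series chi s"
proof -
  have "(\<lambda>n. chi (Suc n) * of_nat (Suc n) powr (-s)) sums dirichlet_L chi s"
    using dirichlet_L_props(2)[OF chi s] by (simp add: powr_minus divide_inverse del: of_nat_Suc)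
  hence "(\<lambda>n. chi n * of_nat n powr (-s)) sums dirichlet_L chi s"
    by (subst (asm) sums_Suc_iff) auto
  thus ?thesis unfolding dirichlet_series_def by (rule sums_unique)
qed

lemma abs_conv_character: "dirichlet_character q chi \<Longrightarrow> abs_conv_beyond chi 1"
  by (intro abs_conv_beyond_bounded) (rule dirichlet_character_norm_le)

lemma norm_mangoldt_le: "norm (mangoldt n :: complex) \<le> norm (complex_of_real (ln (real n)) * 1)"
  by (cases "n = 0") (auto simp: mangoldt_le)

lemma abs_conv_mangoldt_character:
  assumes "dirichlet_character q chi"
  shows "abs_conv_beyond (\<lambda>n. mangoldt n * chi n) 1"
proof (rule abs_conv_beyond_mono[OF abs_conv_beyond_ln[of "\<lambda>_. 1" 1]])
  show "norm (mangoldt n * chi n) \<le> norm (complex_of_real (ln (real n)) * 1)" for n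
    using mult_mono[OF norm_mangoldt_le[of n] dirichlet_character_norm_le[OF assms, of n]]
    by (simp add: norm_mult del: norm_mangoldt)
qed (auto intro: abs_conv_beyond_bounded)

text \<open>The Dirichlet convolution of \<Lambda> with 1 is log; by complete multiplicativity chi n
  can be pulled out of every divisor sum, so the identity persists after twisting by chi.\<close>

lemma dirichlet_L_has_derivative:
  assumes chi: "dirichlet_character q chi" and s: "Re s > 1"
  shows "(dirichlet_L chi has_field_derivative - (dirichlet_L chi s * dirichlet_series (\<lambda>n. mangoldt n * chi n) s)) (at s)"
proof -
  note ac = abs_conv_character[OF chi]
  have "dirichlet_series (\<lambda>n. mangoldt n * chi n) s * dirichlet_series chi s =
        dirichlet_series (\<lambda>n. \<Sum>d | d dvd n. (mangoldt d * chi d) * chi (n div d)) s"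
    by (rule dirichlet_series_mult[OF abs_conv_mangoldt_character[OF chi] ac s])
  also have "\<dots> = dirichlet_series (\<lambda>n. of_real (ln (real n)) * chi n) s"
    unfolding dirichlet_series_def
  proof (rule suminf_cong)
    fix n :: nat
    show "(\<Sum>d | d dvd n. (mangoldt d * chi d) * chi (n div d)) * of_nat n powr (-s) =
          of_real (ln (real n)) * chi n * of_nat n powr (-s)"
    proof (cases "n = 0")
      case False
      have "(\<Sum>d | d dvd n. (mangoldt d * chi d) * chi (n div d)) = (\<Sum>d | d dvd n. mangoldt d * chi n)"
      proof (rule sum.cong[OF refl], goal_cases)
        case (1 d)
        hence "chi n = chi d * chi (n div d)" using chi unfolding dirichlet_character_def
          by (metis dvd_mult_div_cancel mem_Collect_eq)
        thus ?case by simp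
      qed
      also have "\<dots> = of_real (ln (real n)) * chi n"
        using mangoldt_sum[OF False, where ?'a = complex] by (simp flip: sum_distrib_right)
      finally show ?thesis by simp
    qed auto
  qed
  finally have eq: "dirichlet_series (\<lambda>n. - (of_real (ln (real n)) * chi n)) s = - (dirichlet_L chi s * dirichlet_series (\<lambda>n. mangoldt n * chi n) s)"
    using dirichlet_series_minus[OF abs_conv_beyond_ln[OF ac] s] dirichlet_L_eq_dser[OF chi s] by (simp add: mult.commute)
  have "(dirichlet_series chi has_field_derivative dirichlet_series (\<lambda>n. - (of_real (ln (real n)) * chi n)) s) (at s)"
    by (rule dirichlet_series_has_derivative[OF ac s])
  thus ?thesis unfolding eq
    by (rule has_field_derivative_transform_within_open[OF _ open_halfspace_Re_gt[of 1]])
       (use s dirichlet_L_eq_dser[OF chi] in auto)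
qed

text \<open>The coefficients of log zeta(s), equal to 1/k at a prime power p^k, written without
  reference to p and k. At n = 0 and n = 1 the value is 0 because \<Lambda> vanishes there.\<close>

definition log_weight :: "nat \<Rightarrow> real" where
  "log_weight n = mangoldt n / ln (real n)"

lemma log_weight_bounds: "0 \<le> log_weight n" "log_weight n \<le> 1"
proof -
  have "0 \<le> log_weight n \<and> log_weight n \<le> 1"
  proof (cases "n \<le> 1")
    case True
    hence "n = 0 \<or> n = 1" by auto
    thus ?thesis by (auto simp: log_weight_def)
  next
    case False
    thus ?thesis using mangoldt_le[of n] by (simp add: log_weight_def mangoldt_nonneg)
  qed
  thus "0 \<le> log_weight n" "log_weight n \<le> 1" by auto
qed

lemma ln_mult_log_weight: "ln (real n) * log_weight n = mangoldt n"
proof (cases "n \<le> 1")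
  case True
  hence "n = 0 \<or> n = 1" by auto
  thus ?thesis by auto
qed (simp add: log_weight_def)

lemma abs_conv_log_weight:
  assumes "\<And>n. norm (chi n) \<le> 1"
  shows "abs_conv_beyond (\<lambda>n. of_real (log_weight n) * chi n) 1"
proof (rule abs_conv_beyond_bounded)
  show "norm (of_real (log_weight n) * chi n) \<le> 1" for n
    using mult_mono[OF log_weight_bounds(2)[of n] assms[of n]] log_weight_bounds(1)[of n] by (simp add: norm_mult)
qed

text \<open>Plays the part of the Euler product. L e^(-G) has derivative zero for Re s > 1, since
  both logarithmic derivatives are given by the \<Lambda>-series, and its constant value is read off
  at infinity on the real axis. Non-vanishing for Re s > 1 is immediate from it.\<close>

lemma dirichlet_L_eq_exp:
  assumes chi: "dirichlet_character q chi" and s: "Re s > 1"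
  shows "dirichlet_L chi s = exp (dirichlet_series (\<lambda>n. of_real (log_weight n) * chi n) s)"
proof -
  define G where "G = dirichlet_series (\<lambda>n. of_real (log_weight n) * chi n)"
  note acG = abs_conv_log_weight[of chi, OF dirichlet_character_norm_le[OF chi]]
  have G': "(G has_field_derivative - dirichlet_series (\<lambda>n. mangoldt n * chi n) s) (at s)" if s: "Re s > 1" for s
  proof -
    have "(\<lambda>n. - (of_real (ln (real n)) * (of_real (log_weight n) * chi n))) = (\<lambda>n. - (mangoldt n * chi n))"
    proof
      fix n
      have "of_real (ln (real n)) * (of_real (log_weight n) * chi n) = of_real (ln (real n) * log_weight n) * chi n"
        by simp
      thus "- (of_real (ln (real n)) * (of_real (log_weight n) * chi n)) = - (mangoldt n * chi n)"
        by (simp only: ln_mult_log_weight of_real_mangoldt)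
    qed
    thus ?thesis
      using dirichlet_series_has_derivative[OF acG s] dirichlet_series_minus[OF abs_conv_mangoldt_character[OF chi] s] by (simp add: G_def)
  qed
  have "\<exists>c. \<forall>s\<in>{s. Re s > 1}. dirichlet_L chi s * exp (- G s) = c"
  proof (rule has_field_derivative_zero_constant)
    fix s assume "s \<in> {s. Re s > 1}"
    hence s: "Re s > 1" by simp
    have "((\<lambda>s. dirichlet_L chi s * exp (- G s)) has_field_derivative 0) (at s)"
      using dirichlet_L_has_derivative[OF chi s] G'[OF s]
      by (auto intro!: derivative_eq_intros)
    thus "((\<lambda>s. dirichlet_L chi s * exp (- G s)) has_field_derivative 0) (at s within {s. Re s > 1})"
      by (rule has_field_derivative_at_within)
  qed (simp add: convex_halfspace_Re_gt)
  then obtain c where c: "\<And>s. Re s > 1 \<Longrightarrow> dirichlet_L chi s * exp (- G s) = c" by auto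
  have "((\<lambda>x. dirichlet_series chi (complex_of_real x) * exp (- G (complex_of_real x))) \<longlongrightarrow> chi 1 * exp (- (of_real (log_weight 1) * chi 1))) at_top"
    unfolding G_def
    by (intro tendsto_intros dirichlet_series_tendsto_at_top[OF acG] dirichlet_series_tendsto_at_top[OF abs_conv_character[OF chi]])
  moreover have "\<forall>\<^sub>F x in at_top. dirichlet_series chi (complex_of_real x) * exp (- G (complex_of_real x)) = c"
    using eventually_gt_at_top[of 1] by eventually_elim (use c dirichlet_L_eq_dser[OF chi] in auto)
  ultimately have "((\<lambda>x::real. c) \<longlongrightarrow> chi 1 * exp (- (of_real (log_weight 1) * chi 1))) at_top"
    by (rule Lim_transform_eventually)
  hence "c = 1" using tendsto_const_iff[of "at_top :: real filter" c]
    by (simp add: log_weight_def dirichlet_character_1[OF chi])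
  hence "dirichlet_L chi s * exp (- G s) = 1" using c[OF s] by simp
  thus ?thesis unfolding G_def[symmetric] by (simp add: exp_minus field_simps)
qed

lemma moebius_mu_prime_mult:
  assumes "prime p" "\<not> p dvd d"
  shows "moebius_mu (p * d) = - (moebius_mu d :: 'a :: ring_1)"
proof (cases "d = 0")
  case False
  have cop: "coprime p d" using assms by (simp add: prime_imp_coprime)
  have sq: "squarefree (p * d) \<longleftrightarrow> squarefree d"
    using cop assms(1) squarefree_mult_coprime[of p d] squarefree_multD(2)[of p d] squarefree_prime[of p] by blast
  have "prime_factors (p * d) = insert p (prime_factors d)"
    using False assms(1) by (subst prime_factors_product) (auto simp: prime_prime_factors)
  moreover have "p \<notin> prime_factors d" using assms by auto
  ultimately have "card (prime_factors (p * d)) = Suc (card (prime_factors d))" by simp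
  thus ?thesis by (simp add: moebius_mu_def sq)
qed (use assms in auto)

text \<open>The squarefree divisors pair off as d and p d for a fixed prime p dividing n, and \<mu>
  takes opposite values on a pair.\<close>

lemma sum_moebius_mu:
  assumes "n > 1"
  shows "(\<Sum>d | d dvd n. moebius_mu d) = (0 :: 'a :: ring_1)"
proof -
  obtain p where p: "prime p" "p dvd n" using assms prime_factor_nat[of n] by auto
  define A where "A = {d. d dvd n \<and> squarefree d \<and> \<not> p dvd d}"
  have fin: "finite {d. d dvd n}" using assms by (intro finite_divisors_nat) auto
  have finA: "finite A" by (rule finite_subset[OF _ fin]) (auto simp: A_def)
  have inj: "inj_on (\<lambda>d. p * d) A" using p by (auto intro!: inj_onI)
  have eq: "{d. d dvd n \<and> squarefree d} = A \<union> (\<lambda>d. p * d) ` A"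
  proof (intro equalityI subsetI)
    fix e assume e: "e \<in> {d. d dvd n \<and> squarefree d}"
    show "e \<in> A \<union> (\<lambda>d. p * d) ` A"
    proof (cases "p dvd e")
      case True
      then obtain d where d: "e = p * d" by auto
      have "\<not> p dvd d"
      proof
        assume "p dvd d"
        hence "p ^ 2 dvd e" by (auto simp: d power2_eq_square)
        hence "is_unit p" using e squarefreeD[of e p] by blast
        thus False using p by auto
      qed
      moreover have "squarefree d" using e d by (auto intro: squarefree_multD)
      moreover have "d dvd n" using e d by (auto intro: dvd_mult_right)
      ultimately show ?thesis using d by (auto simp: A_def)
    qed (use e in \<open>auto simp: A_def\<close>)
  next
    fix e assume "e \<in> A \<union> (\<lambda>d. p * d) ` A"
    thus "e \<in> {d. d dvd n \<and> squarefree d}"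
    proof
      assume "e \<in> (\<lambda>d. p * d) ` A"
      then obtain d where d: "e = p * d" "d dvd n" "squarefree d" "\<not> p dvd d" by (auto simp: A_def)
      have cop: "coprime p d" using d p by (simp add: prime_imp_coprime)
      have "squarefree (p * d)" using cop d p by (subst squarefree_mult_coprime) (auto simp: squarefree_prime)
      moreover have "p * d dvd n" using cop d p by (intro divides_mult) auto
      ultimately show ?thesis using d by simp
    qed (auto simp: A_def)
  qed
  have "(\<Sum>d | d dvd n. moebius_mu d) = (\<Sum>d | d dvd n \<and> squarefree d. moebius_mu d :: 'a)"
    using fin by (intro sum.mono_neutral_right) (auto simp: moebius_mu_def)
  also have "\<dots> = (\<Sum>d\<in>A. moebius_mu d) + (\<Sum>d\<in>(\<lambda>d. p * d) ` A. moebius_mu d)"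
    unfolding eq using finA by (intro sum.union_disjoint) (auto simp: A_def)
  also have "(\<Sum>d\<in>(\<lambda>d. p * d) ` A. moebius_mu d) = (\<Sum>d\<in>A. - moebius_mu d :: 'a)"
    using moebius_mu_prime_mult[OF p(1)] by (subst sum.reindex[OF inj]) (auto simp: A_def intro!: sum.cong)
  finally show ?thesis by (simp add: sum_negf)
qed

lemma norm_moebius_mu_le: "norm (moebius_mu n :: complex) \<le> 1"
  by (simp add: moebius_mu_def norm_power)

lemma zeta_mult_dser_moebius:
  assumes s: "Re s > 1"
  shows "riemann_zeta s * dirichlet_series moebius_mu s = 1"
proof -
  have "riemann_zeta s * dirichlet_series moebius_mu s = dirichlet_series moebius_mu s * dirichlet_series (\<lambda>_. 1) s"
    unfolding riemann_zeta_def using dirichlet_L_eq_dser[OF dirichlet_character_trivial s] by simp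
  also have "\<dots> = dirichlet_series (\<lambda>n. \<Sum>d | d dvd n. moebius_mu d * 1) s"
    by (rule dirichlet_series_mult[OF _ _ s]) (auto intro!: abs_conv_beyond_bounded norm_moebius_mu_le)
  also have "\<dots> = (\<Sum>n. if n = 1 then 1 else 0)"
    unfolding dirichlet_series_def
  proof (rule suminf_cong)
    fix n :: nat
    have "n = 0 \<or> n = 1 \<or> n > 1" by auto
    thus "(\<Sum>d | d dvd n. moebius_mu d * 1) * of_nat n powr (-s) = (if n = 1 then 1 else 0 :: complex)"
      using sum_moebius_mu[of n, where ?'a = complex] by (auto simp: moebius_mu_def)
  qed
  also have "\<dots> = 1" using sums_single[of 1 "\<lambda>_. 1 :: complex"] by (simp add: sums_iff)
  finally show ?thesis .
qed

section \<open>Non-vanishing on the line of real part 1\<close>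

lemma open_strip: "open {s. Re s > a \<and> \<bar>Im s\<bar> < t}"
proof -
  have "{s. Re s > a \<and> \<bar>Im s\<bar> < t} = {s. Re s > a} \<inter> {s. Im s < t} \<inter> {s. Im s > - t}"
    by auto
  thus ?thesis by (metis open_Int open_halfspace_Re_gt open_halfspace_Im_lt open_halfspace_Im_gt)
qed

lemma convex_strip: "convex {s. Re s > a \<and> \<bar>Im s\<bar> < t}"
proof -
  have "{s. Re s > a \<and> \<bar>Im s\<bar> < t} = {s. Re s > a} \<inter> {s. Im s < t} \<inter> {s. Im s > - t}"
    by auto
  thus ?thesis by (metis convex_Int convex_halfspace_Re_gt convex_halfspace_Im_lt convex_halfspace_Im_gt)
qed

lemma dirichlet_series_of_real:
  assumes "abs_conv_beyond (\<lambda>n. of_real (c n)) \<sigma>" "x > \<sigma>"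
  shows "dirichlet_series (\<lambda>n. of_real (c n)) (of_real x) = of_real (\<Sum>n. c n * real n powr (-x))"
    and "summable (\<lambda>n. c n * real n powr (-x))"
proof -
  have eq: "of_real (c n) * of_nat n powr (- complex_of_real x) = complex_of_real (c n * real n powr (-x))" for n
    using powr_of_real[of "real n" "-x"] by simp
  have "(\<lambda>n. complex_of_real (c n * real n powr (-x))) sums dirichlet_series (\<lambda>n. of_real (c n)) (of_real x)"
    using dirichlet_series_sums[OF assms(1), of "of_real x"] assms(2) unfolding eq by simp
  moreover from this show s: "summable (\<lambda>n. c n * real n powr (-x))"
    by (metis sums_summable summable_complex_of_real)
  ultimately show "dirichlet_series (\<lambda>n. of_real (c n)) (of_real x) = of_real (\<Sum>n. c n * real n powr (-x))"
    using sums_unique2 sums_of_real[OF summable_sums[OF s]] by blast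
qed

lemma dirichlet_series_higher_deriv:
  assumes "abs_conv_beyond a \<sigma>"
  shows "Re z > \<sigma> \<Longrightarrow> (deriv ^^ k) (dirichlet_series a) z = (-1) ^ k * dirichlet_series (\<lambda>n. of_real (ln (real n)) ^ k * a n) z"
    and "abs_conv_beyond (\<lambda>n. of_real (ln (real n)) ^ k * a n) \<sigma>"
proof -
  show ac: "abs_conv_beyond (\<lambda>n. of_real (ln (real n)) ^ k * a n) \<sigma>" for k
  proof (induction k)
    case (Suc k)
    from abs_conv_beyond_ln[OF Suc] show ?case by (simp add: mult_ac)
  qed (use assms in simp)
  show "Re z > \<sigma> \<Longrightarrow> (deriv ^^ k) (dirichlet_series a) z = (-1) ^ k * dirichlet_series (\<lambda>n. of_real (ln (real n)) ^ k * a n) z"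
  proof (induction k arbitrary: z)
    case (Suc k)
    have "((\<lambda>z. (-1) ^ k * dirichlet_series (\<lambda>n. of_real (ln (real n)) ^ k * a n) z) has_field_derivative
       (-1) ^ k * dirichlet_series (\<lambda>n. - (of_real (ln (real n)) * (of_real (ln (real n)) ^ k * a n))) z) (at z)"
      by (intro DERIV_cmult dirichlet_series_has_derivative[OF ac Suc.prems])
    hence "((deriv ^^ k) (dirichlet_series a) has_field_derivative
       (-1) ^ k * dirichlet_series (\<lambda>n. - (of_real (ln (real n)) * (of_real (ln (real n)) ^ k * a n))) z) (at z)"
      by (rule has_field_derivative_transform_within_open[OF _ open_halfspace_Re_gt[of \<sigma>]])
         (use Suc in auto)
    moreover have "dirichlet_series (\<lambda>n. - (of_real (ln (real n)) * (of_real (ln (real n)) ^ k * a n))) z =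
        - dirichlet_series (\<lambda>n. of_real (ln (real n)) ^ Suc k * a n) z"
      using dirichlet_series_minus[OF ac[of "Suc k"] Suc.prems] by (simp add: mult.assoc)
    ultimately show ?case by (simp add: DERIV_imp_deriv)
  qed simp
qed

text \<open>A form of Landau's theorem: the abscissa of convergence of a Dirichlet series with nonnegative
  coefficients is a singularity, and its exponential has no zero on the real axis to cancel one.\<close>

lemma landau_log_series:
  fixes c :: "nat \<Rightarrow> real" and D :: "complex \<Rightarrow> complex"
  assumes c: "\<And>n. c n \<ge> 0" and ac: "abs_conv_beyond (\<lambda>n. of_real (c n)) 1"
    and t: "t > 0" and hol: "D holomorphic_on {s. Re s > 0 \<and> \<bar>Im s\<bar> < t}"
    and eq: "\<And>s. Re s > 1 \<Longrightarrow> \<bar>Im s\<bar> < t \<Longrightarrow> D s = exp (dirichlet_series (\<lambda>n. of_real (c n)) s)"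
    and \<sigma>: "\<sigma> > 0"
  shows "summable (\<lambda>n. c n * real n powr (-\<sigma>))"
proof (rule ccontr)
  define P where "P = (\<lambda>x. summable (\<lambda>n. c n * real n powr (-x)))"
  assume "\<not> summable (\<lambda>n. c n * real n powr (-\<sigma>))"
  hence nP: "\<not> P \<sigma>" by (simp add: P_def)
  have P_mono: "P y" if "P x" "x \<le> y" for x y
    unfolding P_def
  proof (rule summable_comparison_test'[OF that(1)[unfolded P_def]])
    fix n :: nat
    show "norm (c n * real n powr (-y)) \<le> c n * real n powr (-x)"
      using c[of n] that(2) by (cases "n = 0") (auto intro!: mult_left_mono powr_mono)
  qed
  have P1: "P x" if "x > 1" for x
    using dirichlet_series_of_real(2)[OF ac that] by (simp add: P_def)
  have lb: "\<sigma> \<le> x" if "P x" for x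
    using P_mono[OF that, of \<sigma>] nP by linarith
  \<comment> \<open>The infimum of the real points of convergence. Divergence at \<sigma> keeps it
    positive, so D is holomorphic around it; the contradiction will be convergence slightly to its
    left.\<close>
  define \<sigma>0 where "\<sigma>0 = Inf {x. P x}"
  have bdd: "bdd_below {x. P x}" using lb by (intro bdd_belowI) auto
  have ne: "{x. P x} \<noteq> {}" using P1[of 2] by auto
  have \<sigma>0: "\<sigma>0 > 0"
    using cInf_greatest[OF ne, of \<sigma>] lb \<sigma> unfolding \<sigma>0_def by fastforce
  have P0: "P x" if x: "x > \<sigma>0" for x
  proof -
    obtain y where "P y" "y < x" using cInf_lessD[OF ne x[unfolded \<sigma>0_def]] by auto
    thus ?thesis using P_mono by fastforce
  qed
  have low: "\<sigma>0 \<le> x" if "P x" for x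
    unfolding \<sigma>0_def using that bdd by (intro cInf_lower) auto
  let ?a = "\<lambda>n. complex_of_real (c n)"
  have ac0: "abs_conv_beyond ?a \<sigma>0"
    using P0 c by (auto simp: abs_conv_beyond_def P_def)
  define T where "T = {s. Re s > \<sigma>0 \<and> \<bar>Im s\<bar> < t}"
  have T: "open T" "connected T" unfolding T_def by (rule open_strip convex_connected convex_strip)+
  have D_eq: "D s = exp (dirichlet_series ?a s)" if "s \<in> T" for s
  proof (rule analytic_continuation_open[of "T \<inter> {s. Re s > 1}" T D])
    show "open (T \<inter> {s. Re s > 1})" using T open_halfspace_Re_gt by blast
    have "complex_of_real (\<sigma>0 + 2) \<in> T \<inter> {s. Re s > 1}" using t \<sigma>0 by (simp add: T_def)
    thus "T \<inter> {s. Re s > 1} \<noteq> {}" by blast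
    show "D holomorphic_on T"
      by (rule holomorphic_on_subset[OF hol]) (use \<sigma>0 in \<open>auto simp: T_def\<close>)
    show "(\<lambda>s. exp (dirichlet_series ?a s)) holomorphic_on T"
      by (intro holomorphic_intros holomorphic_on_subset[OF dirichlet_series_holomorphic[OF ac0]]) (auto simp: T_def)
  qed (use T that eq in \<open>auto simp: T_def\<close>)
  have openS: "open {s. Re s > 0 \<and> \<bar>Im s\<bar> < t}" by (rule open_strip)
  have contD: "isCont D (of_real \<sigma>0)"
    using holomorphic_on_imp_continuous_on[OF hol] continuous_on_eq_continuous_at[OF openS, of D] \<sigma>0 t by auto
  \<comment> \<open>Nonnegativity keeps D away from 0: on the real axis to the right of \<sigma>0
    the series is nonnegative, so D is at least 1 there and, by continuity, its real part is at
    least 1 at \<sigma>0.\<close>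
  have D0: "D (of_real \<sigma>0) \<noteq> 0"
  proof -
    have "((\<lambda>x. D (complex_of_real x)) \<longlongrightarrow> D (of_real \<sigma>0)) (at_right \<sigma>0)"
      by (rule isCont_tendsto_compose[OF contD]) (intro tendsto_intros)
    hence "((\<lambda>x. Re (D (complex_of_real x))) \<longlongrightarrow> Re (D (of_real \<sigma>0))) (at_right \<sigma>0)"
      by (rule tendsto_Re)
    moreover have "\<forall>\<^sub>F x in at_right \<sigma>0. Re (D (complex_of_real x)) \<ge> 1"
      using eventually_at_right_less[of \<sigma>0]
    proof eventually_elim
      case (elim x)
      have "D (of_real x) = exp (dirichlet_series ?a (of_real x))" using elim t by (intro D_eq) (auto simp: T_def)
      also have "\<dots> = of_real (exp (\<Sum>n. c n * real n powr (-x)))"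
        using dirichlet_series_of_real(1)[OF ac0 elim] by (simp add: exp_of_real)
      finally have "Re (D (of_real x)) = exp (\<Sum>n. c n * real n powr (-x))" by simp
      moreover have "(\<Sum>n. c n * real n powr (-x)) \<ge> 0"
        using c dirichlet_series_of_real(2)[OF ac0 elim] by (intro suminf_nonneg) auto
      ultimately show ?case by simp
    qed
    ultimately have "Re (D (of_real \<sigma>0)) \<ge> 1"
      by (intro tendsto_lowerbound) auto
    thus ?thesis by auto
  qed
  obtain r1 where r1: "r1 > 0" "\<And>z. dist (of_real \<sigma>0) z < r1 \<Longrightarrow> D z \<noteq> 0"
    using continuous_at_avoid[OF contD D0] by blast
  obtain r2 where r2: "r2 > 0" "ball (of_real \<sigma>0) r2 \<subseteq> {s. Re s > 0 \<and> \<bar>Im s\<bar> < t}"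
    using openS \<sigma>0 t unfolding open_contains_ball by (metis (mono_tags, lifting) mem_Collect_eq Re_complex_of_real Im_complex_of_real abs_zero)
  define r where "r = min r1 r2"
  have r: "r > 0" using r1 r2 by (simp add: r_def)
  \<comment> \<open>The logarithmic derivative in place of a logarithm avoids the choice of a
    branch; to the right of \<sigma>0 it is the series with coefficients ln n * c n, again
    nonnegative.\<close>
  define E where "E = (\<lambda>z. - deriv D z / D z)"
  have holE: "E holomorphic_on ball (of_real \<sigma>0) r"
  proof -
    have "D holomorphic_on ball (of_real \<sigma>0) r"
      by (rule holomorphic_on_subset[OF hol]) (use r2 in \<open>auto simp: r_def\<close>)
    thus ?thesis unfolding E_def
      by (intro holomorphic_intros) (use r1 in \<open>auto simp: r_def\<close>)
  qed
  define F where "F = dirichlet_series (\<lambda>n. of_real (ln (real n)) * ?a n)"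
  have EF: "E z = F z" if "z \<in> T" for z
  proof -
    have "((\<lambda>z. exp (dirichlet_series ?a z)) has_field_derivative exp (dirichlet_series ?a z) * dirichlet_series (\<lambda>n. - (of_real (ln (real n)) * ?a n)) z) (at z)"
      using that by (auto intro!: derivative_eq_intros dirichlet_series_has_derivative[OF ac0] simp: T_def)
    hence "(D has_field_derivative exp (dirichlet_series ?a z) * dirichlet_series (\<lambda>n. - (of_real (ln (real n)) * ?a n)) z) (at z)"
      by (rule has_field_derivative_transform_within_open[OF _ T(1) that]) (simp add: D_eq)
    hence "deriv D z = exp (dirichlet_series ?a z) * dirichlet_series (\<lambda>n. - (of_real (ln (real n)) * ?a n)) z"
      by (rule DERIV_imp_deriv)
    also have "\<dots> = D z * - F z"
      unfolding F_def using dirichlet_series_minus[OF abs_conv_beyond_ln[OF ac0], of z] that by (simp add: D_eq T_def)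
    finally show ?thesis using D_eq[OF that] by (simp add: E_def)
  qed
  \<comment> \<open>The disc of radius r / 2 about A stays inside the disc of radius r about
    \<sigma>0 because r / 4 + r / 2 < r, and its point A - x = \<sigma>0 - r / 8 lies to the left of
    \<sigma>0.\<close>
  define A where "A = \<sigma>0 + r / 4"
  define x where "x = 3 * r / 8"
  have A: "A > \<sigma>0" and Ax: "A - x < \<sigma>0" using r by (auto simp: A_def x_def)
  have x0: "x > 0" using r by (simp add: x_def)
  have sub: "ball (complex_of_real A) (r/2) \<subseteq> ball (of_real \<sigma>0) r"
  proof
    fix z assume "z \<in> ball (complex_of_real A) (r/2)"
    moreover have "dist (complex_of_real \<sigma>0) (of_real A) = r / 4"
      unfolding dist_of_real using r by (simp add: A_def dist_real_def)
    ultimately show "z \<in> ball (of_real \<sigma>0) r"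
      using dist_triangle[of "of_real \<sigma>0" z "complex_of_real A"] r by simp
  qed
  let ?w = "complex_of_real (A - x)"
  have wball: "?w \<in> ball (of_real A) (r/2)"
    unfolding mem_ball dist_of_real using r by (simp add: dist_real_def x_def)
  note ps = holomorphic_power_series[OF holomorphic_on_subset[OF holE sub] wball]
  define S where "S = (\<lambda>k. \<Sum>n. ln (real n) ^ k * (ln (real n) * c n) * real n powr (-A))"
  have acF: "abs_conv_beyond (\<lambda>n. of_real (ln (real n)) * ?a n) \<sigma>0" by (rule abs_conv_beyond_ln[OF ac0])
  have Sk: "dirichlet_series (\<lambda>n. of_real (ln (real n)) ^ k * (of_real (ln (real n)) * ?a n)) (of_real A) = of_real (S k)"
    and Sk': "summable (\<lambda>n. ln (real n) ^ k * (ln (real n) * c n) * real n powr (-A))" for k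
    using dirichlet_series_of_real[of "\<lambda>n. ln (real n) ^ k * (ln (real n) * c n)" \<sigma>0 A] dirichlet_series_higher_deriv(2)[OF acF, of k] A
    by (simp_all add: S_def)
  have holF: "F holomorphic_on {s. Re s > \<sigma>0}" unfolding F_def by (rule dirichlet_series_holomorphic[OF acF])
  have derE: "(deriv ^^ k) E (of_real A) = (-1) ^ k * of_real (S k)" for k
  proof -
    have "(deriv ^^ k) E (of_real A) = (deriv ^^ k) F (of_real A)"
    proof (rule higher_deriv_transform_within_open[of _ "T \<inter> ball (of_real \<sigma>0) r"])
      show "E holomorphic_on T \<inter> ball (of_real \<sigma>0) r" by (rule holomorphic_on_subset[OF holE]) auto
      show "F holomorphic_on T \<inter> ball (of_real \<sigma>0) r" by (rule holomorphic_on_subset[OF holF]) (auto simp: T_def)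
      show "open (T \<inter> ball (of_real \<sigma>0) r)" using T by auto
      have "complex_of_real A \<in> T" using A t by (simp add: T_def)
      moreover have "complex_of_real A \<in> ball (of_real \<sigma>0) r" using sub r by (meson centre_in_ball half_gt_zero subsetD)
      ultimately show "complex_of_real A \<in> T \<inter> ball (of_real \<sigma>0) r" by blast
    qed (use EF in auto)
    also have "\<dots> = (-1) ^ k * of_real (S k)"
      unfolding F_def using dirichlet_series_higher_deriv(1)[OF acF, of "of_real A" k] A Sk by simp
    finally show ?thesis .
  qed
  have "(\<lambda>k. complex_of_real (S k / fact k * x ^ k)) sums E ?w"
  proof -
    have "(deriv ^^ k) E (of_real A) / fact k * (?w - of_real A) ^ k = complex_of_real (S k / fact k * x ^ k)" for k
    proof -
      have "(?w - of_real A) ^ k = (-1) ^ k * of_real (x ^ k)" by (simp add: power_minus')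
      thus ?thesis unfolding derE by (simp flip: power_mult_distrib mult.assoc)
    qed
    thus ?thesis using ps by simp
  qed
  from sums_Re[OF this] have sumsE: "(\<lambda>k. S k / fact k * x ^ k) sums Re (E ?w)"
    by (simp only: Re_complex_of_real)
  define u where "u = (\<lambda>n. ln (real n) * c n * real n powr (-A))"
  have u: "u n \<ge> 0" for n
    unfolding u_def using c[of n] by (cases "n = 0") auto
  \<comment> \<open>At A - x the Taylor series about A has nonnegative terms only. Truncating in n
    before expanding n^x in powers of x log n bounds every partial sum of the Dirichlet series at A
    - x by the real part of E there, with no interchange of two infinite sums.\<close>
  have bound: "(\<Sum>n<N. u n * real n powr x) \<le> Re (E ?w)" for N
  proof -
    have e: "(\<lambda>k. u n * ((x * ln (real n)) ^ k / fact k)) sums (u n * real n powr x)" for n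
    proof (cases "n = 0")
      case False
      have "(\<lambda>k. u n * ((x * ln (real n)) ^ k /\<^sub>R fact k)) sums (u n * exp (x * ln (real n)))"
        by (intro sums_mult exp_converges)
      thus ?thesis using False by (simp add: powr_def divide_inverse mult_ac)
    qed (simp add: u_def)
    have "(\<lambda>k. \<Sum>n<N. u n * ((x * ln (real n)) ^ k / fact k)) sums (\<Sum>n<N. u n * real n powr x)"
      by (intro sums_sum e)
    moreover have "(\<Sum>n<N. u n * ((x * ln (real n)) ^ k / fact k)) \<le> S k / fact k * x ^ k" for k
    proof -
      have "(\<Sum>n<N. u n * ((x * ln (real n)) ^ k / fact k)) =
        (\<Sum>n<N. ln (real n) ^ k * (ln (real n) * c n) * real n powr (-A)) * (x ^ k / fact k)"
        unfolding sum_distrib_right by (intro sum.cong) (auto simp: u_def power_mult_distrib)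
      also have "\<dots> \<le> S k * (x ^ k / fact k)"
        unfolding S_def
      proof (intro mult_right_mono sum_le_suminf Sk')
        fix n :: nat
        show "0 \<le> ln (real n) ^ k * (ln (real n) * c n) * real n powr (-A)"
          using c[of n] by (cases "n = 0") auto
      qed (use x0 in auto)
      finally show ?thesis by simp
    qed
    ultimately show ?thesis by (rule sums_le[OF _ _ sumsE, rotated])
  qed
  have su: "summable (\<lambda>n. u n * real n powr x)"
    by (rule summableI_nonneg_bounded[OF _ bound]) (use u in auto)
  have "P (A - x)"
    unfolding P_def
  proof (rule summable_comparison_test_ev[OF _ su])
    show "\<forall>\<^sub>F n in sequentially. norm (c n * real n powr (-(A - x))) \<le> u n * real n powr x"
      using eventually_ge_at_top[of 3]
    proof eventually_elim
      case (elim n)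
      \<comment> \<open>From n = 3 on log n is at least 1, so removing the logarithm from u n can
        only decrease the terms.\<close>
      have "1 \<le> ln (real n)"
        using elim exp_le by (subst ln_ge_iff) (auto intro: order_trans)
      hence "1 * (c n * real n powr (x - A)) \<le> ln (real n) * (c n * real n powr (x - A))"
        using c[of n] by (intro mult_right_mono) auto
      also have "\<dots> = u n * real n powr x" by (simp add: u_def mult_ac flip: powr_add)
      finally show ?case using c[of n] by simp
    qed
  qed
  thus False using low Ax by fastforce
qed

section \<open>The zero-free line Re s = 1\<close>

lemma dirichlet_character_cnj: "dirichlet_character q chi \<Longrightarrow> dirichlet_character q (\<lambda>n. cnj (chi n))"
  by (simp add: dirichlet_character_def)

lemma cnj_not_principal:
  "chi \<noteq> principal_character q \<Longrightarrow> (\<lambda>n. cnj (chi n)) \<noteq> principal_character q"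
proof (rule contrapos_nn)
  assume eq: "(\<lambda>n. cnj (chi n)) = principal_character q"
  show "chi = principal_character q"
  proof
    fix n
    have "cnj (chi n) = principal_character q n" using fun_cong[OF eq, of n] .
    thus "chi n = principal_character q n"
      by (metis complex_cnj_cnj complex_cnj_one complex_cnj_zero principal_character_def)
  qed
qed

lemma cnj_of_nat_powr: "cnj (of_nat n powr s) = of_nat n powr cnj s"
  by (cases "n = 0") (auto simp: powr_def exp_cnj Ln_of_nat)

lemma dirichlet_L_cnj:
  assumes chi: "dirichlet_character q chi" and s: "Re s > 1"
  shows "dirichlet_L (\<lambda>n. cnj (chi n)) (cnj s) = cnj (dirichlet_L chi s)"
proof -
  have "(\<lambda>n. chi n * of_nat n powr (-s)) sums dirichlet_L chi s"
    using dirichlet_series_sums[OF abs_conv_character[OF chi] s] dirichlet_L_eq_dser[OF chi s] by simp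
  hence "(\<lambda>n. cnj (chi n) * of_nat n powr (- cnj s)) sums cnj (dirichlet_L chi s)"
    by (subst (asm) sums_cnj[symmetric]) (simp add: cnj_of_nat_powr)
  thus ?thesis
    using dirichlet_L_eq_dser[OF dirichlet_character_cnj[OF chi], of "cnj s"] s
    by (simp add: dirichlet_series_def sums_iff)
qed

text \<open>For n = p^k, n and n^2 have the same \<Lambda> while the logarithm doubles. It lets the
  terms at squares compensate for those n where the twist is close to -1.\<close>

lemma log_weight_square: "log_weight (n ^ 2) = log_weight n / 2"
proof (cases "primepow n")
  case True
  then obtain p k where pk: "prime p" "k > 0" "n = p ^ k" by (auto simp: primepow_def)
  have "mangoldt (n ^ 2) = (mangoldt n :: real)"
    using pk by (simp flip: power_mult)
  moreover have "n > 0" using pk by (simp add: prime_gt_0_nat)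
  ultimately show ?thesis by (simp add: log_weight_def ln_realpow)
next
  case False
  moreover from this have "\<not> primepow (n ^ 2)"
    using primepow_power_iff_nat[of n 2] by (cases "n = 0") auto
  ultimately show ?thesis by (simp add: log_weight_def mangoldt_def)
qed

lemma L_entire_trivial_1: "L_entire 1 (\<lambda>_. 1) 1 = 1"
  by (simp add: L_entire_def hurwitz_entire_1)

text \<open>Convergence at 1 would bound zeta to the right of 1, in conflict with its pole, that is,
  with the value 1 of (s - 1) zeta(s) at s = 1.\<close>

lemma not_summable_log_weight: "\<not> summable (\<lambda>n. log_weight n * real n powr (-1))"
proof
  assume s: "summable (\<lambda>n. log_weight n * real n powr (-1))"
  define B where "B = (\<Sum>n. log_weight n * real n powr (-1))"
  let ?Z = "L_entire 1 (\<lambda>_. 1)"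
  have tr: "dirichlet_character 1 (\<lambda>_. 1)" using dirichlet_character_trivial by simp
  have lim: "((\<lambda>x. ?Z (complex_of_real x)) \<longlongrightarrow> ?Z (of_real 1)) (at_right 1)"
  proof -
    have "isCont ?Z (of_real 1)"
      using L_entire_holomorphic[OF tr] continuous_on_eq_continuous_at[of UNIV ?Z]
      by (auto dest: holomorphic_on_imp_continuous_on)
    from isCont_tendsto_compose[OF this tendsto_of_real[OF tendsto_ident_at]] show ?thesis .
  qed
  have bd: "norm (?Z (complex_of_real x)) \<le> exp B * (x - 1)" if x: "x > 1" for x
  proof -
    have ac: "abs_conv_beyond (\<lambda>n. of_real (log_weight n)) 1"
      using abs_conv_log_weight[of "\<lambda>_. 1"] by simp
    have z: "dirichlet_L (\<lambda>_. 1) (of_real x) = of_real (exp (\<Sum>n. log_weight n * real n powr (-x)))"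
      using dirichlet_L_eq_exp[OF tr, of "of_real x"] dirichlet_series_of_real(1)[OF ac x] x by (simp add: exp_of_real)
    have "(\<Sum>n. log_weight n * real n powr (-x)) \<le> B"
      unfolding B_def
    proof (rule suminf_le[OF _ dirichlet_series_of_real(2)[OF ac x] s])
      fix n :: nat
      show "log_weight n * real n powr (-x) \<le> log_weight n * real n powr (-1)"
        using log_weight_bounds[of n] x by (cases "n = 0") (simp, intro mult_left_mono powr_mono, auto)
    qed
    hence zb: "norm (dirichlet_L (\<lambda>_. 1) (of_real x)) \<le> exp B" unfolding z by simp
    have x1: "complex_of_real x \<noteq> 1" using x by (metis of_real_eq_1_iff less_irrefl)
    have "?Z (of_real x) = dirichlet_L (\<lambda>_. 1) (of_real x) * (of_real x - 1)"
      using dirichlet_L_props(3)[OF tr x1] x1 by simp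
    also have "norm \<dots> = norm (dirichlet_L (\<lambda>_. 1) (of_real x)) * (x - 1)"
    proof -
      have "norm (complex_of_real x - 1) = x - 1" using x by (metis norm_of_real of_real_1 of_real_diff abs_of_pos diff_gt_0_iff_gt)
      thus ?thesis by (simp add: norm_mult)
    qed
    also have "\<dots> \<le> exp B * (x - 1)" using zb x by (intro mult_right_mono) auto
    finally show ?thesis .
  qed
  have "((\<lambda>x. ?Z (complex_of_real x)) \<longlongrightarrow> 0) (at_right 1)"
  proof (rule Lim_null_comparison)
    show "\<forall>\<^sub>F x in at_right 1. norm (?Z (complex_of_real x)) \<le> exp B * (x - 1)"
      using eventually_at_right_less[of 1] by eventually_elim (rule bd)
    have "((\<lambda>x. exp B * (x - 1)) \<longlongrightarrow> exp B * (1 - 1)) (at_right 1)" by (intro tendsto_intros)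
    thus "((\<lambda>x. exp B * (x - 1)) \<longlongrightarrow> 0) (at_right 1)" by simp
  qed
  with lim have "?Z (of_real 1) = 0" by (intro tendsto_unique[OF _ lim]) auto
  thus False using L_entire_trivial_1 by simp
qed

text \<open>A zero at 1 + it would cancel the double pole of zeta^2 in D(s) = zeta(s)^2 L(s + it,
  chi) L(s - it, cnj chi), as the conjugate factor then vanishes too. The logarithm of D has the
  coefficients w(n) (2 + 2 Re(chi(n) n^(-it))) >= 0 with w = \<open>log_weight\<close>, so by
  Landau's theorem it converges already at 1/2. The terms at squares then force the divergent sum of
  w(n) / n to converge.\<close>

theorem dirichlet_L_nonzero_on_line_1:
  assumes chi: "dirichlet_character q chi" and alt: "chi \<noteq> principal_character q \<or> t \<noteq> 0"
  shows "dirichlet_L chi (Complex 1 t) \<noteq> 0"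
proof
  assume zero: "dirichlet_L chi (Complex 1 t) = 0"
  \<comment> \<open>For t \<noteq> 0 a strip of half-width |t| keeps s + it and s - it away from the
    possible pole at 1. For t = 0 the character is non-principal, its L-function is entire, and any
    width will do.\<close>
  define \<tau> where "\<tau> = (if t = 0 then 1 else \<bar>t\<bar>)"
  have \<tau>: "\<tau> > 0" by (simp add: \<tau>_def)
  define S where "S = {s. Re s > 0 \<and> \<bar>Im s\<bar> < \<tau>}"
  have S: "open S" unfolding S_def by (rule open_strip)
  have S1: "1 \<in> S" using \<tau> by (simp add: S_def)
  define chi' where "chi' = (\<lambda>n. cnj (chi n))"
  have chi': "dirichlet_character q chi'" unfolding chi'_def by (rule dirichlet_character_cnj[OF chi])
  have hol: "(\<lambda>s. dirichlet_L \<psi> (s + \<i> * of_real u)) holomorphic_on S"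
    if \<psi>: "dirichlet_character q \<psi>" "\<psi> \<noteq> principal_character q \<or> t \<noteq> 0" and u: "\<bar>u\<bar> = \<bar>t\<bar>" for \<psi> u
  proof -
    define R where "R = (if t = 0 then UNIV else - {1 :: complex})"
    have "dirichlet_L \<psi> holomorphic_on R"
      using \<psi> dirichlet_L_holomorphic[OF \<psi>(1)] dirichlet_L_holomorphic_away[OF \<psi>(1)] by (auto simp: R_def)
    hence "dirichlet_L \<psi> \<circ> (\<lambda>s. s + \<i> * of_real u) holomorphic_on S"
    proof (rule holomorphic_on_compose_gen[rotated])
      show "(\<lambda>s. s + \<i> * of_real u) ` S \<subseteq> R"
        using u by (auto simp: S_def R_def \<tau>_def complex_eq_iff split: if_splits)
    qed (intro holomorphic_intros)
    thus ?thesis by (simp add: o_def)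
  qed
  define f1 where "f1 = (\<lambda>s. dirichlet_L chi (s + \<i> * of_real t))"
  define f2 where "f2 = (\<lambda>s. dirichlet_L chi' (s + \<i> * of_real (-t)))"
  have f1: "f1 holomorphic_on S" unfolding f1_def by (rule hol[OF chi alt]) simp
  have f2: "f2 holomorphic_on S" unfolding f2_def
    by (rule hol[OF chi']) (use alt cnj_not_principal in \<open>auto simp: chi'_def\<close>)
  have f11: "f1 1 = 0" using zero by (simp add: f1_def complex_eq_iff Complex_eq)
  have cont: "((\<lambda>x. f (complex_of_real x)) \<longlongrightarrow> f 1) (at_right 1)" if "f holomorphic_on S" for f
  proof -
    have "isCont f (of_real 1)"
      using holomorphic_on_imp_continuous_on[OF that] continuous_on_eq_continuous_at[OF S] S1 by auto
    from isCont_tendsto_compose[OF this tendsto_of_real[OF tendsto_ident_at]] show ?thesis by simp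
  qed
  have f21: "f2 1 = 0"
  proof -
    have "((\<lambda>x. cnj (f1 (complex_of_real x))) \<longlongrightarrow> cnj (f1 1)) (at_right 1)"
      by (intro tendsto_cnj cont f1)
    moreover have "\<forall>\<^sub>F x in at_right 1. cnj (f1 (complex_of_real x)) = f2 (of_real x)"
      using eventually_at_right_less[of "1::real"]
    proof eventually_elim
      case (elim x)
      thus ?case using dirichlet_L_cnj[OF chi, of "of_real x + \<i> * of_real t"]
        by (simp add: f1_def f2_def chi'_def)
    qed
    ultimately have "((\<lambda>x. f2 (complex_of_real x)) \<longlongrightarrow> cnj (f1 1)) (at_right 1)"
      by (rule Lim_transform_eventually)
    from tendsto_unique[OF _ this cont[OF f2]] show ?thesis using f11 by simp
  qed
  \<comment> \<open>The difference quotient at 1, completed by the derivative; for f1 and f2, which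
    vanish at 1, it is f(s) / (s - 1).\<close>
  define g where "g = (\<lambda>f s. if s = 1 then deriv f 1 else (f s - f 1) / (s - 1 :: complex) :: complex)"
  have hg: "g f holomorphic_on S" if "f holomorphic_on S" for f
    unfolding g_def by (rule pole_lemma_open[OF that S])
  define D where "D = (\<lambda>s. L_entire 1 (\<lambda>_. 1) s ^ 2 * g f1 s * g f2 s)"
  have tr: "dirichlet_character 1 (\<lambda>_. 1)" using dirichlet_character_trivial by simp
  have holD: "D holomorphic_on S"
    unfolding D_def
    by (intro holomorphic_intros hg f1 f2 holomorphic_on_subset[OF L_entire_holomorphic[OF tr]]) auto
  define z where "z = (\<lambda>n. chi n * of_nat n powr (- (\<i> * of_real t)))"
  have nz: "norm (z n) \<le> 1" for n
    using dirichlet_character_norm_le[OF chi, of n] by (cases "n = 0") (auto simp: z_def norm_mult norm_of_nat_powr)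
  define c where "c = (\<lambda>n. log_weight n * (2 + 2 * Re (z n)))"
  have Rez: "\<bar>Re (z n)\<bar> \<le> 1" for n using abs_Re_le_cmod[of "z n"] nz[of n] by linarith
  have c0: "c n \<ge> 0" for n
    unfolding c_def using log_weight_bounds(1)[of n] Rez[of n] by (intro mult_nonneg_nonneg) auto
  have c4: "c n \<le> 4" for n
    using mult_mono[OF log_weight_bounds(2)[of n], of "2 + 2 * Re (z n)" 4] Rez[of n]
    by (auto simp: c_def)
  have acc: "abs_conv_beyond (\<lambda>n. complex_of_real (c n)) 1"
    by (rule abs_conv_beyond_mono[of "\<lambda>_. 4"])
       (use c0 c4 in \<open>auto simp: abs_conv_beyond_def summable_real_powr_iff intro!: summable_mult\<close>)
  have D_eq: "D s = exp (dirichlet_series (\<lambda>n. of_real (c n)) s)" if s: "Re s > 1" for s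
  proof -
    have s1: "s \<noteq> 1" using s by auto
    let ?w = "\<lambda>\<psi> n. of_real (log_weight n) * (\<psi> n :: complex)"
    have "D s = dirichlet_L (\<lambda>_. 1) s ^ 2 * f1 s * f2 s"
      using s1 dirichlet_L_props(3)[OF tr s1] by (simp add: D_def g_def f11 f21 power2_eq_square)
    also have "\<dots> = exp (2 * dirichlet_series (?w (\<lambda>_. 1)) s + dirichlet_series (?w chi) (s + \<i> * of_real t) + dirichlet_series (?w chi') (s + \<i> * of_real (-t)))"
      unfolding f1_def f2_def
      using s dirichlet_L_eq_exp[OF tr s] dirichlet_L_eq_exp[OF chi, of "s + \<i> * of_real t"]
        dirichlet_L_eq_exp[OF chi', of "s + \<i> * of_real (-t)"]
      by (simp add: exp_add exp_double)
    also have "2 * dirichlet_series (?w (\<lambda>_. 1)) s + dirichlet_series (?w chi) (s + \<i> * of_real t) + dirichlet_series (?w chi') (s + \<i> * of_real (-t))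
        = dirichlet_series (\<lambda>n. of_real (c n)) s"
    proof -
      have "(\<lambda>n. 2 * (?w (\<lambda>_. 1) n * of_nat n powr (-s)) + ?w chi n * of_nat n powr (- (s + \<i> * of_real t)) +
          ?w chi' n * of_nat n powr (- (s + \<i> * of_real (-t)))) sums
        (2 * dirichlet_series (?w (\<lambda>_. 1)) s + dirichlet_series (?w chi) (s + \<i> * of_real t) + dirichlet_series (?w chi') (s + \<i> * of_real (-t)))"
        using s dirichlet_character_norm_le[OF chi] dirichlet_character_norm_le[OF chi']
        by (intro sums_add sums_mult dirichlet_series_sums[OF abs_conv_log_weight]) auto
      moreover have "2 * (?w (\<lambda>_. 1) n * of_nat n powr (-s)) + ?w chi n * of_nat n powr (- (s + \<i> * of_real t)) +
          ?w chi' n * of_nat n powr (- (s + \<i> * of_real (-t))) = of_real (c n) * of_nat n powr (-s)" for n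
      proof (cases "n = 0")
        case False
        have e1: "chi n * of_nat n powr (- (s + \<i> * of_real t)) = of_nat n powr (-s) * z n"
          unfolding z_def minus_add_distrib powr_add by (simp add: mult_ac)
        have e2: "chi' n * of_nat n powr (- (s + \<i> * of_real (-t))) = of_nat n powr (-s) * cnj (z n)"
          unfolding z_def chi'_def minus_add_distrib powr_add by (simp add: mult_ac cnj_of_nat_powr)
        have e3: "complex_of_real (c n) = of_real (log_weight n) * (2 + (z n + cnj (z n)))"
          unfolding complex_add_cnj c_def by simp
        show ?thesis unfolding mult.assoc e1 e2 e3 by (simp add: algebra_simps)
      qed simp
      ultimately show ?thesis by (simp add: dirichlet_series_def sums_unique)
    qed
    finally show ?thesis .
  qed
  \<comment> \<open>The point 1/2 is chosen because the term at n^2 then carries the weight 1 /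
    n.\<close>
  have "summable (\<lambda>n. c n * real n powr (-(1/2)))"
    by (rule landau_log_series[OF c0 acc \<tau> _ D_eq]) (use holD in \<open>auto simp: S_def\<close>)
  hence s1: "summable (\<lambda>n. c n * real n powr (-(1/2)))" .
  have s2: "summable ((\<lambda>n. c n * real n powr (-(1/2))) \<circ> (\<lambda>n. n ^ 2))"
    by (rule summable_reindex[OF s1]) (use c0 in \<open>auto intro!: inj_onI mult_nonneg_nonneg simp: power2_eq_iff_nonneg\<close>)
  have "summable (\<lambda>n. (2/3) * (c n * real n powr (-(1/2)) + c (n ^ 2) * real (n ^ 2) powr (-(1/2))))"
    using summable_add[OF s1 s2] by (intro summable_mult) (simp add: o_def)
  hence "summable (\<lambda>n. log_weight n * real n powr (-1))"
  proof (rule summable_comparison_test'[where N = 1])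
    fix n :: nat assume n: "n \<ge> 1"
    have zz: "z (n ^ 2) = z n ^ 2"
      using n dirichlet_character_power[OF chi, of n 2]
      by (simp add: z_def power_mult_distrib powr_times_real power2_eq_square)
    \<comment> \<open>With u = Re (z n) and |z n| <= 1, the real part of (z n)^2 is at least 2 u^2 -
      1, so the left side is at least 2 (u + 1/2)^2 + 3/2. The factor 2/3 above is the reciprocal of
      this minimum.\<close>
    have "2 + 2 * Re (z n) + (1 + Re (z n ^ 2)) \<ge> 3 / 2"
    proof -
      have "(Re (z n))\<^sup>2 + (Im (z n))\<^sup>2 \<le> 1"
        using nz[of n] by (metis cmod_power2 norm_ge_zero one_power2 power_mono)
      moreover have "Re (z n ^ 2) = (Re (z n))\<^sup>2 - (Im (z n))\<^sup>2" by (simp add: power2_eq_square)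
      moreover have "0 \<le> (Re (z n) + 1 / 2)\<^sup>2" by simp
      ultimately show ?thesis by (simp add: power2_sum power2_eq_square field_simps)
    qed
    hence "log_weight n * (3 / 2) \<le> log_weight n * (2 + 2 * Re (z n) + (1 + Re (z n ^ 2)))"
      using log_weight_bounds(1)[of n] by (intro mult_left_mono)
    also have "\<dots> = c n + c (n ^ 2)"
      by (simp add: c_def log_weight_square zz field_simps)
    finally have "log_weight n * (3 / 2) \<le> c n + c (n ^ 2)" .
    hence "log_weight n * (3 / 2) * real n powr (-1) \<le> (c n + c (n ^ 2)) * real n powr (-1)"
      by (intro mult_right_mono) auto
    also have "\<dots> = c n * real n powr (-1) + c (n ^ 2) * real n powr (-1)" by (simp add: algebra_simps)
    also have "c n * real n powr (-1) \<le> c n * real n powr (-(1/2))"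
      using n c0 by (intro mult_left_mono powr_mono) auto
    finally have fin: "log_weight n * (3 / 2) * real n powr (-1) \<le> c n * real n powr (-(1/2)) + c (n ^ 2) * real n powr (-1)"
      by simp
    have e: "real (n ^ 2) powr (-(1/2)) = real n powr (-1)"
      using n by (simp add: powr_powr flip: powr_numeral)
    show "norm (log_weight n * real n powr (-1)) \<le> (2/3) * (c n * real n powr (-(1/2)) + c (n ^ 2) * real (n ^ 2) powr (-(1/2)))"
    proof -
      have "norm (log_weight n * real n powr (-1)) = log_weight n * real n powr (-1)"
        using log_weight_bounds(1)[of n] by simp
      moreover have "L \<le> 2 / 3 * (X + Y)" if "3 / 2 * L \<le> X + Y" for L X Y :: real
        using that by simp
      moreover have "3 / 2 * (log_weight n * real n powr (-1)) \<le> c n * real n powr (-(1/2)) + c (n ^ 2) * real n powr (-1)"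
        using fin by (simp only: mult_ac)
      ultimately show ?thesis unfolding e by (simp only:)
    qed
  qed
  thus False using not_summable_log_weight by simp
qed

section \<open>Bounds for the logarithmic derivative under GRH\<close>

text \<open>\<open>generalized_riemann_hypothesis\<close> speaks of the open critical strip only;
  the line Re s = 1 is covered by \<open>dirichlet_L_nonzero_on_line_1\<close> and the half-plane
  beyond it by the exponential representation.\<close>

lemma dirichlet_L_nonzero:
  assumes grh: "generalized_riemann_hypothesis" and chi: "dirichlet_character q chi"
    and s: "Re s > 1 / 2" and alt: "chi \<noteq> principal_character q \<or> s \<noteq> 1"
  shows "dirichlet_L chi s \<noteq> 0"
proof -
  consider "Re s > 1" | "Re s = 1" | "Re s < 1" by linarith
  thus ?thesis
  proof cases
    case 1
    thus ?thesis using dirichlet_L_eq_exp[OF chi] by simp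
  next
    case 2
    hence "s = Complex 1 (Im s)" by (simp add: complex_eq_iff)
    moreover have "chi \<noteq> principal_character q \<or> Im s \<noteq> 0" using alt 2 by (auto simp: complex_eq_iff)
    ultimately show ?thesis using dirichlet_L_nonzero_on_line_1[OF chi] by metis
  next
    case 3
    show ?thesis
    proof
      assume "dirichlet_L chi s = 0"
      hence "s \<in> nontrivial_zeros (dirichlet_L chi)" using s 3 by (simp add: nontrivial_zeros_def)
      hence "Re s = 1 / 2" using grh chi unfolding generalized_riemann_hypothesis_def by blast
      thus False using s by simp
    qed
  qed
qed

text \<open>Schwarz's lemma for g / (2 M' - g), which maps the unit disc into itself because Re g <
  M'. The summand 1 in M' makes this inequality strict and M' positive.\<close>

lemma borel_caratheodory:
  assumes hol: "f holomorphic_on ball z0 R" and M: "\<And>z. z \<in> ball z0 R \<Longrightarrow> Re (f z) \<le> M" "M \<ge> 0"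
    and A: "norm (f z0) \<le> A" and z: "norm (z - z0) \<le> \<rho>" and \<rho>: "0 \<le> \<rho>" "\<rho> < R"
  shows "norm (f z) \<le> A + 2 * (M + A + 1) * \<rho> / (R - \<rho>)"
proof -
  define M' where "M' = M + A + 1"
  have A0: "A \<ge> 0" using A norm_ge_zero order_trans by blast
  have M': "M' > 0" using M(2) A0 by (simp add: M'_def)
  have R: "R > 0" using \<rho> by simp
  define g where "g = (\<lambda>w. f (z0 + of_real R * w) - f z0)"
  have inb: "z0 + of_real R * w \<in> ball z0 R" if "norm w < 1" for w
    using that R by (simp add: dist_norm norm_mult)
  have gre: "Re (g w) < M'" if "norm w < 1" for w
    using M(1)[OF inb[OF that]] A abs_Re_le_cmod[of "f z0"] by (simp add: g_def M'_def)
  have "f \<circ> (\<lambda>w. z0 + of_real R * w) holomorphic_on ball 0 1"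
    by (rule holomorphic_on_compose_gen[OF _ hol]) (use inb in \<open>auto intro!: holomorphic_intros\<close>)
  hence holg: "g holomorphic_on ball 0 1" unfolding g_def o_def by (intro holomorphic_intros)
  define h where "h = (\<lambda>w. g w / (of_real (2 * M') - g w))"
  have nz: "of_real (2 * M') - g w \<noteq> 0" if "norm w < 1" for w
    using gre[OF that] M' by (auto simp: complex_eq_iff)
  have hh: "norm (h w) < 1" if w: "norm w < 1" for w
  proof -
    have "(norm (g w))\<^sup>2 < (norm (of_real (2 * M') - g w))\<^sup>2"
    proof -
      have "(norm (of_real (2 * M') - g w))\<^sup>2 - (norm (g w))\<^sup>2 = 4 * M' * (M' - Re (g w))"
        unfolding cmod_power2 by (simp add: power2_eq_square algebra_simps)
      also have "\<dots> > 0" using gre[OF w] M' by simp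
      finally show ?thesis by simp
    qed
    hence "norm (g w) < norm (of_real (2 * M') - g w)" by (rule power2_less_imp_less) simp
    thus ?thesis using nz[OF w] by (simp add: h_def norm_divide)
  qed
  define w where "w = (z - z0) / of_real R"
  have w1: "norm w \<le> \<rho> / R" using z R by (simp add: w_def norm_divide divide_right_mono)
  hence w2: "norm w < 1" using \<rho> R by (auto intro: le_less_trans)
  have "norm (h w) \<le> norm w"
  proof (rule Schwarz_Lemma(1)[OF _ _ hh w2])
    show "h holomorphic_on ball 0 1" unfolding h_def by (intro holomorphic_intros holg) (use nz in auto)
  qed (simp_all add: h_def g_def)
  hence hw: "norm (h w) \<le> \<rho> / R" using w1 by simp
  have "g w = of_real (2 * M') * h w / (1 + h w)"
  proof -
    have "1 + h w = of_real (2 * M') / (of_real (2 * M') - g w)"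
      using nz[OF w2] by (simp add: h_def field_simps)
    thus ?thesis using nz[OF w2] M' by (simp add: h_def)
  qed
  hence "norm (g w) = 2 * M' * norm (h w) / norm (1 + h w)"
    using M' by (simp add: norm_mult norm_divide)
  also have "\<dots> \<le> 2 * M' * (\<rho> / R) / (1 - \<rho> / R)"
  proof (intro frac_le mult_left_mono hw)
    show "1 - \<rho> / R \<le> norm (1 + h w)" using hw norm_triangle_ineq4[of "1 + h w" "h w"] by simp
  qed (use M' \<rho> R in auto)
  also have "\<dots> = 2 * M' * \<rho> / (R - \<rho>)" using R \<rho> by (simp add: field_simps)
  finally have "norm (g w) \<le> 2 * M' * \<rho> / (R - \<rho>)" .
  moreover have "f z = g w + f z0" using R by (simp add: g_def w_def)
  ultimately show ?thesis using A norm_triangle_ineq[of "g w" "f z0"] by (simp add: M'_def)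
qed

text \<open>Hadamard's three circles theorem up to a constant factor: interpolate geometrically between
  the two Cauchy bounds on each Taylor coefficient.\<close>

lemma three_circles:
  assumes r: "0 < r" "r < \<rho>" "\<rho> < R"
  shows "\<exists>C>0. \<exists>\<theta>>0. \<theta> < 1 \<and> (\<forall>f z0 A M z. f holomorphic_on ball z0 R \<longrightarrow> continuous_on (cball z0 R) f \<longrightarrow>
     A > 0 \<longrightarrow> M > 0 \<longrightarrow> (\<forall>z\<in>cball z0 r. norm (f z) \<le> A) \<longrightarrow> (\<forall>z\<in>cball z0 R. norm (f z) \<le> M) \<longrightarrow>
     norm (z - z0) \<le> \<rho> \<longrightarrow> norm (f z) \<le> C * (A powr (1 - \<theta>) * M powr \<theta>))"
proof -
  define a b where "a = ln (\<rho> / r)" and "b = ln (R / \<rho>)"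
  have ab: "a > 0" "b > 0" using r by (auto simp: a_def b_def)
  \<comment> \<open>The exact Hadamard exponent a / (a + b) would make the ratio \<kappa> equal to 1
    and the geometric series diverge; the midpoint between it and 1 gives \<kappa> < 1 at the cost
    of a constant.\<close>
  define \<theta> where "\<theta> = (a + b / 2) / (a + b)"
  have \<theta>: "0 < \<theta>" "\<theta> < 1" using ab by (auto simp: \<theta>_def field_simps)
  define \<kappa> where "\<kappa> = (\<rho> / r) powr (1 - \<theta>) * (\<rho> / R) powr \<theta>"
  have \<kappa>0: "\<kappa> > 0" using r by (simp add: \<kappa>_def)
  have "ln \<kappa> = (1 - \<theta>) * a - \<theta> * b"
    using r by (simp add: \<kappa>_def ln_mult ln_powr a_def b_def ln_div algebra_simps)
  also have "\<dots> = a - \<theta> * (a + b)" by (simp add: algebra_simps)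
  also have "\<theta> * (a + b) = a + b / 2" using ab by (simp add: \<theta>_def)
  finally have "ln \<kappa> < 0" using ab by simp
  hence \<kappa>1: "\<kappa> < 1" using \<kappa>0 by simp
  show ?thesis
  proof (rule exI[of _ "1 / (1 - \<kappa>)"], rule conjI[rotated], rule exI[of _ \<theta>], intro conjI allI impI \<theta>)
    show "1 / (1 - \<kappa>) > 0" using \<kappa>1 by simp
    fix f :: "complex \<Rightarrow> complex" and z0 A M z
    assume hol: "f holomorphic_on ball z0 R" and cont: "continuous_on (cball z0 R) f"
      and AM: "A > 0" "M > 0" and bA: "\<forall>z\<in>cball z0 r. norm (f z) \<le> A" and bM: "\<forall>z\<in>cball z0 R. norm (f z) \<le> M"
      and z: "norm (z - z0) \<le> \<rho>"
    define c where "c = (\<lambda>n. (deriv ^^ n) f z0 / fact n)"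
    have zb: "z \<in> ball z0 R" using z r by (simp add: dist_norm norm_minus_commute)
    have ps: "(\<lambda>n. c n * (z - z0) ^ n) sums f z"
      unfolding c_def by (rule holomorphic_power_series[OF hol zb])
    have cA: "norm (c n) \<le> A / r ^ n" for n
    proof -
      have "norm ((deriv ^^ n) f z0) \<le> fact n * A / r ^ n"
        by (rule Cauchy_inequality) (use r bA in \<open>auto simp: dist_norm intro!: holomorphic_on_subset[OF hol] continuous_on_subset[OF cont]\<close>)
      thus ?thesis by (simp add: c_def norm_divide field_simps)
    qed
    have cM: "norm (c n) \<le> M / R ^ n" for n
    proof -
      have "norm ((deriv ^^ n) f z0) \<le> fact n * M / R ^ n"
        by (rule Cauchy_inequality) (use r bM hol cont in \<open>auto simp: dist_norm\<close>)
      thus ?thesis by (simp add: c_def norm_divide field_simps)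
    qed
    have trm: "norm (c n * (z - z0) ^ n) \<le> A powr (1 - \<theta>) * M powr \<theta> * \<kappa> ^ n" for n
    proof -
      define x where "x = norm (c n * (z - z0) ^ n)"
      have zn: "norm (z - z0) ^ n \<le> \<rho> ^ n" using z by (intro power_mono) auto
      have x1: "x \<le> A * (\<rho> / r) ^ n"
        using mult_mono[OF cA[of n] zn] r AM by (simp add: x_def norm_mult norm_power power_divide)
      have x2: "x \<le> M * (\<rho> / R) ^ n"
        using mult_mono[OF cM[of n] zn] r AM by (simp add: x_def norm_mult norm_power power_divide)
      have x0: "x \<ge> 0" by (simp add: x_def)
      have "x = x powr (1 - \<theta>) * x powr \<theta>" using x0 by (simp flip: powr_add)
      also have "\<dots> \<le> (A * (\<rho> / r) ^ n) powr (1 - \<theta>) * (M * (\<rho> / R) ^ n) powr \<theta>"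
        using x0 x1 x2 \<theta> by (intro mult_mono powr_mono2) auto
      also have "\<dots> = A powr (1 - \<theta>) * M powr \<theta> * (((\<rho> / r) powr (1 - \<theta>)) ^ n * ((\<rho> / R) powr \<theta>) ^ n)"
        using AM r by (simp add: powr_mult powr_powr flip: powr_realpow) (simp add: mult_ac)
      also have "\<dots> = A powr (1 - \<theta>) * M powr \<theta> * \<kappa> ^ n" by (simp add: \<kappa>_def power_mult_distrib)
      finally show ?thesis by (simp add: x_def)
    qed
    have sg: "(\<lambda>n. A powr (1 - \<theta>) * M powr \<theta> * \<kappa> ^ n) sums (A powr (1 - \<theta>) * M powr \<theta> * (1 / (1 - \<kappa>)))"
      using \<kappa>0 \<kappa>1 by (intro sums_mult geometric_sums) auto
    have "norm (f z) \<le> (\<Sum>n. A powr (1 - \<theta>) * M powr \<theta> * \<kappa> ^ n)"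
      unfolding sums_unique[OF ps] by (rule norm_suminf_le[OF trm sums_summable[OF sg]])
    also have "\<dots> = 1 / (1 - \<kappa>) * (A powr (1 - \<theta>) * M powr \<theta>)"
      using sums_unique[OF sg] by (simp add: mult_ac)
    finally show "norm (f z) \<le> 1 / (1 - \<kappa>) * (A powr (1 - \<theta>) * M powr \<theta>)" .
  qed
qed

lemma norm_log_series_le:
  assumes chi: "dirichlet_character q chi" and s: "Re s \<ge> 3 / 2"
  shows "norm (dirichlet_series (\<lambda>n. of_real (log_weight n) * chi n) s) \<le> (\<Sum>n. real n powr (-3/2))"
  unfolding dirichlet_series_def
proof (rule norm_suminf_le)
  show "summable (\<lambda>n. real n powr (-3/2))" by (simp add: summable_real_powr_iff)
  fix n :: nat
  show "norm (of_real (log_weight n) * chi n * of_nat n powr (-s)) \<le> real n powr (-3/2)"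
  proof (cases "n = 0")
    case False
    have "norm (of_real (log_weight n) * chi n * of_nat n powr (-s)) = log_weight n * norm (chi n) * real n powr (- Re s)"
      using log_weight_bounds(1)[of n] by (simp add: norm_mult norm_of_nat_powr)
    also have "\<dots> \<le> 1 * 1 * real n powr (-3/2)"
      using False s log_weight_bounds[of n] dirichlet_character_norm_le[OF chi, of n]
      by (intro mult_mono powr_mono) auto
    finally show ?thesis by simp
  qed simp
qed

text \<open>The disc about 3 + it of radius 5/2 touches Re s = 1/2, so the absence of zeros provides
  a logarithm on it. This logarithm is O(1) on the inner disc of radius 3/2, where its Dirichlet
  series converges, and O(log) on almost the whole disc by Borel-Caratheodory; three circles
  interpolates to a power \<theta> < 1 of the logarithm. For principal characters, |t| >= 4 keeps
  the disc away from the pole.\<close>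

lemma holomorphic_logarithm_bound:
  assumes grh: "generalized_riemann_hypothesis" and d: "0 < d" "d < 1 / 2"
  shows "\<exists>C>0. \<exists>\<theta>>0. \<theta> < 1 \<and> (\<forall>q chi t. dirichlet_character q chi \<longrightarrow>
     chi \<noteq> principal_character q \<or> \<bar>t\<bar> \<ge> 4 \<longrightarrow>
     (\<exists>l. l holomorphic_on ball (Complex 3 t) (5 / 2) \<and>
        (\<forall>s\<in>ball (Complex 3 t) (5 / 2). dirichlet_L chi s = exp (l s)) \<and>
        (\<forall>s\<in>cball (Complex 3 t) (5 / 2 - d). norm (l s) \<le> C * (1 + ln (real q * (8 + \<bar>t\<bar>))) powr \<theta>)))"
proof -
  define Z where "Z = (\<Sum>n. real n powr (-3/2)) + 1"
  have "(\<Sum>n. real n powr (-3/2)) \<ge> 0" by (intro suminf_nonneg) (auto simp: summable_real_powr_iff)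
  hence Z: "Z \<ge> 1" by (simp add: Z_def)
  obtain C0 where C0: "C0 > 0" "\<And>q chi s. dirichlet_character q chi \<Longrightarrow> Re s \<ge> 1 / 2 \<Longrightarrow>
     chi \<noteq> principal_character q \<or> \<bar>Im s\<bar> \<ge> 1 \<Longrightarrow> norm (dirichlet_L chi s) \<le> C0 * real q ^ 2 * (2 + norm s) ^ 2"
    using dirichlet_L_bound by blast
  \<comment> \<open>\<rho> is the radius of the claim; R leaves a margin d / 2 on either side, to
    the claimed disc and to the disc of holomorphy.\<close>
  define \<rho> where "\<rho> = 5 / 2 - d"
  define R where "R = 5 / 2 - d / 2"
  have rR: "(0::real) < 3 / 2" "3 / 2 < \<rho>" "\<rho> < R" using d by (auto simp: \<rho>_def R_def)
  obtain C1 \<theta> where C1: "C1 > 0" and \<theta>: "\<theta> > 0" "\<theta> < 1" and tc: "\<And>f z0 A M z. f holomorphic_on ball z0 R \<Longrightarrow> continuous_on (cball z0 R) f \<Longrightarrow>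
     A > 0 \<Longrightarrow> M > 0 \<Longrightarrow> (\<forall>z\<in>cball z0 (3/2). norm (f z) \<le> A) \<Longrightarrow> (\<forall>z\<in>cball z0 R. norm (f z) \<le> M) \<Longrightarrow>
     norm (z - z0) \<le> \<rho> \<Longrightarrow> norm (f z) \<le> C1 * (A powr (1 - \<theta>) * M powr \<theta>)"
    using three_circles[OF rR] by blast
  define K where "K = Z + 2 * (\<bar>ln C0\<bar> + 2 + Z + 1) * R / (5 / 2 - R)"
  have K: "K > 0" using Z d by (auto simp: K_def R_def intro!: add_pos_nonneg divide_nonneg_pos)
  show ?thesis
  proof (rule exI[of _ "C1 * (Z powr (1 - \<theta>) * K powr \<theta>)"], rule conjI[rotated], rule exI[of _ \<theta>], intro conjI \<theta> allI impI)
    show "C1 * (Z powr (1 - \<theta>) * K powr \<theta>) > 0" using C1 Z K by simp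
    fix q chi and t :: real
    assume chi: "dirichlet_character q chi" and alt: "chi \<noteq> principal_character q \<or> \<bar>t\<bar> \<ge> 4"
    have q: "q \<ge> 1" using chi by (auto simp: dirichlet_character_def Suc_le_eq)
    let ?z0 = "Complex 3 t"
    let ?B = "ball ?z0 (5 / 2)"
    let ?L = "dirichlet_L chi"
    have dist: "\<bar>Re s - 3\<bar> < 5 / 2" "\<bar>Im s - t\<bar> < 5 / 2" "norm s < 11 / 2 + \<bar>t\<bar>" if "s \<in> ?B" for s
    proof -
      have n: "norm (s - ?z0) < 5 / 2" using that by (simp add: dist_norm norm_minus_commute)
      show "\<bar>Re s - 3\<bar> < 5 / 2" "\<bar>Im s - t\<bar> < 5 / 2"
        using n abs_Re_le_cmod[of "s - ?z0"] abs_Im_le_cmod[of "s - ?z0"] by auto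
      have "norm ?z0 \<le> 3 + \<bar>t\<bar>" using cmod_le[of ?z0] by simp
      thus "norm s < 11 / 2 + \<bar>t\<bar>" using n norm_triangle_sub[of s ?z0] by linarith
    qed
    have reB: "Re s > 1 / 2" if "s \<in> ?B" for s using dist(1)[OF that] by linarith
    have altB: "chi \<noteq> principal_character q \<or> s \<noteq> 1" "chi \<noteq> principal_character q \<or> \<bar>Im s\<bar> \<ge> 1" if "s \<in> ?B" for s
    proof -
      have "\<bar>Im s\<bar> \<ge> 1" if "\<bar>t\<bar> \<ge> 4" using dist(2)[OF \<open>s \<in> ?B\<close>] that by linarith
      thus "chi \<noteq> principal_character q \<or> s \<noteq> 1" "chi \<noteq> principal_character q \<or> \<bar>Im s\<bar> \<ge> 1"
        using alt by auto
    qed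
    have holL: "?L holomorphic_on ?B"
    proof (cases "chi = principal_character q")
      case False
      thus ?thesis using dirichlet_L_holomorphic[OF chi] holomorphic_on_subset by blast
    next
      case True
      thus ?thesis using altB(1) by (intro holomorphic_on_subset[OF dirichlet_L_holomorphic_away[OF chi]]) auto
    qed
    have nz: "?L s \<noteq> 0" if "s \<in> ?B" for s
      by (rule dirichlet_L_nonzero[OF grh chi reB[OF that] altB(1)[OF that]])
    have hq: "(\<lambda>s. deriv ?L s / ?L s) holomorphic_on ?B"
      using holL nz by (intro holomorphic_intros) auto
    obtain P where P0: "\<And>s. s \<in> ?B \<Longrightarrow> (P has_field_derivative deriv ?L s / ?L s) (at s within ?B)"
      using holomorphic_convex_primitive'[OF convex_ball open_ball hq] by metis
    have P: "(P has_field_derivative deriv ?L s / ?L s) (at s)" if "s \<in> ?B" for s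
      using P0[OF that] by (simp only: at_within_open[OF that open_ball])
    define G where "G = dirichlet_series (\<lambda>n. of_real (log_weight n) * chi n)"
    \<comment> \<open>Normalised to agree at the centre with the Dirichlet series G of the
      logarithm, through which l is bounded on the inner disc.\<close>
    define l where "l = (\<lambda>s. P s - P ?z0 + G ?z0)"
    have l': "(l has_field_derivative deriv ?L s / ?L s) (at s)" if "s \<in> ?B" for s
      unfolding l_def using P[OF that] by (auto intro!: derivative_eq_intros)
    have L': "(?L has_field_derivative deriv ?L s) (at s)" if "s \<in> ?B" for s
      using holL that by (intro holomorphic_derivI[of _ ?B]) auto
    have z0B: "?z0 \<in> ?B" by simp
    have lz0: "l ?z0 = G ?z0" by (simp add: l_def)
    have expl: "?L s = exp (l s)" if s: "s \<in> ?B" for s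
    proof -
      have "\<exists>c. \<forall>s\<in>?B. ?L s * exp (- l s) = c"
      proof (rule has_field_derivative_zero_constant)
        fix s assume s: "s \<in> ?B"
        have "((\<lambda>s. ?L s * exp (- l s)) has_field_derivative 0) (at s)"
          using L'[OF s] l'[OF s] nz[OF s] by (auto intro!: derivative_eq_intros)
        thus "((\<lambda>s. ?L s * exp (- l s)) has_field_derivative 0) (at s within ?B)"
          by (rule has_field_derivative_at_within)
      qed simp
      then obtain c where c: "\<And>s. s \<in> ?B \<Longrightarrow> ?L s * exp (- l s) = c" by blast
      have "c = 1" using c[OF z0B] dirichlet_L_eq_exp[OF chi, of ?z0] lz0 by (simp add: G_def exp_minus)
      with c[OF s] show ?thesis by (simp add: exp_minus field_simps)
    qed
    \<comment> \<open>On the part of the disc with Re s > 1, which is convex, l and G have the same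
      derivative and agree at the centre; the inner disc lies in that part.\<close>
    have lG: "l s = G s" if s: "s \<in> cball ?z0 (3/2)" for s
    proof -
      let ?T = "?B \<inter> {s. Re s > 1}"
      have "\<exists>c. \<forall>s\<in>?T. l s - G s = c"
      proof (rule has_field_derivative_zero_constant)
        fix s assume s: "s \<in> ?T"
        have hG: "G holomorphic_on {s. Re s > 1}"
          unfolding G_def by (rule dirichlet_series_holomorphic[OF abs_conv_log_weight[OF dirichlet_character_norm_le[OF chi]]])
        have G': "(G has_field_derivative deriv G s) (at s)"
          using hG s by (intro holomorphic_derivI[OF _ open_halfspace_Re_gt[of 1]]) auto
        have "((\<lambda>s. exp (G s)) has_field_derivative exp (G s) * deriv G s) (at s)"
          by (auto intro!: derivative_eq_intros G')
        hence "(?L has_field_derivative exp (G s) * deriv G s) (at s)"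
          by (rule has_field_derivative_transform_within_open[OF _ open_halfspace_Re_gt[of 1]])
             (use s dirichlet_L_eq_exp[OF chi] in \<open>auto simp: G_def\<close>)
        hence "deriv ?L s = ?L s * deriv G s"
          using s dirichlet_L_eq_exp[OF chi, of s] by (simp add: DERIV_imp_deriv G_def)
        hence "deriv ?L s / ?L s = deriv G s" using nz[of s] s by simp
        hence "((\<lambda>s. l s - G s) has_field_derivative 0) (at s)"
          using l'[of s] s G' by (auto intro!: derivative_eq_intros)
        thus "((\<lambda>s. l s - G s) has_field_derivative 0) (at s within ?T)"
          by (rule has_field_derivative_at_within)
      qed (simp add: convex_Int convex_halfspace_Re_gt)
      then obtain c where c: "\<And>s. s \<in> ?T \<Longrightarrow> l s - G s = c" by blast
      have "norm (?z0 - s) \<le> 3 / 2" using s by (simp add: dist_norm)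
      hence "Re s \<ge> 3 / 2" "s \<in> ?B" using abs_Re_le_cmod[of "?z0 - s"] by (auto simp: dist_norm)
      hence "s \<in> ?T" by simp
      moreover have "?z0 \<in> ?T" by simp
      ultimately show ?thesis using c[of s] c[of ?z0] lz0 by simp
    qed
    have lA: "norm (l s) \<le> Z" if s: "s \<in> cball ?z0 (3/2)" for s
    proof -
      have "norm (?z0 - s) \<le> 3 / 2" using s by (simp add: dist_norm)
      hence "Re s \<ge> 3 / 2" using abs_Re_le_cmod[of "?z0 - s"] by auto
      thus ?thesis using norm_log_series_le[OF chi, of s] lG[OF s] by (simp add: Z_def G_def)
    qed
    have hol_l: "l holomorphic_on ?B"
      by (subst holomorphic_on_open) (simp, use l' in blast)
    \<comment> \<open>The 8 covers the summand 2 of the growth bound together with |s| < 11/2 + |t|;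
      the leading 1 keeps y >= 1, so that constants can be absorbed into multiples of y.\<close>
    define y where "y = 1 + ln (real q * (8 + \<bar>t\<bar>))"
    have "1 * 1 \<le> real q * (8 + \<bar>t\<bar>)" using q by (intro mult_mono) auto
    hence ln0: "ln (real q * (8 + \<bar>t\<bar>)) \<ge> 0" by simp
    hence y: "y \<ge> 1" by (simp add: y_def)
    define M where "M = \<bar>ln C0\<bar> + 2 * y"
    have ReM: "Re (l s) \<le> M" if s: "s \<in> ?B" for s
    proof -
      have "exp (Re (l s)) = norm (?L s)" using expl[OF s] by simp
      also have "\<dots> \<le> C0 * real q ^ 2 * (2 + norm s) ^ 2"
        using C0(2)[OF chi _ altB(2)[OF s]] reB[OF s] by simp
      also have "\<dots> \<le> C0 * real q ^ 2 * (8 + \<bar>t\<bar>) ^ 2"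
        using C0(1) dist(3)[OF s] by (intro mult_left_mono power_mono) auto
      also have "\<dots> = C0 * (real q * (8 + \<bar>t\<bar>)) ^ 2" by (simp add: power_mult_distrib)
      finally have "Re (l s) \<le> ln (C0 * (real q * (8 + \<bar>t\<bar>)) ^ 2)"
        using C0(1) q by (subst ln_ge_iff) (auto intro!: mult_pos_pos zero_less_power add_pos_nonneg)
      also have "\<dots> = ln C0 + 2 * ln (real q * (8 + \<bar>t\<bar>))"
        using C0(1) q by (subst ln_mult) (auto simp: ln_realpow intro!: mult_pos_pos zero_less_power add_pos_nonneg)
      finally show ?thesis by (simp add: M_def y_def)
    qed
    have lK: "norm (l s) \<le> K * y" if s: "s \<in> cball ?z0 R" for s
    proof -
      have "norm (l s) \<le> Z + 2 * (M + Z + 1) * R / (5 / 2 - R)"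
        by (rule borel_caratheodory[OF hol_l ReM])
           (use s y lA[of ?z0] d in \<open>auto simp: M_def R_def dist_norm norm_minus_commute\<close>)
      also have "\<dots> \<le> Z * y + 2 * ((\<bar>ln C0\<bar> + 2 + Z + 1) * y) * R / (5 / 2 - R)"
      proof (intro add_mono divide_right_mono mult_right_mono mult_left_mono)
        have "(\<bar>ln C0\<bar> + Z + 1) * 1 \<le> (\<bar>ln C0\<bar> + Z + 1) * y"
          using y Z by (intro mult_left_mono) auto
        thus "M + Z + 1 \<le> (\<bar>ln C0\<bar> + 2 + Z + 1) * y" by (simp add: M_def algebra_simps)
        show "Z \<le> Z * y" using y Z by simp
      qed (use d in \<open>auto simp: R_def\<close>)
      also have "\<dots> = K * y" by (simp add: K_def field_simps)
      finally show ?thesis .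
    qed
    have fin: "norm (l s) \<le> C1 * (Z powr (1 - \<theta>) * K powr \<theta>) * y powr \<theta>" if s: "s \<in> cball ?z0 \<rho>" for s
    proof -
      have RB: "cball ?z0 R \<subseteq> ?B" using d by (auto simp: R_def)
      have "norm (l s) \<le> C1 * (Z powr (1 - \<theta>) * (K * y) powr \<theta>)"
      proof (rule tc[of l ?z0 Z "K * y" s])
        show "l holomorphic_on ball ?z0 R" by (rule holomorphic_on_subset[OF hol_l]) (use RB in auto)
        show "continuous_on (cball ?z0 R) l"
          by (rule holomorphic_on_imp_continuous_on[OF holomorphic_on_subset[OF hol_l RB]])
      qed (use Z K y lA lK s in \<open>auto simp: dist_norm norm_minus_commute\<close>)
      thus ?thesis using K y by (simp add: powr_mult mult_ac)
    qed
    show "\<exists>l. l holomorphic_on ?B \<and> (\<forall>s\<in>?B. dirichlet_L chi s = exp (l s)) \<and>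
        (\<forall>s\<in>cball ?z0 (5 / 2 - d). norm (l s) \<le> C1 * (Z powr (1 - \<theta>) * K powr \<theta>) * (1 + ln (real q * (8 + \<bar>t\<bar>))) powr \<theta>)"
      using hol_l expl fin by (intro exI[of _ l]) (auto simp: y_def \<rho>_def)
  qed
qed

text \<open>This is where \<theta> < 1 pays off: after exponentiation the bound for the logarithm
  costs only an arbitrarily small power of the height.\<close>

lemma powr_absorbed_by_linear:
  fixes C \<theta> \<eta> :: real
  assumes "C > 0" "0 < \<theta>" "\<theta> < 1" "\<eta> > 0"
  obtains K where "\<And>x. x \<ge> 0 \<Longrightarrow> C * x powr \<theta> \<le> \<eta> * x + K"
proof
  define x0 where "x0 = (C / \<eta>) powr (1 / (1 - \<theta>))"
  fix x :: real assume x: "x \<ge> 0"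
  show "C * x powr \<theta> \<le> \<eta> * x + C * x0 powr \<theta>"
  proof (cases "x \<le> x0")
    case True
    have "C * x powr \<theta> \<le> C * x0 powr \<theta>" using True x assms by (intro mult_left_mono powr_mono2) auto
    thus ?thesis using x assms by (simp add: add_increasing)
  next
    case False
    have x0: "x0 > 0" using assms by (simp add: x0_def)
    have "C / \<eta> = x0 powr (1 - \<theta>)" using assms by (simp add: x0_def powr_powr)
    also have "\<dots> \<le> x powr (1 - \<theta>)" using False x0 assms by (intro powr_mono2) auto
    finally have "C \<le> \<eta> * x powr (1 - \<theta>)" using assms by (simp add: field_simps)
    hence "C * x powr \<theta> \<le> \<eta> * x powr (1 - \<theta>) * x powr \<theta>" by (intro mult_right_mono) auto
    also have "\<dots> = \<eta> * x" using x by (simp add: mult.assoc flip: powr_add)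
    finally show ?thesis using assms by (simp add: add_increasing2)
  qed
qed

text \<open>The reciprocal of zeta, written through (s - 1) zeta(s) so that its holomorphy at s = 1,
  where zeta has its pole, is visible.\<close>

definition inverse_zeta :: "complex \<Rightarrow> complex" where
  "inverse_zeta s = (s - 1) / L_entire 1 (\<lambda>_. 1) s"

lemma trivial_character: "dirichlet_character 1 (\<lambda>_. 1)"
  using dirichlet_character_trivial by simp

lemma inverse_zeta_eq: "s \<noteq> 1 \<Longrightarrow> inverse_zeta s = 1 / dirichlet_L (\<lambda>_. 1) s"
  using dirichlet_L_props(3)[OF trivial_character] by (simp add: inverse_zeta_def)

lemma inverse_zeta_holomorphic:
  assumes grh: "generalized_riemann_hypothesis"
  shows "inverse_zeta holomorphic_on {s. Re s > 1 / 2}"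
proof -
  have "L_entire 1 (\<lambda>_. 1) s \<noteq> 0" if "Re s > 1 / 2" for s
  proof (cases "s = 1")
    case False
    thus ?thesis using dirichlet_L_nonzero[OF grh trivial_character that] dirichlet_L_props(3)[OF trivial_character False]
      by auto
  qed (simp add: L_entire_trivial_1[simplified])
  thus ?thesis unfolding inverse_zeta_def
    by (intro holomorphic_intros holomorphic_on_subset[OF L_entire_holomorphic[OF trivial_character]]) auto
qed

lemma inverse_zeta_bound:
  assumes grh: "generalized_riemann_hypothesis" and d: "0 < d" "d < 1 / 2" and \<eta>: "\<eta> > 0"
  shows "\<exists>C>0. \<forall>s. 1 / 2 + d \<le> Re s \<longrightarrow> Re s \<le> 3 \<longrightarrow> norm (inverse_zeta s) \<le> C * (8 + \<bar>Im s\<bar>) powr \<eta>"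
proof -
  obtain C \<theta> where C: "C > 0" "\<theta> > 0" "\<theta> < 1" and l: "\<And>q chi t. dirichlet_character q chi \<Longrightarrow>
     chi \<noteq> principal_character q \<or> \<bar>t\<bar> \<ge> 4 \<Longrightarrow>
     (\<exists>l. l holomorphic_on ball (Complex 3 t) (5 / 2) \<and>
        (\<forall>s\<in>ball (Complex 3 t) (5 / 2). dirichlet_L chi s = exp (l s)) \<and>
        (\<forall>s\<in>cball (Complex 3 t) (5 / 2 - d). norm (l s) \<le> C * (1 + ln (real q * (8 + \<bar>t\<bar>))) powr \<theta>))"
    using holomorphic_logarithm_bound[OF grh d] by blast
  obtain K where K: "\<And>x. x \<ge> 0 \<Longrightarrow> C * x powr \<theta> \<le> \<eta> * x + K"
    using powr_absorbed_by_linear[OF C \<eta>] by blast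
  \<comment> \<open>Small heights are excluded from the logarithm bound on account of the pole of
    zeta; there compactness takes over.\<close>
  have "compact (inverse_zeta ` cbox (Complex (1 / 2 + d) (-4)) (Complex 3 4))"
    by (intro compact_continuous_image compact_cbox holomorphic_on_imp_continuous_on
          holomorphic_on_subset[OF inverse_zeta_holomorphic[OF grh]])
       (use d in \<open>auto simp: in_cbox_complex_iff\<close>)
  then obtain B where B: "B > 0" "\<And>s. s \<in> cbox (Complex (1 / 2 + d) (-4)) (Complex 3 4) \<Longrightarrow> norm (inverse_zeta s) \<le> B"
    using compact_imp_bounded bounded_pos by (metis imageI)
  have "norm (inverse_zeta s) \<le> (B + exp (\<eta> + K)) * (8 + \<bar>Im s\<bar>) powr \<eta>" if s: "1 / 2 + d \<le> Re s" "Re s \<le> 3" for s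
  proof (cases "\<bar>Im s\<bar> \<ge> 4")
    case True
    let ?t = "Im s"
    obtain l where l: "\<And>s. s\<in>ball (Complex 3 ?t) (5 / 2) \<Longrightarrow> dirichlet_L (\<lambda>_. 1) s = exp (l s)"
       "\<And>s. s\<in>cball (Complex 3 ?t) (5 / 2 - d) \<Longrightarrow> norm (l s) \<le> C * (1 + ln (8 + \<bar>?t\<bar>)) powr \<theta>"
      using l[OF trivial_character, of ?t] True by auto
    have "dist (Complex 3 ?t) s = 3 - Re s"
      using s by (simp add: dist_norm cmod_def)
    hence sb: "s \<in> cball (Complex 3 ?t) (5 / 2 - d)" "s \<in> ball (Complex 3 ?t) (5 / 2)" using s d by auto
    have s1: "s \<noteq> 1" using True by auto
    have "norm (inverse_zeta s) = exp (- Re (l s))"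
      using inverse_zeta_eq[OF s1] l(1)[OF sb(2)] by (simp add: norm_divide exp_minus inverse_eq_divide)
    also have "\<dots> \<le> exp (norm (l s))" using abs_Re_le_cmod[of "l s"] by simp
    also have "\<dots> \<le> exp (C * (1 + ln (8 + \<bar>?t\<bar>)) powr \<theta>)" using l(2)[OF sb(1)] by simp
    also have "\<dots> \<le> exp (\<eta> * (1 + ln (8 + \<bar>?t\<bar>)) + K)" using K[of "1 + ln (8 + \<bar>?t\<bar>)"] by simp
    also have "\<dots> = exp (\<eta> + K) * (8 + \<bar>?t\<bar>) powr \<eta>"
      by (simp add: powr_def algebra_simps flip: exp_add)
    also have "\<dots> \<le> (B + exp (\<eta> + K)) * (8 + \<bar>?t\<bar>) powr \<eta>" using B by (intro mult_right_mono) auto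
    finally show ?thesis .
  next
    case False
    have "norm (inverse_zeta s) \<le> B" using s False by (intro B(2)) (auto simp: in_cbox_complex_iff)
    also have "\<dots> \<le> (B + exp (\<eta> + K)) * 1" by simp
    also have "\<dots> \<le> (B + exp (\<eta> + K)) * (8 + \<bar>Im s\<bar>) powr \<eta>"
      using B \<eta> by (intro mult_left_mono ge_one_powr_ge_zero) (auto intro: add_nonneg_nonneg)
    finally show ?thesis .
  qed
  thus ?thesis using B by (intro exI[of _ "B + exp (\<eta> + K)"]) (auto intro: add_pos_pos)
qed

lemma Cauchy_deriv_bound:
  assumes hol: "f holomorphic_on S" and S: "cball z r \<subseteq> S" and r: "r > 0"
    and B: "\<And>w. w \<in> cball z r \<Longrightarrow> norm (f w) \<le> B"
  shows "norm (deriv f z) \<le> B / r"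
proof -
  have "norm ((deriv ^^ 1) f z) \<le> fact 1 * B / r ^ 1"
  proof (rule Cauchy_inequality[OF _ _ r])
    show "f holomorphic_on ball z r"
      by (rule holomorphic_on_subset[OF hol]) (use S ball_subset_cball in blast)
    show "continuous_on (cball z r) f"
      by (rule holomorphic_on_imp_continuous_on[OF holomorphic_on_subset[OF hol S]])
  qed (use B in \<open>auto simp: dist_norm\<close>)
  thus ?thesis by simp
qed

text \<open>Cauchy's estimate on discs of radius d. They have to stay to the right of 1/2 + d, hence
  the abscissa 1/2 + 2 d, and to the left of 3.\<close>

lemma inverse_zeta_deriv_bound:
  assumes grh: "generalized_riemann_hypothesis" and d: "0 < d" "d < 1 / 2" and \<eta>: "\<eta> > 0"
  shows "\<exists>C>0. \<forall>s. 1 / 2 + 2 * d \<le> Re s \<longrightarrow> Re s \<le> 2 \<longrightarrow> norm (deriv inverse_zeta s) \<le> C * (8 + \<bar>Im s\<bar>) powr \<eta>"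
proof -
  obtain C where C: "C > 0" "\<And>s. 1 / 2 + d \<le> Re s \<Longrightarrow> Re s \<le> 3 \<Longrightarrow> norm (inverse_zeta s) \<le> C * (8 + \<bar>Im s\<bar>) powr \<eta>"
    using inverse_zeta_bound[OF assms] by blast
  have "norm (deriv inverse_zeta s) \<le> C * 2 powr \<eta> / d * (8 + \<bar>Im s\<bar>) powr \<eta>" if s: "1 / 2 + 2 * d \<le> Re s" "Re s \<le> 2" for s
  proof -
    have near: "\<bar>Re s - Re w\<bar> \<le> d" "\<bar>Im s - Im w\<bar> \<le> d" if "w \<in> cball s d" for w
      using that abs_Re_le_cmod[of "s - w"] abs_Im_le_cmod[of "s - w"] by (auto simp: dist_norm)
    have "norm (deriv inverse_zeta s) \<le> (C * (2 * (8 + \<bar>Im s\<bar>)) powr \<eta>) / d"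
    proof (rule Cauchy_deriv_bound[OF inverse_zeta_holomorphic[OF grh] _ d(1)])
      show "cball s d \<subseteq> {s. 1 / 2 < Re s}" using near(1) s d by fastforce
      fix w assume w: "w \<in> cball s d"
      have "norm (inverse_zeta w) \<le> C * (8 + \<bar>Im w\<bar>) powr \<eta>"
        using near(1)[OF w] s d by (intro C(2)) linarith+
      also have "\<dots> \<le> C * (2 * (8 + \<bar>Im s\<bar>)) powr \<eta>"
      proof (intro mult_left_mono powr_mono2)
        show "8 + \<bar>Im w\<bar> \<le> 2 * (8 + \<bar>Im s\<bar>)" 
        proof -
          have "8 + y \<le> 2 * (8 + x)" if "z \<le> d" "y - x \<le> z" "0 \<le> x" for x y z :: real
            using that d by (simp add: field_simps)
          from this[OF near(2)[OF w] abs_triangle_ineq2_sym abs_ge_zero] show ?thesis .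
        qed
      qed (use C \<eta> in auto)
      finally show "norm (inverse_zeta w) \<le> C * (2 * (8 + \<bar>Im s\<bar>)) powr \<eta>" .
    qed
    moreover have "(2 * (8 + \<bar>Im s\<bar>)) powr \<eta> = 2 powr \<eta> * (8 + \<bar>Im s\<bar>) powr \<eta>"
      by (rule powr_mult)
    ultimately show ?thesis by (simp only: mult.assoc times_divide_eq_left)
  qed
  thus ?thesis using C d by (intro exI[of _ "C * 2 powr \<eta> / d"]) auto
qed

text \<open>The quotient is the derivative of the holomorphic logarithm, so Cauchy's estimate on a
  disc of radius d applies to the logarithm directly. A power of a logarithm results, which lies
  below any positive power of q (8 + |Im s|).\<close>

lemma dirichlet_L_logderiv_bound:
  assumes grh: "generalized_riemann_hypothesis" and d: "0 < d" "d < 1 / 2" and \<eta>: "\<eta> > 0"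
  shows "\<exists>C>0. \<forall>q chi s. dirichlet_character q chi \<longrightarrow> chi \<noteq> principal_character q \<longrightarrow>
     1 / 2 + 2 * d \<le> Re s \<longrightarrow> Re s \<le> 3 \<longrightarrow>
     norm (deriv (dirichlet_L chi) s / dirichlet_L chi s) \<le> C * (real q * (8 + \<bar>Im s\<bar>)) powr \<eta>"
proof -
  obtain C \<theta> where C: "C > 0" "\<theta> > 0" "\<theta> < 1" and l: "\<And>q chi t. dirichlet_character q chi \<Longrightarrow>
     chi \<noteq> principal_character q \<or> \<bar>t\<bar> \<ge> 4 \<Longrightarrow>
     (\<exists>l. l holomorphic_on ball (Complex 3 t) (5 / 2) \<and>
        (\<forall>s\<in>ball (Complex 3 t) (5 / 2). dirichlet_L chi s = exp (l s)) \<and>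
        (\<forall>s\<in>cball (Complex 3 t) (5 / 2 - d). norm (l s) \<le> C * (1 + ln (real q * (8 + \<bar>t\<bar>))) powr \<theta>))"
    using holomorphic_logarithm_bound[OF grh d] by blast
  have "norm (deriv (dirichlet_L chi) s / dirichlet_L chi s) \<le> C * (1 + 1 / \<eta>) / d * (real q * (8 + \<bar>Im s\<bar>)) powr \<eta>"
    if chi: "dirichlet_character q chi" and np: "chi \<noteq> principal_character q"
      and s: "1 / 2 + 2 * d \<le> Re s" "Re s \<le> 3" for q chi s
  proof -
    let ?t = "Im s"
    let ?B = "ball (Complex 3 ?t) (5 / 2)"
    have q: "q \<ge> 1" using chi by (auto simp: dirichlet_character_def Suc_le_eq)
    define X where "X = real q * (8 + \<bar>?t\<bar>)"
    have "1 * 1 \<le> real q * (8 + \<bar>?t\<bar>)" using q by (intro mult_mono) auto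
    hence X: "X \<ge> 1" by (simp add: X_def)
    obtain l where l: "l holomorphic_on ?B" "\<And>s. s\<in>?B \<Longrightarrow> dirichlet_L chi s = exp (l s)"
       "\<And>s. s\<in>cball (Complex 3 ?t) (5 / 2 - d) \<Longrightarrow> norm (l s) \<le> C * (1 + ln X) powr \<theta>"
      using l[OF chi, of ?t] np unfolding X_def by auto
    have ds: "dist (Complex 3 ?t) s = 3 - Re s" using s by (simp add: dist_norm cmod_def)
    have sB: "s \<in> ?B" using ds s d by auto
    have sub: "cball s d \<subseteq> cball (Complex 3 ?t) (5 / 2 - d)"
    proof
      fix w assume "w \<in> cball s d"
      thus "w \<in> cball (Complex 3 ?t) (5 / 2 - d)"
        using dist_triangle[of "Complex 3 ?t" w s] ds s by simp
    qed
    have "(l has_field_derivative deriv l s) (at s)"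
      by (rule holomorphic_derivI[OF l(1) open_ball sB])
    hence "((\<lambda>s. exp (l s)) has_field_derivative exp (l s) * deriv l s) (at s)"
      by (auto intro!: derivative_eq_intros)
    hence "(dirichlet_L chi has_field_derivative exp (l s) * deriv l s) (at s)"
      by (rule has_field_derivative_transform_within_open[OF _ open_ball sB]) (simp add: l(2))
    hence "deriv (dirichlet_L chi) s / dirichlet_L chi s = deriv l s"
      by (simp add: DERIV_imp_deriv l(2)[OF sB])
    also have "norm (deriv l s) \<le> C * (1 + ln X) powr \<theta> / d"
    proof (rule Cauchy_deriv_bound[OF l(1) _ d(1)])
      show "cball s d \<subseteq> ?B" using sub d by fastforce
    qed (use sub l(3) in auto)
    also have "\<dots> \<le> C * ((1 + 1 / \<eta>) * X powr \<eta>) / d"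
    proof (intro divide_right_mono mult_left_mono)
      have "(1 + ln X) powr \<theta> \<le> (1 + ln X) powr 1" using X C by (intro powr_mono) auto
      also have "\<dots> = 1 + ln X" using X by simp
      also have "\<dots> \<le> X powr \<eta> + X powr \<eta> / \<eta>"
        using X \<eta> by (intro add_mono ln_powr_bound ge_one_powr_ge_zero) auto
      finally show "(1 + ln X) powr \<theta> \<le> (1 + 1 / \<eta>) * X powr \<eta>" by (simp add: algebra_simps)
    qed (use C d in auto)
    finally show ?thesis by (simp add: X_def)
  qed
  moreover have "C * (1 + 1 / \<eta>) / d > 0" using C d \<eta> by (intro divide_pos_pos mult_pos_pos add_pos_pos) auto
  ultimately show ?thesis by blast
qed

section \<open>A truncated Perron formula\<close>

lemma contour_integral_rectpath:
  assumes "f contour_integrable_on linepath (Complex a u) (Complex b u)"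
    "f contour_integrable_on linepath (Complex b u) (Complex b v)"
    "f contour_integrable_on linepath (Complex a v) (Complex b v)"
    "f contour_integrable_on linepath (Complex a u) (Complex a v)"
  shows "contour_integral (rectpath (Complex a u) (Complex b v)) f =
     contour_integral (linepath (Complex a u) (Complex b u)) f + contour_integral (linepath (Complex b u) (Complex b v)) f
     - contour_integral (linepath (Complex a v) (Complex b v)) f - contour_integral (linepath (Complex a u) (Complex a v)) f"
proof -
  note r = has_contour_integral_reverse_linepath[OF has_contour_integral_integral[OF assms(3)]]
     has_contour_integral_reverse_linepath[OF has_contour_integral_integral[OF assms(4)]]
  have "(f has_contour_integral (contour_integral (linepath (Complex a u) (Complex b u)) f +
     (contour_integral (linepath (Complex b u) (Complex b v)) f +
     (- contour_integral (linepath (Complex a v) (Complex b v)) f + - contour_integral (linepath (Complex a u) (Complex a v)) f))))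
     (rectpath (Complex a u) (Complex b v))"
    unfolding rectpath_def Let_def complex.sel
    by (intro has_contour_integral_join has_contour_integral_integral assms r valid_path_join) auto
  thus ?thesis by (simp add: contour_integral_unique)
qed

text \<open>Bounding |s| below by |u| and integrating y^\<sigma> exactly keeps the estimate bounded
  when the segment is later extended far to the side where y^\<sigma> decays.\<close>

lemma powr_horizontal_bound:
  assumes y: "y > 0" "y \<noteq> 1" and ab: "a < b" and u: "u \<noteq> 0"
  shows "(\<lambda>s. of_real y powr s / s) contour_integrable_on linepath (Complex a u) (Complex b u)"
    and "norm (contour_integral (linepath (Complex a u) (Complex b u)) (\<lambda>s. of_real y powr s / s)) \<le>
           (y powr b - y powr a) / ln y / \<bar>u\<bar>"
proof -
  define z where "z = (\<lambda>t. linepath (Complex a u) (Complex b u) t)"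
  have z: "z t = Complex (a + t * (b - a)) u" for t
    by (simp add: z_def linepath_def complex_eq_iff algebra_simps)
  have nz: "s \<noteq> 0" if "s \<in> closed_segment (Complex a u) (Complex b u)" for s
    using that u by (auto simp: closed_segment_same_Im)
  have c: "continuous_on (closed_segment (Complex a u) (Complex b u)) (\<lambda>s. of_real y powr s / s)"
    using y nz by (auto intro!: continuous_intros)
  thus int: "(\<lambda>s. of_real y powr s / s) contour_integrable_on linepath (Complex a u) (Complex b u)"
    by (rule contour_integrable_continuous_linepath)
  define A where "A = (\<lambda>t. exp (ln y * (a + t * (b - a))) / ln y / \<bar>u\<bar>)"
  have "((\<lambda>t. y powr (a + t * (b - a)) * (b - a) / \<bar>u\<bar>) has_integral A 1 - A 0) {0..1}"
  proof (rule fundamental_theorem_of_calculus)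
    fix t :: real
    have "(A has_field_derivative y powr (a + t * (b - a)) * (b - a) / \<bar>u\<bar>) (at t within {0..1})"
      unfolding A_def using y u by (auto intro!: derivative_eq_intros simp: powr_def mult_ac)
    thus "(A has_vector_derivative y powr (a + t * (b - a)) * (b - a) / \<bar>u\<bar>) (at t within {0..1})"
      by (simp add: has_real_derivative_iff_has_vector_derivative)
  qed auto
  also have "A 1 - A 0 = (y powr b - y powr a) / ln y / \<bar>u\<bar>"
    using y by (simp add: A_def powr_def diff_divide_distrib mult_ac)
  finally have I: "((\<lambda>t. y powr (a + t * (b - a)) * (b - a) / \<bar>u\<bar>) has_integral (y powr b - y powr a) / ln y / \<bar>u\<bar>) {0..1}" .
  have "norm (contour_integral (linepath (Complex a u) (Complex b u)) (\<lambda>s. of_real y powr s / s)) =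
     norm (integral {0..1} (\<lambda>t. of_real y powr z t / z t * (Complex b u - Complex a u)))"
    by (simp add: contour_integral_integral z_def)
  also have "\<dots> \<le> integral {0..1} (\<lambda>t. y powr (a + t * (b - a)) * (b - a) / \<bar>u\<bar>)"
  proof (rule integral_norm_bound_integral)
    show "(\<lambda>t. of_real y powr z t / z t * (Complex b u - Complex a u)) integrable_on {0..1}"
      using int unfolding contour_integrable_on z_def by simp
    show "(\<lambda>t. y powr (a + t * (b - a)) * (b - a) / \<bar>u\<bar>) integrable_on {0..1}" using I by blast
    fix t :: real
    have "norm (Complex b u - Complex a u) = b - a" using ab by (simp add: cmod_def)
    moreover have "norm (complex_of_real y powr z t) = y powr (a + t * (b - a))"
      using y by (subst norm_of_real_powr) (auto simp: z)
    moreover have "norm (z t) \<ge> \<bar>u\<bar>" using abs_Im_le_cmod[of "z t"] by (simp add: z)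
    ultimately show "norm (of_real y powr z t / z t * (Complex b u - Complex a u)) \<le> y powr (a + t * (b - a)) * (b - a) / \<bar>u\<bar>"
      using ab u by (auto simp: norm_mult norm_divide intro!: frac_le mult_nonneg_nonneg)
  qed
  also have "\<dots> = (y powr b - y powr a) / ln y / \<bar>u\<bar>" using I by (rule integral_unique)
  finally show "norm (contour_integral (linepath (Complex a u) (Complex b u)) (\<lambda>s. of_real y powr s / s)) \<le>
           (y powr b - y powr a) / ln y / \<bar>u\<bar>" .
qed

lemma powr_vertical_bound:
  assumes y: "y > 0" and r: "r \<noteq> 0" and T: "T > 0"
  shows "(\<lambda>s. of_real y powr s / s) contour_integrable_on linepath (Complex r (-T)) (Complex r T)"
    and "norm (contour_integral (linepath (Complex r (-T)) (Complex r T)) (\<lambda>s. of_real y powr s / s)) \<le>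
           2 * T * (y powr r / \<bar>r\<bar>)"
proof -
  have re: "Re s = r" if "s \<in> closed_segment (Complex r (-T)) (Complex r T)" for s
    using that by (simp add: closed_segment_same_Re)
  hence nz: "s \<noteq> 0" if "s \<in> closed_segment (Complex r (-T)) (Complex r T)" for s
    using that r by fastforce
  have "continuous_on (closed_segment (Complex r (-T)) (Complex r T)) (\<lambda>s. of_real y powr s / s)"
    using y nz by (auto intro!: continuous_intros)
  thus int: "(\<lambda>s. of_real y powr s / s) contour_integrable_on linepath (Complex r (-T)) (Complex r T)"
    by (rule contour_integrable_continuous_linepath)
  have "norm (contour_integral (linepath (Complex r (-T)) (Complex r T)) (\<lambda>s. of_real y powr s / s)) \<le>
     y powr r / \<bar>r\<bar> * norm (Complex r T - Complex r (-T))"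
  proof (rule contour_integral_bound_linepath[OF int])
    fix s assume s: "s \<in> closed_segment (Complex r (-T)) (Complex r T)"
    have "norm (of_real y powr s / s) = y powr r / norm s"
      using y re[OF s] by (simp add: norm_divide norm_of_real_powr)
    also have "\<dots> \<le> y powr r / \<bar>r\<bar>"
      using r re[OF s] abs_Re_le_cmod[of s] by (intro frac_le) auto
    finally show "norm (of_real y powr s / s) \<le> y powr r / \<bar>r\<bar>" .
  qed auto
  also have "norm (Complex r T - Complex r (-T)) = 2 * T"
  proof -
    have "Complex r T - Complex r (-T) = \<i> * of_real (2 * T)" by (simp add: complex_eq_iff)
    hence "norm (Complex r T - Complex r (-T)) = \<bar>2 * T\<bar>"
      by (simp only: norm_mult norm_of_real norm_ii mult_1)
    thus ?thesis using T by simp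
  qed
  finally show "norm (contour_integral (linepath (Complex r (-T)) (Complex r T)) (\<lambda>s. of_real y powr s / s)) \<le>
           2 * T * (y powr r / \<bar>r\<bar>)" by (simp add: mult_ac)
qed

text \<open>For y > 1 the contour is closed on the left around the pole at 0, for y < 1 on the right
  without a pole. The far side is kept at a finite distance R and made smaller than an arbitrary e,
  in place of a limit of contours.\<close>

lemma perron_kernel:
  assumes y: "y > 0" "y \<noteq> 1" and c: "c > 0" and T: "T > 0"
  shows "norm (contour_integral (linepath (Complex c (-T)) (Complex c T)) (\<lambda>s. of_real y powr s / s)
     - (if y > 1 then 2 * of_real pi * \<i> else 0)) \<le> 2 * y powr c / (T * \<bar>ln y\<bar>)"
proof (rule field_le_epsilon)
  fix e :: real assume e: "e > 0"
  \<comment> \<open>c + 1 places the far side beyond the line of integration, and 2 T / e makes its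
    contribution, at most 2 T / R, no larger than e.\<close>
  define R where "R = max (c + 1) (2 * T / e)"
  have R: "R > c" "R > 0" "2 * T / R \<le> e" using c e T
    by (auto simp: R_def field_simps max_def)
  have tri1: "norm (- a + b + c) \<le> norm a + norm b + norm c" for a b c :: complex
    using norm_triangle_ineq[of "- a + b" c] norm_triangle_ineq[of "- a" b] by simp
  have tri2: "norm (a + b - c) \<le> norm a + norm b + norm c" for a b c :: complex
    using norm_triangle_ineq4[of "a + b" c] norm_triangle_ineq[of a b] by simp
  let ?f = "\<lambda>s. complex_of_real y powr s / s"
  let ?I = "contour_integral (linepath (Complex c (-T)) (Complex c T)) ?f"
  show "norm (?I - (if y > 1 then 2 * of_real pi * \<i> else 0)) \<le> 2 * y powr c / (T * \<bar>ln y\<bar>) + e"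
  proof (cases "y > 1")
    case True
    let ?rp = "rectpath (Complex (-R) (-T)) (Complex c T)"
    have in0: "0 \<in> box (Complex (-R) (-T)) (Complex c T)" using R T c by (simp add: in_box_complex_iff)
    have "((\<lambda>w. of_real y powr w / (w - 0)) has_contour_integral (2 * pi * \<i> * winding_number ?rp 0 * of_real y powr 0)) ?rp"
    proof (rule Cauchy_integral_formula_convex_simple[of UNIV])
      show "path_image ?rp \<subseteq> UNIV - {0}"
        using in0 path_image_rectpath_inter_box[of "Complex (-R) (-T)" "Complex c T"] R T c by auto
    qed (use y in \<open>auto intro!: holomorphic_intros\<close>)
    hence "contour_integral ?rp ?f = 2 * of_real pi * \<i>"
      using winding_number_rectpath[OF in0] y by (simp add: contour_integral_unique)
    moreover have "contour_integral ?rp ?f = contour_integral (linepath (Complex (-R) (-T)) (Complex c (-T))) ?f + ?I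
     - contour_integral (linepath (Complex (-R) T) (Complex c T)) ?f - contour_integral (linepath (Complex (-R) (-T)) (Complex (-R) T)) ?f"
      using R T y c by (intro contour_integral_rectpath powr_horizontal_bound powr_vertical_bound) auto
    ultimately have eq: "?I - 2 * of_real pi * \<i> = - contour_integral (linepath (Complex (-R) (-T)) (Complex c (-T))) ?f
      + contour_integral (linepath (Complex (-R) T) (Complex c T)) ?f + contour_integral (linepath (Complex (-R) (-T)) (Complex (-R) T)) ?f"
      by (simp add: algebra_simps)
    have "norm (?I - 2 * of_real pi * \<i>) \<le> norm (contour_integral (linepath (Complex (-R) (-T)) (Complex c (-T))) ?f)
      + norm (contour_integral (linepath (Complex (-R) T) (Complex c T)) ?f) + norm (contour_integral (linepath (Complex (-R) (-T)) (Complex (-R) T)) ?f)"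
      unfolding eq by (rule tri1)
    also have "\<dots> \<le> (y powr c - y powr (-R)) / ln y / \<bar>-T\<bar> + (y powr c - y powr (-R)) / ln y / \<bar>T\<bar> + 2 * T * (y powr (-R) / \<bar>-R\<bar>)"
    proof (intro add_mono)
      show "norm (contour_integral (linepath (Complex (-R) (-T)) (Complex c (-T))) ?f) \<le> (y powr c - y powr (-R)) / ln y / \<bar>-T\<bar>"
        by (rule powr_horizontal_bound(2)) (use R T y c in auto)
      show "norm (contour_integral (linepath (Complex (-R) T) (Complex c T)) ?f) \<le> (y powr c - y powr (-R)) / ln y / \<bar>T\<bar>"
        by (rule powr_horizontal_bound(2)) (use R T y c in auto)
      show "norm (contour_integral (linepath (Complex (-R) (-T)) (Complex (-R) T)) ?f) \<le> 2 * T * (y powr (-R) / \<bar>-R\<bar>)"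
        by (rule powr_vertical_bound(2)) (use R T y c in auto)
    qed
    also have "\<dots> \<le> y powr c / ln y / T + y powr c / ln y / T + 2 * T * (1 / R)"
    proof -
      have "y powr (-R) \<le> 1" using True R powr_mono[of "-R" 0 y] by simp
      thus ?thesis using True R T by (intro add_mono mult_left_mono) (auto intro!: divide_right_mono)
    qed
    also have "\<dots> \<le> 2 * y powr c / (T * \<bar>ln y\<bar>) + e" using R True by (simp add: mult.commute)
    finally show ?thesis using True by simp
  next
    case False
    hence y1: "y < 1" using y by simp
    let ?rp = "rectpath (Complex c (-T)) (Complex R T)"
    have "(?f has_contour_integral 0) ?rp"
    proof (rule Cauchy_theorem_convex_simple)
      show "path_image ?rp \<subseteq> {s. Re s > 0}"
        using path_image_rectpath_subset_cbox[of "Complex c (-T)" "Complex R T"] R T c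
        by (auto simp: in_cbox_complex_iff)
      show "?f holomorphic_on {s. Re s > 0}" using y by (auto intro!: holomorphic_intros)
    qed (auto simp: convex_halfspace_Re_gt)
    hence "contour_integral ?rp ?f = 0" by (rule contour_integral_unique)
    moreover have "contour_integral ?rp ?f = contour_integral (linepath (Complex c (-T)) (Complex R (-T))) ?f
      + contour_integral (linepath (Complex R (-T)) (Complex R T)) ?f
     - contour_integral (linepath (Complex c T) (Complex R T)) ?f - ?I"
      using R T y c by (intro contour_integral_rectpath powr_horizontal_bound powr_vertical_bound) auto
    ultimately have eq: "?I = contour_integral (linepath (Complex c (-T)) (Complex R (-T))) ?f
      + contour_integral (linepath (Complex R (-T)) (Complex R T)) ?f
     - contour_integral (linepath (Complex c T) (Complex R T)) ?f" by simp
    have "norm ?I \<le> norm (contour_integral (linepath (Complex c (-T)) (Complex R (-T))) ?f)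
      + norm (contour_integral (linepath (Complex R (-T)) (Complex R T)) ?f)
      + norm (contour_integral (linepath (Complex c T) (Complex R T)) ?f)"
      unfolding eq by (rule tri2)
    also have "\<dots> \<le> (y powr R - y powr c) / ln y / \<bar>-T\<bar> + 2 * T * (y powr R / \<bar>R\<bar>) + (y powr R - y powr c) / ln y / \<bar>T\<bar>"
    proof (intro add_mono)
      show "norm (contour_integral (linepath (Complex c (-T)) (Complex R (-T))) ?f) \<le> (y powr R - y powr c) / ln y / \<bar>-T\<bar>"
        by (rule powr_horizontal_bound(2)) (use R T y c in auto)
      show "norm (contour_integral (linepath (Complex c T) (Complex R T)) ?f) \<le> (y powr R - y powr c) / ln y / \<bar>T\<bar>"
        by (rule powr_horizontal_bound(2)) (use R T y c in auto)
      show "norm (contour_integral (linepath (Complex R (-T)) (Complex R T)) ?f) \<le> 2 * T * (y powr R / \<bar>R\<bar>)"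
        by (rule powr_vertical_bound(2)) (use R T y c in auto)
    qed
    also have "(y powr R - y powr c) / ln y = (y powr c - y powr R) / \<bar>ln y\<bar>"
      using y1 y by (simp add: field_simps)
    also have "(y powr c - y powr R) / \<bar>ln y\<bar> / \<bar>-T\<bar> + 2 * T * (y powr R / \<bar>R\<bar>) + (y powr c - y powr R) / \<bar>ln y\<bar> / \<bar>T\<bar>
        \<le> y powr c / \<bar>ln y\<bar> / T + 2 * T * (1 / R) + y powr c / \<bar>ln y\<bar> / T"
    proof -
      have "y powr R \<le> 1" using y1 y R powr_le1[of R y] by simp
      thus ?thesis using R T by (intro add_mono mult_left_mono) (auto intro!: divide_right_mono)
    qed
    also have "\<dots> \<le> 2 * y powr c / (T * \<bar>ln y\<bar>) + e" using R by (simp add: mult.commute)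
    finally show ?thesis using False by simp
  qed
qed

lemma integral_powr_symmetric:
  fixes \<eta> T :: real
  assumes \<eta>: "0 < \<eta>" and T: "T > 0"
  shows "((\<lambda>t. (8 + \<bar>t\<bar>) powr (\<eta> - 1)) has_integral 2 * ((8 + T) powr \<eta> - 8 powr \<eta>) / \<eta>) {-T..T}"
proof -
  have 1: "((\<lambda>t. (8 + \<bar>t\<bar>) powr (\<eta> - 1)) has_integral (8 + T) powr \<eta> / \<eta> - (8 + 0) powr \<eta> / \<eta>) {0..T}"
  proof (rule fundamental_theorem_of_calculus)
    fix t :: real assume t: "t \<in> {0..T}"
    hence "((\<lambda>t. (8 + t) powr \<eta> / \<eta>) has_field_derivative (8 + \<bar>t\<bar>) powr (\<eta> - 1)) (at t within {0..T})"
      using \<eta> by (auto intro!: derivative_eq_intros)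
    thus "((\<lambda>t. (8 + t) powr \<eta> / \<eta>) has_vector_derivative (8 + \<bar>t\<bar>) powr (\<eta> - 1)) (at t within {0..T})"
      by (simp add: has_real_derivative_iff_has_vector_derivative)
  qed (use T in auto)
  have 2: "((\<lambda>t. (8 + \<bar>t\<bar>) powr (\<eta> - 1)) has_integral - ((8 - 0) powr \<eta> / \<eta>) - (- ((8 - (-T)) powr \<eta> / \<eta>))) {-T..0}"
  proof (rule fundamental_theorem_of_calculus)
    fix t :: real assume t: "t \<in> {-T..0}"
    hence "((\<lambda>t. - ((8 - t) powr \<eta> / \<eta>)) has_field_derivative (8 + \<bar>t\<bar>) powr (\<eta> - 1)) (at t within {-T..0})"
      using \<eta> by (auto intro!: derivative_eq_intros)
    thus "((\<lambda>t. - ((8 - t) powr \<eta> / \<eta>)) has_vector_derivative (8 + \<bar>t\<bar>) powr (\<eta> - 1)) (at t within {-T..0})"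
      by (simp add: has_real_derivative_iff_has_vector_derivative)
  qed (use T in auto)
  have "((\<lambda>t. (8 + \<bar>t\<bar>) powr (\<eta> - 1)) has_integral (- ((8 - 0) powr \<eta> / \<eta>) - (- ((8 - (-T)) powr \<eta> / \<eta>))) +
      ((8 + T) powr \<eta> / \<eta> - (8 + 0) powr \<eta> / \<eta>)) {-T..T}"
    by (rule has_integral_combine[OF _ _ 2 1]) (use T in auto)
  thus ?thesis by (simp add: diff_divide_distrib right_diff_distrib)
qed

text \<open>A half-integer x stays at distance at least 1/2 from every integer, so the factor 1 /
  |ln y| in the error term of Perron's formula costs no more than O(x).\<close>

lemma half_integer_ln_bound:
  assumes "n > 0" "k > 0"
  shows "\<bar>ln ((real k + 1 / 2) / real n)\<bar> \<ge> 1 / (4 * (real k + 1 / 2))" and "(real k + 1 / 2) / real n \<noteq> 1"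
    and "(real k + 1 / 2) / real n > 1 \<longleftrightarrow> n \<le> k"
proof -
  define x where "x = real k + 1 / 2"
  have x: "x > 0" by (simp add: x_def)
  have "x \<noteq> real n" unfolding x_def
  proof
    assume "real k + 1 / 2 = real n"
    hence "2 * k + 1 = 2 * n" by linarith
    thus False by presburger
  qed
  thus "(real k + 1 / 2) / real n \<noteq> 1" using assms by (simp add: x_def)
  show "(real k + 1 / 2) / real n > 1 \<longleftrightarrow> n \<le> k"
    using assms by (auto simp: field_simps)
  show "\<bar>ln ((real k + 1 / 2) / real n)\<bar> \<ge> 1 / (4 * (real k + 1 / 2))"
  proof (cases "n \<le> k")
    case True
    have "ln (real n / x) \<le> real n / x - 1" using assms x by (intro ln_le_minus_one) auto
    hence "ln (x / real n) \<ge> 1 - real n / x" using assms x by (simp add: ln_div)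
    also have "1 - real n / x = (x - real n) / x" using x by (simp add: field_simps)
    also have "(x - real n) / x \<ge> (1 / 2) / x" using True x by (intro divide_right_mono) (auto simp: x_def)
    also have "(1 / 2) / x \<ge> 1 / (4 * x)" using x by (simp add: field_simps)
    finally show ?thesis by (simp add: x_def)
  next
    case False
    have "ln (x / real n) \<le> x / real n - 1" using assms x by (intro ln_le_minus_one) auto
    also have "x / real n - 1 \<le> x / (real k + 1) - 1"
      using False x by (intro diff_right_mono divide_left_mono) auto
    also have "\<dots> = - (1 / 2) / (real k + 1)" by (simp add: x_def field_simps)
    also have "\<dots> \<le> - (1 / (4 * x))" using assms by (simp add: x_def field_simps)
    finally show ?thesis by (simp add: x_def)
  qed
qed

text \<open>The series converges uniformly on the finite segment and is integrated term by term with
  \<open>perron_kernel\<close>. At the half-integer x each term has an error of at most |a n| n^(-c)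
  times 8 x^(c + 1) / T.\<close>

lemma perron_sum_approx:
  assumes a: "abs_conv_beyond a 1" and c: "c > 1" and K: "(\<Sum>n. norm (a n) * real n powr (-c)) \<le> K"
    and k: "k \<ge> 1" and T: "T > 0"
  defines "x \<equiv> real k + 1 / 2"
  shows "norm (contour_integral (linepath (Complex c (-T)) (Complex c T)) (\<lambda>s. dirichlet_series a s * (of_real x powr s / s))
     - 2 * of_real pi * \<i> * (\<Sum>n=1..k. a n)) \<le> 8 * K * x powr (c + 1) / T"
proof -
  have x: "x > 0" by (simp add: x_def)
  let ?g = "linepath (Complex c (-T)) (Complex c T)"
  let ?S = "closed_segment (Complex c (-T)) (Complex c T)"
  have re: "Re s = c" if "s \<in> ?S" for s using that by (simp add: closed_segment_same_Re)
  have nz: "s \<noteq> 0" if "s \<in> ?S" for s using re[OF that] c by auto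
  define f where "f = (\<lambda>n s. a n * of_nat n powr (-s) * (of_real x powr s / s))"
  have sK: "summable (\<lambda>n. norm (a n) * real n powr (-c))" using a c by (auto simp: abs_conv_beyond_def)
  have contf: "continuous_on ?S (f n)" for n
    unfolding f_def using x nz by (cases "n = 0") (auto intro!: continuous_intros)
  have ul: "uniform_limit (path_image ?g) (\<lambda>N s. \<Sum>n<N. f n s) (\<lambda>s. \<Sum>n. f n s) sequentially"
  proof (rule Weierstrass_m_test)
    fix n s assume "s \<in> path_image ?g"
    hence s: "s \<in> ?S" by simp
    have "norm (f n s) = norm (a n) * real n powr (-c) * (x powr c / norm s)"
      using x re[OF s] by (simp add: f_def norm_mult norm_divide norm_of_nat_powr norm_of_real_powr)
    also have "\<dots> \<le> norm (a n) * real n powr (-c) * (x powr c / 1)"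
      using re[OF s] c abs_Re_le_cmod[of s] by (intro mult_left_mono frac_le) auto
    finally show "norm (f n s) \<le> norm (a n) * real n powr (-c) * x powr c" by simp
  next
    show "summable (\<lambda>n. norm (a n) * real n powr (-c) * x powr c)" by (intro summable_mult2 sK)
  qed
  have sumf: "(\<Sum>n. f n s) = dirichlet_series a s * (of_real x powr s / s)" if "s \<in> ?S" for s
  proof -
    have "(\<lambda>n. f n s) sums (dirichlet_series a s * (of_real x powr s / s))"
      unfolding f_def using re[OF that] c by (intro sums_mult2 dirichlet_series_sums[OF a]) auto
    thus ?thesis by (simp add: sums_iff)
  qed
  obtain I J where IJ: "\<And>N. ((\<lambda>s. \<Sum>n<N. f n s) has_contour_integral I N) ?g"
     "((\<lambda>s. \<Sum>n. f n s) has_contour_integral J) ?g" "I \<longlonglongrightarrow> J"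
    using uniform_limit_contour_integral_linepath[OF ul] contf by (auto intro!: continuous_intros)
  have J: "contour_integral ?g (\<lambda>s. dirichlet_series a s * (of_real x powr s / s)) = J"
    using has_contour_integral_eq[OF IJ(2)] sumf by (intro contour_integral_unique) auto
  define P where "P = (\<lambda>n. contour_integral ?g (\<lambda>s. of_real (x / real n) powr s / s))"
  have intP: "(\<lambda>s. of_real y powr s / s) contour_integrable_on ?g" if "y > 0" for y
    using powr_vertical_bound(1)[OF that _ T] c by auto
  have fP: "f n s = a n * (of_real (x / real n) powr s / s)" if "n > 0" for n s
  proof -
    have "of_real (x / real n) powr s = (of_real x * of_real (1 / real n)) powr s" by (simp add: divide_inverse)
    also have "\<dots> = of_real x powr s * of_real (1 / real n) powr s"
      using x that by (subst powr_times_real) auto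
    also have "complex_of_real (1 / real n) powr s = of_nat n powr (-s)"
    proof -
      have "ln (1 / real n) = - ln (real n)" using that by (simp add: ln_div)
      thus ?thesis using that by (simp add: powr_def Ln_of_real Ln_of_nat del: of_real_divide)
    qed
    finally show ?thesis by (simp add: f_def)
  qed
  have If: "(f n has_contour_integral a n * P n) ?g" if "n > 0" for n
  proof -
    have "((\<lambda>s. a n * (of_real (x / real n) powr s / s)) has_contour_integral a n * P n) ?g"
      unfolding P_def using x that by (intro has_contour_integral_lmul has_contour_integral_integral intP) auto
    thus ?thesis by (rule has_contour_integral_eq) (simp add: fP[OF that])
  qed
  have f0: "(f 0 has_contour_integral 0) ?g" by (simp add: f_def has_contour_integral_0)
  have bound: "norm (I N - 2 * of_real pi * \<i> * (\<Sum>n=1..k. a n)) \<le> 8 * K * x powr (c + 1) / T" if N: "N > k" for N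
  proof -
    define i where "i = (\<lambda>n. if n = 0 then 0 else a n * P n)"
    define e where "e = (\<lambda>n. if n \<in> {1..k} then 2 * of_real pi * \<i> * a n else 0)"
    have "((\<lambda>s. \<Sum>n<N. f n s) has_contour_integral (\<Sum>n<N. i n)) ?g"
      by (rule has_contour_integral_sum) (use If f0 in \<open>auto simp: i_def\<close>)
    hence "I N = (\<Sum>n<N. i n)" using IJ(1) has_contour_integral_unique by blast
    moreover have "2 * of_real pi * \<i> * (\<Sum>n=1..k. a n) = (\<Sum>n<N. e n)"
    proof -
      have "(\<Sum>n<N. e n) = (\<Sum>n\<in>{1..k}. e n)"
        using N by (intro sum.mono_neutral_right) (auto simp: e_def)
      also have "\<dots> = (\<Sum>n\<in>{1..k}. 2 * of_real pi * \<i> * a n)" by (intro sum.cong) (auto simp: e_def)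
      finally show ?thesis by (simp add: sum_distrib_left)
    qed
    ultimately have "norm (I N - 2 * of_real pi * \<i> * (\<Sum>n=1..k. a n)) = norm (\<Sum>n<N. i n - e n)"
      by (simp add: sum_subtractf)
    also have "\<dots> \<le> (\<Sum>n<N. norm (a n) * real n powr (-c) * (8 * x powr (c + 1) / T))"
    proof (rule sum_norm_le)
      fix n
      show "norm (i n - e n) \<le> norm (a n) * real n powr (-c) * (8 * x powr (c + 1) / T)"
      proof (cases "n = 0")
        case True
        thus ?thesis by (simp add: i_def e_def)
      next
        case False
        hence n: "n > 0" by simp
        define y where "y = x / real n"
        have y: "y > 0" "y \<noteq> 1" "y > 1 \<longleftrightarrow> n \<le> k" "\<bar>ln y\<bar> \<ge> 1 / (4 * x)"
          using half_integer_ln_bound[of n k] n k x by (auto simp: y_def x_def)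
        have "i n - e n = a n * (P n - (if y > 1 then 2 * of_real pi * \<i> else 0))"
          using n y(3) by (auto simp: i_def e_def algebra_simps)
        hence "norm (i n - e n) = norm (a n) * norm (P n - (if y > 1 then 2 * of_real pi * \<i> else 0))"
          by (simp only: norm_mult)
        also have "norm (P n - (if y > 1 then 2 * of_real pi * \<i> else 0)) \<le> 2 * y powr c / (T * \<bar>ln y\<bar>)"
          unfolding P_def y_def[symmetric] using perron_kernel[OF y(1,2) _ T, of c] c by simp
        also have "\<dots> \<le> 2 * y powr c / (T * (1 / (4 * x)))"
          using y T x by (intro divide_left_mono mult_left_mono mult_pos_pos) auto
        also have "\<dots> = real n powr (-c) * (8 * x powr (c + 1) / T)"
          using x T n by (simp add: y_def powr_divide powr_add powr_minus_divide field_simps)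
        finally show ?thesis by (simp add: mult_left_mono mult.assoc)
      qed
    qed
    also have "\<dots> = (\<Sum>n<N. norm (a n) * real n powr (-c)) * (8 * x powr (c + 1) / T)"
      by (rule sum_distrib_right[symmetric])
    also have "\<dots> \<le> K * (8 * x powr (c + 1) / T)"
    proof (rule mult_right_mono)
      have "(\<Sum>n<N. norm (a n) * real n powr (-c)) \<le> (\<Sum>n. norm (a n) * real n powr (-c))"
        by (rule sum_le_suminf[OF sK]) auto
      thus "(\<Sum>n<N. norm (a n) * real n powr (-c)) \<le> K" using K by simp
    qed (use T in auto)
    finally show ?thesis by (simp add: mult_ac)
  qed
  have "(\<lambda>N. norm (I N - 2 * of_real pi * \<i> * (\<Sum>n=1..k. a n))) \<longlonglongrightarrow> norm (J - 2 * of_real pi * \<i> * (\<Sum>n=1..k. a n))"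
    by (intro tendsto_intros IJ(3))
  moreover have "\<forall>\<^sub>F N in sequentially. norm (I N - 2 * of_real pi * \<i> * (\<Sum>n=1..k. a n)) \<le> 8 * K * x powr (c + 1) / T"
    using eventually_gt_at_top[of k] by eventually_elim (rule bound)
  ultimately show ?thesis unfolding J by (intro tendsto_upperbound) auto
qed

text \<open>Moving the line of integration from Re s = 1 + \<eta> to 1/2 + 2 \<eta> meets no pole.
  With height T = x^2 the truncation error is O(K x^\<eta>), the horizontal sides are O(B x^(3
  \<eta> - 1)), and the vertical side contributes B x^(1/2 + 2 \<eta>) T^\<eta>, whence the exponent
  1/2 + 4 \<eta>. The constant depends on \<eta> alone, so B and K carry all dependence on the
  character.\<close>

lemma perron_bound:
  fixes \<eta> :: real
  assumes \<eta>: "0 < \<eta>" "\<eta> < 1 / 8"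
  shows "\<exists>C>0. \<forall>a F B K k. abs_conv_beyond a 1 \<longrightarrow> (\<Sum>n. norm (a n) * real n powr (-(1 + \<eta>))) \<le> K \<longrightarrow>
     F holomorphic_on {s. Re s > 1 / 2} \<longrightarrow> (\<forall>s. Re s > 1 \<longrightarrow> F s = dirichlet_series a s) \<longrightarrow> B \<ge> 0 \<longrightarrow>
     (\<forall>s. 1 / 2 + 2 * \<eta> \<le> Re s \<longrightarrow> Re s \<le> 2 \<longrightarrow> norm (F s) \<le> B * (8 + \<bar>Im s\<bar>) powr \<eta>) \<longrightarrow> k \<ge> 1 \<longrightarrow>
     norm (\<Sum>n=1..k. a n) \<le> C * (B + K) * real k powr (1 / 2 + 4 * \<eta>)"
proof (intro exI[of _ "2 * (272 / \<eta> + 24)"] conjI allI impI)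
  \<comment> \<open>272 = 17 * 2 * 8 comes from the vertical side, 24 = 8 + 8 + 8 from the two
    horizontal sides and the truncation error, and the outer 2 from passing from k + 1/2 to
    k.\<close>
  show "2 * (272 / \<eta> + 24) > 0" using \<eta> by (simp add: add_pos_pos)
  fix a F B K and k :: nat
  assume a: "abs_conv_beyond a 1" and K: "(\<Sum>n. norm (a n) * real n powr (-(1 + \<eta>))) \<le> K"
    and hol: "F holomorphic_on {s. Re s > 1 / 2}" and eq: "\<forall>s. Re s > 1 \<longrightarrow> F s = dirichlet_series a s" and B: "B \<ge> 0"
    and bd: "\<forall>s. 1 / 2 + 2 * \<eta> \<le> Re s \<longrightarrow> Re s \<le> 2 \<longrightarrow> norm (F s) \<le> B * (8 + \<bar>Im s\<bar>) powr \<eta>" and k: "k \<ge> 1"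
  have K0: "K \<ge> 0"
  proof -
    have "0 \<le> (\<Sum>n. norm (a n) * real n powr (-(1 + \<eta>)))"
      using a[unfolded abs_conv_beyond_def, rule_format, of "1 + \<eta>"] \<eta> by (intro suminf_nonneg) auto
    thus ?thesis using K by simp
  qed
  define x where "x = real k + 1 / 2"
  have x: "x \<ge> 3 / 2" using k by (simp add: x_def)
  define T where "T = x ^ 2"
  have T: "T > 0" using x by (simp add: T_def)
  define b c where "b = 1 / 2 + 2 * \<eta>" and "c = 1 + \<eta>"
  have bc: "1 / 2 < b" "b < c" "c - b \<le> 1" "c \<le> 2" "c > 1" using \<eta> by (auto simp: b_def c_def)
  have T8: "(8 + T) powr \<eta> \<le> 8 * x powr (2 * \<eta>)"
  proof -
    have "(3 / 2) ^ 2 \<le> x ^ 2" using x by (intro power_mono) auto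
    hence "8 + T \<le> 8 * T" by (simp add: T_def power2_eq_square)
    hence "(8 + T) powr \<eta> \<le> (8 * T) powr \<eta>" using T \<eta> by (intro powr_mono2) auto
    also have "\<dots> = 8 powr \<eta> * T powr \<eta>" by (rule powr_mult)
    also have "T powr \<eta> = x powr (2 * \<eta>)" using x by (simp add: T_def powr_powr flip: powr_numeral)
    also have "8 powr \<eta> * x powr (2 * \<eta>) \<le> 8 powr 1 * x powr (2 * \<eta>)"
      using \<eta> by (intro mult_right_mono powr_mono) auto
    finally show ?thesis by simp
  qed
  let ?f = "\<lambda>s. F s * (of_real x powr s / s)"
  have holf: "?f holomorphic_on {s. Re s > 1 / 2}"
    using x by (intro holomorphic_intros hol) auto
  have intf: "?f contour_integrable_on linepath z w" if "Re z > 1 / 2" "Re w > 1 / 2" for z w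
  proof (rule contour_integrable_continuous_linepath)
    have "closed_segment z w \<subseteq> {s. Re s > 1 / 2}"
      by (rule closed_segment_subset[OF _ _ convex_halfspace_Re_gt]) (use that in auto)
    thus "continuous_on (closed_segment z w) ?f"
      using holomorphic_on_imp_continuous_on[OF holf] continuous_on_subset by blast
  qed
  have nf: "norm (?f s) = norm (F s) * (x powr Re s / norm s)" for s
    using x by (simp add: norm_mult norm_divide norm_of_real_powr)
  have hor: "norm (contour_integral (linepath (Complex b u) (Complex c u)) ?f) \<le> 8 * B * x powr (1 / 2 + 4 * \<eta>)"
    if u: "\<bar>u\<bar> = T" for u
  proof -
    have "norm (contour_integral (linepath (Complex b u) (Complex c u)) ?f) \<le>
       (B * (8 * x powr (2 * \<eta>)) * (x powr c / T)) * norm (Complex c u - Complex b u)"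
    proof (rule contour_integral_bound_linepath[OF intf])
      fix s assume "s \<in> closed_segment (Complex b u) (Complex c u)"
      hence s: "Im s = u" "b \<le> Re s" "Re s \<le> c"
        using bc by (auto simp: closed_segment_same_Im closed_segment_eq_real_ivl)
      have "norm (F s) \<le> B * (8 + T) powr \<eta>" using bd s bc u by (auto simp: b_def)
      also have "\<dots> \<le> B * (8 * x powr (2 * \<eta>))" using T8 B by (intro mult_left_mono)
      finally have 1: "norm (F s) \<le> B * (8 * x powr (2 * \<eta>))" .
      have 2: "x powr Re s / norm s \<le> x powr c / T"
        using s x T u abs_Im_le_cmod[of s] by (intro frac_le powr_mono) auto
      show "norm (?f s) \<le> B * (8 * x powr (2 * \<eta>)) * (x powr c / T)"
        unfolding nf using 1 2 B T by (intro mult_mono) auto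
    qed (use bc B T in auto)
    also have "norm (Complex c u - Complex b u) = c - b" using bc by (simp add: cmod_def)
    also have "B * (8 * x powr (2 * \<eta>)) * (x powr c / T) * (c - b) \<le> B * (8 * x powr (2 * \<eta>)) * (x powr c / T) * 1"
      using bc B T by (intro mult_left_mono) auto
    also have "x powr c / T = x powr (\<eta> - 1)"
      using x by (simp add: c_def T_def powr_diff powr_add power2_eq_square field_simps)
    also have "B * (8 * x powr (2 * \<eta>)) * x powr (\<eta> - 1) * 1 = 8 * B * x powr (2 * \<eta> + (\<eta> - 1))"
      by (simp only: powr_add mult_ac mult_1_right)
    also have "\<dots> \<le> 8 * B * x powr (1 / 2 + 4 * \<eta>)"
      using x B \<eta> by (intro mult_left_mono powr_mono) auto
    finally show ?thesis .
  qed
  have ver: "norm (contour_integral (linepath (Complex b (-T)) (Complex b T)) ?f) \<le> 272 / \<eta> * B * x powr (1 / 2 + 4 * \<eta>)"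
  proof -
    have "contour_integral (linepath (Complex b (-T)) (Complex b T)) ?f = \<i> * integral {-T..T} (\<lambda>t. ?f (Complex b t))"
      using T by (intro contour_integral_linepath_same_Re) auto
    also have "norm \<dots> = norm (integral {-T..T} (\<lambda>t. ?f (Complex b t)))" by (simp add: norm_mult)
    also have "\<dots> \<le> integral {-T..T} (\<lambda>t. 17 * B * x powr b * (8 + \<bar>t\<bar>) powr (\<eta> - 1))"
    proof (rule integral_norm_bound_integral)
      have "continuous_on {-T..T} (\<lambda>t. ?f (Complex b t))"
        by (rule continuous_on_compose2[OF holomorphic_on_imp_continuous_on[OF holf]])
           (use bc in \<open>auto intro!: continuous_intros simp: Complex_eq\<close>)
      thus "(\<lambda>t. ?f (Complex b t)) integrable_on {-T..T}" by (rule integrable_continuous_real)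
      show "(\<lambda>t. 17 * B * x powr b * (8 + \<bar>t\<bar>) powr (\<eta> - 1)) integrable_on {-T..T}"
        using integral_powr_symmetric[OF \<eta>(1) T] by (intro integrable_on_mult_right) blast
      fix t :: real assume "t \<in> {-T..T}"
      define s where "s = Complex b t"
      have n: "norm s \<ge> 1 / 2" "norm s \<ge> \<bar>t\<bar>"
        using abs_Re_le_cmod[of s] abs_Im_le_cmod[of s] bc by (auto simp: s_def)
      \<comment> \<open>8 <= 16 |s| because |s| >= 1/2, and |t| <= |s|.\<close>
      have "8 + \<bar>t\<bar> \<le> 17 * norm s" using n by simp
      moreover have "norm s > 0" using n(1) by linarith
      ultimately have "17 / (17 * norm s) \<le> 17 / (8 + \<bar>t\<bar>)" by (intro divide_left_mono mult_pos_pos) auto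
      hence 1: "1 / norm s \<le> 17 / (8 + \<bar>t\<bar>)" by simp
      have "1 / 2 + 2 * \<eta> \<le> Re s" "Re s \<le> 2" using bc by (simp_all add: s_def b_def)
      hence "norm (F s) \<le> B * (8 + \<bar>Im s\<bar>) powr \<eta>" using bd by blast
      hence 2: "norm (F s) \<le> B * (8 + \<bar>t\<bar>) powr \<eta>" by (simp add: s_def)
      have "norm (?f s) = x powr b * (norm (F s) * (1 / norm s))" unfolding nf by (simp add: s_def)
      also have "\<dots> \<le> x powr b * (B * (8 + \<bar>t\<bar>) powr \<eta> * (17 / (8 + \<bar>t\<bar>)))"
        using 1 2 B n by (intro mult_left_mono mult_mono) auto
      also have "\<dots> = 17 * B * x powr b * ((8 + \<bar>t\<bar>) powr \<eta> / (8 + \<bar>t\<bar>))" by (simp add: field_simps)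
      also have "(8 + \<bar>t\<bar>) powr \<eta> / (8 + \<bar>t\<bar>) = (8 + \<bar>t\<bar>) powr (\<eta> - 1)" by (simp add: powr_diff)
      finally show "norm (?f (Complex b t)) \<le> 17 * B * x powr b * (8 + \<bar>t\<bar>) powr (\<eta> - 1)" by (simp add: s_def)
    qed
    also have "\<dots> = 17 * B * x powr b * (2 * ((8 + T) powr \<eta> - 8 powr \<eta>) / \<eta>)"
      using integral_powr_symmetric[OF \<eta>(1) T] by (simp add: integral_unique)
    also have "\<dots> \<le> 17 * B * x powr b * (2 * (8 * x powr (2 * \<eta>)) / \<eta>)"
    proof -
      have "(8 + T) powr \<eta> - 8 powr \<eta> \<le> 8 * x powr (2 * \<eta>)" using T8 powr_ge_zero[of 8 \<eta>] by linarith
      thus ?thesis using B \<eta> by (intro mult_left_mono divide_right_mono) auto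
    qed
    also have "\<dots> = 272 / \<eta> * B * (x powr b * x powr (2 * \<eta>))" by simp
    also have "x powr b * x powr (2 * \<eta>) = x powr (1 / 2 + 4 * \<eta>)" 
    proof -
      have "b + 2 * \<eta> = 1 / 2 + 4 * \<eta>" by (simp add: b_def)
      thus ?thesis by (metis powr_add)
    qed
    finally show ?thesis .
  qed
  have "contour_integral (rectpath (Complex b (-T)) (Complex c T)) ?f = 0"
  proof (rule contour_integral_unique, rule Cauchy_theorem_convex_simple[OF holf])
    show "path_image (rectpath (Complex b (-T)) (Complex c T)) \<subseteq> {s. Re s > 1 / 2}"
      using path_image_rectpath_subset_cbox[of "Complex b (-T)" "Complex c T"] bc T
      by (auto simp: in_cbox_complex_iff)
  qed (rule convex_halfspace_Re_gt, auto)
  moreover have "contour_integral (rectpath (Complex b (-T)) (Complex c T)) ?f =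
     contour_integral (linepath (Complex b (-T)) (Complex c (-T))) ?f + contour_integral (linepath (Complex c (-T)) (Complex c T)) ?f
     - contour_integral (linepath (Complex b T) (Complex c T)) ?f - contour_integral (linepath (Complex b (-T)) (Complex b T)) ?f"
    by (rule contour_integral_rectpath; rule intf) (use bc in auto)
  ultimately have I: "contour_integral (linepath (Complex c (-T)) (Complex c T)) ?f =
     contour_integral (linepath (Complex b T) (Complex c T)) ?f + contour_integral (linepath (Complex b (-T)) (Complex b T)) ?f
     - contour_integral (linepath (Complex b (-T)) (Complex c (-T))) ?f" by (simp add: algebra_simps)
  define X where "X = x powr (1 / 2 + 4 * \<eta>)"
  have tri: "norm (u + v - w) \<le> norm u + norm v + norm w" for u v w :: complex
    using norm_triangle_ineq4[of "u + v" w] norm_triangle_ineq[of u v] by simp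
  have nI: "norm (contour_integral (linepath (Complex c (-T)) (Complex c T)) ?f) \<le> 8 * B * X + 272 / \<eta> * B * X + 8 * B * X"
    unfolding I X_def
    by (rule order_trans[OF tri]) (intro add_mono hor ver, use T in auto)
  have eqI: "contour_integral (linepath (Complex c (-T)) (Complex c T)) ?f =
     contour_integral (linepath (Complex c (-T)) (Complex c T)) (\<lambda>s. dirichlet_series a s * (of_real x powr s / s))"
    by (rule contour_integral_cong) (use eq bc in \<open>auto simp: closed_segment_same_Re\<close>)
  have "norm (contour_integral (linepath (Complex c (-T)) (Complex c T)) ?f - 2 * of_real pi * \<i> * (\<Sum>n=1..k. a n)) \<le> 8 * K * x powr (c + 1) / T"
    unfolding eqI using perron_sum_approx[OF a bc(5) K[folded c_def] k T, folded x_def] .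
  also have "8 * K * x powr (c + 1) / T = 8 * K * x powr \<eta>"
    using x by (simp add: c_def T_def powr_add power2_eq_square field_simps)
  also have "\<dots> \<le> 8 * K * X"
    unfolding X_def using x K0 \<eta> by (intro mult_left_mono powr_mono) auto
  finally have "norm (2 * of_real pi * \<i> * (\<Sum>n=1..k. a n)) \<le> 8 * B * X + 272 / \<eta> * B * X + 8 * B * X + 8 * K * X"
    using nI norm_triangle_sub[of "2 * of_real pi * \<i> * (\<Sum>n=1..k. a n)" "contour_integral (linepath (Complex c (-T)) (Complex c T)) ?f"]
    by (simp add: norm_minus_commute)
  moreover have "norm (2 * of_real pi * \<i> * (\<Sum>n=1..k. a n)) = 2 * pi * norm (\<Sum>n=1..k. a n)"
    by (simp add: norm_mult)
  moreover have "1 * norm (\<Sum>n=1..k. a n) \<le> 2 * pi * norm (\<Sum>n=1..k. a n)"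
    using pi_gt3 by (intro mult_right_mono) auto
  ultimately have "norm (\<Sum>n=1..k. a n) \<le> 8 * B * X + 272 / \<eta> * B * X + 8 * B * X + 8 * K * X" by simp
  also have "\<dots> \<le> (272 / \<eta> + 24) * (B + K) * X"
  proof -
    have "8 * B * X + e * B * X + 8 * B * X + 8 * K * X \<le> (e + 24) * (B + K) * X" if "e \<ge> 0" for e
    proof -
      have "0 \<le> e * (K * X)" "0 \<le> K * X" "0 \<le> B * X"
        using that K0 B by (auto simp: X_def)
      thus ?thesis by (simp add: algebra_simps)
    qed
    from this[of "272 / \<eta>"] show ?thesis using \<eta> by simp
  qed
  also have "\<dots> \<le> (272 / \<eta> + 24) * (B + K) * (2 * real k powr (1 / 2 + 4 * \<eta>))"
  proof (rule mult_left_mono)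
    have "X \<le> (2 * real k) powr (1 / 2 + 4 * \<eta>)"
      unfolding X_def using k \<eta> x by (intro powr_mono2) (auto simp: x_def)
    also have "\<dots> = 2 powr (1 / 2 + 4 * \<eta>) * real k powr (1 / 2 + 4 * \<eta>)" by (rule powr_mult)
    also have "\<dots> \<le> 2 powr 1 * real k powr (1 / 2 + 4 * \<eta>)"
      using \<eta> by (intro mult_right_mono powr_mono) auto
    finally show "X \<le> 2 * real k powr (1 / 2 + 4 * \<eta>)" by simp
  qed (use \<eta> B K0 in \<open>auto intro!: mult_nonneg_nonneg\<close>)
  finally show "norm (\<Sum>n=1..k. a n) \<le> 2 * (272 / \<eta> + 24) * (B + K) * real k powr (1 / 2 + 4 * \<eta>)"
    by (simp only: mult_ac)
qed

section \<open>Functions with absolutely continuous derivative\<close>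

text \<open>The intervals of a division may share endpoints, so disjointness, and with it additivity
  of the measure, is used for their interiors.\<close>

lemma sum_content_division_le:
  fixes \<D> :: "real set set"
  assumes D: "\<D> division_of X" and U: "\<And>K. K \<in> \<D> \<Longrightarrow> K \<subseteq> U" "U \<in> lmeasurable"
  shows "(\<Sum>K\<in>\<D>. measure lborel K) \<le> measure lebesgue U"
proof -
  have fin: "finite \<D>" using D by blast
  have box: "\<exists>u v. K = cbox u v" if "K \<in> \<D>" for K using D that by blast
  have eq: "measure lborel K = measure lebesgue (interior K)" and lm: "interior K \<in> lmeasurable" if "K \<in> \<D>" for K
  proof -
    obtain u v where K: "K = cbox u v" using box[OF \<open>K \<in> \<D>\<close>] by blast
    show "measure lborel K = measure lebesgue (interior K)" "interior K \<in> lmeasurable"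
      unfolding K by (auto simp: content_real_if)
  qed
  have "(\<Sum>K\<in>\<D>. measure lborel K) = (\<Sum>K\<in>\<D>. measure lebesgue (interior K))"
    by (intro sum.cong refl eq)
  also have "\<dots> = measure lebesgue (\<Union>K\<in>\<D>. interior K)"
  proof (rule measure_finite_Union[symmetric, OF fin])
    show "interior ` \<D> \<subseteq> sets lebesgue" using lm by (auto simp: fmeasurable_def)
    show "disjoint_family_on interior \<D>"
      using D by (auto simp: disjoint_family_on_def)
    show "emeasure lebesgue (interior K) \<noteq> \<infinity>" if "K \<in> \<D>" for K
      using lm[OF that] by (auto simp: fmeasurable_def)
  qed
  also have "\<dots> \<le> measure lebesgue U"
  proof (rule measure_mono_fmeasurable[OF _ _ U(2)])
    show "(\<Union>K\<in>\<D>. interior K) \<subseteq> U" using U(1) interior_subset by blast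
    show "(\<Union>K\<in>\<D>. interior K) \<in> sets lebesgue" using lm fin by (auto simp: fmeasurable_def)
  qed
  finally show ?thesis .
qed

text \<open>Transfers one instance of absolute continuity, which is given for finite sets of
  endpoint pairs, to divisions, whose members are recovered from \<open>Inf K\<close> and
  \<open>Sup K\<close>.\<close>

lemma abs_continuous_on_division:
  assumes ac: "\<And>D. finite D \<Longrightarrow> \<forall>(a, b)\<in>D. a \<le> b \<and> {a..b} \<subseteq> I \<Longrightarrow>
        disjoint_family_on (\<lambda>(a, b). {a<..<b}) D \<Longrightarrow> (\<Sum>(a, b)\<in>D. b - a) < d \<Longrightarrow> (\<Sum>(a, b)\<in>D. norm (g b - g a)) < e"
    and D: "\<D> division_of X" "X \<subseteq> I" and small: "(\<Sum>K\<in>\<D>. measure lborel K) < d"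
  shows "(\<Sum>K\<in>\<D>. norm (g (Sup K) - g (Inf K))) < (e :: real)"
proof -
  have fin: "finite \<D>" using D by blast
  have K: "K = {Inf K..Sup K} \<and> Inf K \<le> Sup K" if "K \<in> \<D>" for K :: "real set"
  proof -
    obtain u v where "K = cbox u v" using D(1) \<open>K \<in> \<D>\<close> by blast
    moreover have "K \<noteq> {}" using D(1) that by blast
    ultimately show ?thesis by auto
  qed
  let ?h = "\<lambda>K :: real set. (Inf K, Sup K)"
  have inj: "inj_on ?h \<D>" using K by (intro inj_onI) (metis Pair_inject)
  have "(\<Sum>(a, b)\<in>?h ` \<D>. norm (g b - g a)) < e"
  proof (rule ac)
    show "finite (?h ` \<D>)" using fin by simp
    show "\<forall>(a, b)\<in>?h ` \<D>. a \<le> b \<and> {a..b} \<subseteq> I"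
    proof clarify
      fix K assume "K \<in> \<D>"
      moreover have "K \<subseteq> X" using D(1) \<open>K \<in> \<D>\<close> by blast
      ultimately show "Inf K \<le> Sup K \<and> {Inf K..Sup K} \<subseteq> I" using K[of K] D(2) by auto
    qed
    show "disjoint_family_on (\<lambda>(a, b). {a<..<b}) (?h ` \<D>)"
      unfolding disjoint_family_on_def
    proof (intro ballI impI)
      fix p1 p2 assume "p1 \<in> ?h ` \<D>" "p2 \<in> ?h ` \<D>" and ne: "p1 \<noteq> p2"
      then obtain K L where KL: "K \<in> \<D>" "L \<in> \<D>" and p: "p1 = ?h K" "p2 = ?h L" by blast
      from ne p have "K \<noteq> L" by auto
      hence "interior K \<inter> interior L = {}" using D(1) KL by blast
      moreover have "interior K = {Inf K<..<Sup K}" "interior L = {Inf L<..<Sup L}"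
        using K[OF KL(1)] K[OF KL(2)] by (metis interior_atLeastAtMost_real)+
      ultimately show "(case p1 of (a, b) \<Rightarrow> {a<..<b}) \<inter> (case p2 of (a, b) \<Rightarrow> {a<..<b}) = {}"
        by (simp add: p)
    qed
    have "(\<Sum>(a, b)\<in>?h ` \<D>. b - a) = (\<Sum>K\<in>\<D>. Sup K - Inf K)"
      by (subst sum.reindex[OF inj]) simp
    also have "\<dots> = (\<Sum>K\<in>\<D>. measure lborel K)"
      using K by (intro sum.cong refl) (metis content_real)
    finally show "(\<Sum>(a, b)\<in>?h ` \<D>. b - a) < d" using small by simp
  qed
  also have "(\<Sum>(a, b)\<in>?h ` \<D>. norm (g b - g a)) = (\<Sum>K\<in>\<D>. norm (g (Sup K) - g (Inf K)))"
    by (subst sum.reindex[OF inj]) simp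
  finally show ?thesis .
qed

lemma abs_continuous_on_subset: "abs_continuous_on I g \<Longrightarrow> J \<subseteq> I \<Longrightarrow> abs_continuous_on J g"
  unfolding abs_continuous_on_def
proof (intro allI impI)
  fix e :: real
  assume ac: "\<forall>e>0. \<exists>d>0. \<forall>D. finite D \<and> (\<forall>(a, b)\<in>D. a \<le> b \<and> {a..b} \<subseteq> I) \<and>
      disjoint_family_on (\<lambda>(a, b). {a<..<b}) D \<and> (\<Sum>(a, b)\<in>D. b - a) < d \<longrightarrow> (\<Sum>(a, b)\<in>D. norm (g b - g a)) < e"
    and J: "J \<subseteq> I" and "e > 0"
  then obtain d where d: "d > 0" "\<And>D. finite D \<Longrightarrow> \<forall>(a, b)\<in>D. a \<le> b \<and> {a..b} \<subseteq> I \<Longrightarrow>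
      disjoint_family_on (\<lambda>(a, b). {a<..<b}) D \<Longrightarrow> (\<Sum>(a, b)\<in>D. b - a) < d \<Longrightarrow> (\<Sum>(a, b)\<in>D. norm (g b - g a)) < e"
    by meson
  have "\<forall>(a, b)\<in>D. a \<le> b \<and> {a..b} \<subseteq> I" if "\<forall>(a, b)\<in>D. a \<le> b \<and> {a..b} \<subseteq> J" for D
    using that J by blast
  thus "\<exists>d>0. \<forall>D. finite D \<and> (\<forall>(a, b)\<in>D. a \<le> b \<and> {a..b} \<subseteq> J) \<and>
      disjoint_family_on (\<lambda>(a, b). {a<..<b}) D \<and> (\<Sum>(a, b)\<in>D. b - a) < d \<longrightarrow> (\<Sum>(a, b)\<in>D. norm (g b - g a)) < e"
    using d by (intro exI[of _ d]) auto
qed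

text \<open>On the exceptional null set, covered by an open set of
  small measure, a fine tagged division sees only a small part of the variation of \<open>g\<close>.\<close>

lemma abs_continuous_on_has_integral:
  fixes g h :: "real \<Rightarrow> complex"
  assumes ab: "a \<le> b" and ac: "abs_continuous_on {a..b} g"
    and S: "negligible S" and deriv: "\<And>x. x \<in> {a..b} - S \<Longrightarrow> (g has_vector_derivative h x) (at x within {a..b})"
  shows "(h has_integral g b - g a) {a..b}"
proof -
  \<comment> \<open>With the integrand set to 0 on S, a tag in S contributes only an increment of g
    to the error, and absolute continuity controls the sum of those.\<close>
  define h0 where "h0 = (\<lambda>x. if x \<in> S then 0 else h x)"
  have "(h0 has_integral g b - g a) {a..b}"
    unfolding has_integral_real
  proof (intro allI impI)
    fix e :: real assume e: "e > 0"
    obtain d where d: "d > 0" and acd: "\<And>D. finite D \<Longrightarrow> \<forall>(u, v)\<in>D. u \<le> v \<and> {u..v} \<subseteq> {a..b} \<Longrightarrow>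
        disjoint_family_on (\<lambda>(a, b). {a<..<b}) D \<Longrightarrow> (\<Sum>(a, b)\<in>D. b - a) < d \<Longrightarrow> (\<Sum>(a, b)\<in>D. norm (g b - g a)) < e / 2"
      using ac[unfolded abs_continuous_on_def, rule_format, of "e / 2"] e by auto
    have Sn: "S \<in> null_sets lebesgue" using S by (simp add: negligible_iff_null_sets)
    obtain U where U: "open U" "S \<subseteq> U" "U \<in> lmeasurable" "measure lebesgue U < d"
    proof -
      obtain T where T: "open T" "S \<subseteq> T" "(T - S) \<in> lmeasurable" "emeasure lebesgue (T - S) < ennreal d"
        using sets_lebesgue_outer_open[of S d] Sn d by auto
      have Tl: "T \<in> sets lebesgue" using T(1) by (simp add: borel_open)
      have "emeasure lebesgue (T - S) = emeasure lebesgue T"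
        by (rule emeasure_Diff_null_set[OF Sn Tl])
      hence em: "emeasure lebesgue T < ennreal d" using T(4) by simp
      hence lm: "T \<in> lmeasurable" using Tl by (auto simp: fmeasurable_def intro: less_trans)
      have "measure lebesgue T < d"
        using em lm d by (simp add: emeasure_eq_measure2 ennreal_less_iff)
      thus ?thesis using that T(1,2) lm by blast
    qed
    \<comment> \<open>The added 1 keeps the denominator positive when a = b and makes the resulting
      bound strict.\<close>
    define e' where "e' = e / (2 * (b - a + 1))"
    have e': "e' > 0" using e ab by (simp add: e'_def)
    have "\<exists>r>0. (x \<in> S \<longrightarrow> ball x r \<subseteq> U) \<and> (x \<in> {a..b} - S \<longrightarrow>
        (\<forall>y\<in>{a..b}. \<bar>y - x\<bar> < r \<longrightarrow> norm (g y - g x - (y - x) *\<^sub>R h x) \<le> e' * \<bar>y - x\<bar>))" for x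
    proof (cases "x \<in> S")
      case True
      thus ?thesis using U(1,2) open_contains_ball by (metis DiffD2 subsetD)
    next
      case xS: False
      show ?thesis
      proof (cases "x \<in> {a..b}")
        case True
        have "(g has_derivative (\<lambda>y. y *\<^sub>R h x)) (at x within {a..b})"
          using deriv[of x] True xS by (simp add: has_vector_derivative_def)
        then obtain r where "r > 0" "\<forall>y\<in>{a..b}. norm (y - x) < r \<longrightarrow> norm (g y - g x - (y - x) *\<^sub>R h x) \<le> e' * norm (y - x)"
          using e' unfolding has_derivative_within_alt by blast
        thus ?thesis using xS by (intro exI[of _ r]) auto
      qed (use xS in \<open>auto intro: exI[of _ 1]\<close>)
    qed
    then obtain r where r: "\<And>x. r x > 0" "\<And>x. x \<in> S \<Longrightarrow> ball x (r x) \<subseteq> U"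
      "\<And>x y. x \<in> {a..b} \<Longrightarrow> x \<notin> S \<Longrightarrow> y \<in> {a..b} \<Longrightarrow> \<bar>y - x\<bar> < r x \<Longrightarrow> norm (g y - g x - (y - x) *\<^sub>R h x) \<le> e' * \<bar>y - x\<bar>"
      by (metis Diff_iff)
    define \<gamma> where "\<gamma> = (\<lambda>x. ball x (r x))"
    have "gauge \<gamma>" using r(1) by (auto simp: \<gamma>_def gauge_def)
    moreover have "norm ((\<Sum>(x, K)\<in>p. measure lborel K *\<^sub>R h0 x) - (g b - g a)) < e"
      if p: "p tagged_division_of {a..b}" and fine: "\<gamma> fine p" for p
    proof -
      have finp: "finite p" using p by blast
      have Kf: "x \<in> K" "K \<subseteq> {a..b}" "K = {Inf K..Sup K}" "Inf K \<le> Sup K" "K \<subseteq> ball x (r x)" if "(x, K) \<in> p" for x K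
      proof -
        obtain u v where uv: "K = cbox u v" using p \<open>(x, K) \<in> p\<close> by blast
        show x: "x \<in> K" using p that by blast
        show "K \<subseteq> {a..b}" using p that by blast
        show "K = {Inf K..Sup K}" "Inf K \<le> Sup K" using uv x by auto
        show "K \<subseteq> ball x (r x)" using fine that by (auto simp: fine_def \<gamma>_def)
      qed
      define pS where "pS = {(x, K). (x, K) \<in> p \<and> x \<in> S}"
      define q where "q = {(x, K). (x, K) \<in> p \<and> x \<notin> S}"
      have split: "p = pS \<union> q" "pS \<inter> q = {}" "finite pS" "finite q" "pS \<subseteq> p" "q \<subseteq> p"
        using finp by (auto simp: pS_def q_def intro: finite_subset[OF _ finp])
      let ?F = "\<lambda>(x, K). measure lborel K *\<^sub>R h0 x - (g (Sup K) - g (Inf K))"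
      have "(\<Sum>(x, K)\<in>p. measure lborel K *\<^sub>R h0 x) - (g b - g a) = (\<Sum>z\<in>p. ?F z)"
        using additive_tagged_division_1[OF ab p, of g] by (simp add: sum_subtractf split_beta')
      also have "\<dots> = (\<Sum>z\<in>pS. ?F z) + (\<Sum>z\<in>q. ?F z)"
        unfolding split(1) by (rule sum.union_disjoint[OF split(3,4,2)])
      finally have main: "norm ((\<Sum>(x, K)\<in>p. measure lborel K *\<^sub>R h0 x) - (g b - g a)) \<le> norm (\<Sum>z\<in>pS. ?F z) + norm (\<Sum>z\<in>q. ?F z)"
        by (simp add: norm_triangle_ineq)
      have "norm (\<Sum>z\<in>q. ?F z) \<le> (\<Sum>(x, K)\<in>q. e' * measure lborel K)"
      proof (rule sum_norm_le, clarify)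
        fix x K assume xK: "(x, K) \<in> q"
        hence pK: "(x, K) \<in> p" and xS: "x \<notin> S" by (auto simp: q_def)
        define u v where "u = Inf K" and "v = Sup K"
        have K_eq: "K = {u..v}" and uv: "u \<le> v"
          using Kf(3,4)[OF pK] unfolding u_def v_def by blast+
        have Kuv: "K = {u..v}" "u \<le> v" "u \<in> K" "v \<in> K"
          using uv K_eq by auto
        have xuv: "u \<le> x" "x \<le> v" using Kf(1)[OF pK] Kuv(1) by auto
        have near: "\<bar>u - x\<bar> < r x" "\<bar>v - x\<bar> < r x"
          using Kf(5)[OF pK] Kuv(3,4) by (auto simp: dist_real_def abs_minus_commute)
        have xab: "x \<in> {a..b}" "u \<in> {a..b}" "v \<in> {a..b}" using Kf(1,2)[OF pK] Kuv(3,4) by auto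
        have c: "measure lborel K = v - u" using Kuv by simp
        \<comment> \<open>Straddling: measured from the tag x, the linearisation errors at the two
          endpoints add up to e' times the length, because u <= x <= v.\<close>
        have "measure lborel K *\<^sub>R h0 x - (g v - g u) = (g u - g x - (u - x) *\<^sub>R h x) - (g v - g x - (v - x) *\<^sub>R h x)"
          using xS by (simp add: c h0_def algebra_simps)
        also have "norm \<dots> \<le> norm (g u - g x - (u - x) *\<^sub>R h x) + norm (g v - g x - (v - x) *\<^sub>R h x)"
          by (rule norm_triangle_ineq4)
        also have "\<dots> \<le> e' * \<bar>u - x\<bar> + e' * \<bar>v - x\<bar>"
          using r(3) xab xS near by (intro add_mono) auto
        also have "\<dots> = e' * measure lborel K" using xuv by (simp add: c algebra_simps)
        finally show "norm (measure lborel K *\<^sub>R h0 x - (g (Sup K) - g (Inf K))) \<le> e' * measure lborel K" by (simp add: u_def v_def)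
      qed
      also have "\<dots> \<le> (\<Sum>(x, K)\<in>p. e' * measure lborel K)"
        using finp split(6) e' by (intro sum_mono2) auto
      also have "\<dots> = e' * (\<Sum>(x, K)\<in>p. measure lborel K)" by (simp add: sum_distrib_left split_beta')
      also have "(\<Sum>(x, K)\<in>p. measure lborel K) = b - a"
        using additive_content_tagged_division[of p a b] p ab by simp
      also have "e' * (b - a) < e / 2" using e ab by (simp add: e'_def field_simps)
      finally have q: "norm (\<Sum>z\<in>q. ?F z) < e / 2" .
      have pSt: "pS tagged_partial_division_of {a..b}"
        by (rule tagged_partial_division_subset[OF _ split(5)]) (use p in \<open>auto simp: tagged_division_of_def\<close>)
      have pSd: "pS tagged_division_of \<Union>(snd ` pS)" by (rule tagged_partial_division_of_Union_self[OF pSt])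
      have div: "snd ` pS division_of \<Union>(snd ` pS)" by (rule division_of_tagged_division[OF pSd])
      \<comment> \<open>The passage from tagged intervals to intervals asks for the value 0 on every
        box with empty interior; this includes the empty box, on which \<open>Inf\<close> and
        \<open>Sup\<close> carry no information.\<close>
      define w where "w = (\<lambda>K. if K = {} then 0 else norm (g (Sup K) - g (Inf K)))"
      have "norm (\<Sum>z\<in>pS. ?F z) \<le> (\<Sum>(x, K)\<in>pS. w K)"
      proof (rule sum_norm_le, clarify)
        fix x K assume "(x, K) \<in> pS"
        hence "(x, K) \<in> p" "x \<in> S" by (auto simp: pS_def)
        moreover from this have "K \<noteq> {}" using Kf(1) by blast
        ultimately show "norm (measure lborel K *\<^sub>R h0 x - (g (Sup K) - g (Inf K))) \<le> w K"
          by (simp add: h0_def w_def norm_minus_commute)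
      qed
      also have "\<dots> = (\<Sum>K\<in>snd ` pS. w K)"
      proof (rule sum.over_tagged_division_lemma[OF pSd])
        fix u v :: real assume "box u v = {}"
        hence "v \<le> u" by simp
        hence "cbox u v = {} \<or> cbox u v = {u}" by auto
        thus "w (cbox u v) = 0" by (auto simp: w_def)
      qed
      also have "\<dots> = (\<Sum>K\<in>snd ` pS. norm (g (Sup K) - g (Inf K)))"
        using div by (intro sum.cong refl) (auto simp: w_def)
      also have "\<dots> < e / 2"
      proof (rule abs_continuous_on_division[OF acd div])
        show "\<Union>(snd ` pS) \<subseteq> {a..b}" using Kf(2) by (fastforce simp: pS_def)
        have "(\<Sum>K\<in>snd ` pS. measure lborel K) \<le> measure lebesgue U"
        proof (rule sum_content_division_le[OF div _ U(3)])
          fix K assume "K \<in> snd ` pS"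
          then obtain x where "(x, K) \<in> p" "x \<in> S" by (auto simp: pS_def)
          thus "K \<subseteq> U" using Kf(5)[of x K] r(2)[of x] by blast
        qed
        thus "(\<Sum>K\<in>snd ` pS. measure lborel K) < d" using U(4) by simp
      qed auto
      finally show ?thesis using main q by simp
    qed
    ultimately show "\<exists>\<gamma>. gauge \<gamma> \<and> (\<forall>\<D>. \<D> tagged_division_of {a..b} \<and> \<gamma> fine \<D> \<longrightarrow>
        norm ((\<Sum>(x, k)\<in>\<D>. measure lborel k *\<^sub>R h0 x) - (g b - g a)) < e)"
      by (intro exI[of _ \<gamma>] conjI allI impI) auto
  qed
  thus ?thesis by (rule has_integral_spike[OF S, rotated]) (auto simp: h0_def)
qed

text \<open>On intervals shorter than d the increments of g along any division sum to less than 1,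
  so the indefinite integral of h has bounded variation, which is a criterion for absolute
  integrability. Steps of length d / 2 then cover the whole interval.\<close>

lemma abs_continuous_on_absolutely_integrable:
  fixes g h :: "real \<Rightarrow> complex"
  assumes ab: "a \<le> b" and ac: "abs_continuous_on {a..b} g"
    and S: "negligible S" and deriv: "\<And>x. x \<in> {a..b} - S \<Longrightarrow> (g has_vector_derivative h x) (at x within {a..b})"
  shows "h absolutely_integrable_on {a..b}"
proof -
  obtain d where d: "d > 0" and acd: "\<And>D. finite D \<Longrightarrow> \<forall>(u, v)\<in>D. u \<le> v \<and> {u..v} \<subseteq> {a..b} \<Longrightarrow>
      disjoint_family_on (\<lambda>(a, b). {a<..<b}) D \<Longrightarrow> (\<Sum>(a, b)\<in>D. b - a) < d \<Longrightarrow> (\<Sum>(a, b)\<in>D. norm (g b - g a)) < 1"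
    using ac[unfolded abs_continuous_on_def, rule_format, of 1] by auto
  have sub: "(h has_integral g v - g u) {u..v}" if "u \<le> v" "{u..v} \<subseteq> {a..b}" for u v
    by (rule abs_continuous_on_has_integral[OF that(1) abs_continuous_on_subset[OF ac that(2)] S])
       (rule has_vector_derivative_within_subset[OF deriv that(2)], use that(2) in blast)
  have short: "h absolutely_integrable_on {u..v}" if uv: "u \<le> v" "{u..v} \<subseteq> {a..b}" "v - u < d" for u v
  proof -
    have "h absolutely_integrable_on cbox u v"
    proof (rule bounded_variation_absolutely_integrable_interval[where B = 1])
      show "h integrable_on cbox u v" using sub[OF uv(1,2)] by auto
      fix \<D> assume D: "\<D> division_of cbox u v"
      have "(\<Sum>K\<in>\<D>. norm (integral K h)) = (\<Sum>K\<in>\<D>. norm (g (Sup K) - g (Inf K)))"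
      proof (rule sum.cong[OF refl])
        fix K assume K: "K \<in> \<D>"
        then obtain s t where st: "K = cbox s t" using D by blast
        have "K \<noteq> {}" "K \<subseteq> cbox u v" using D K by blast+
        thus "norm (integral K h) = norm (g (Sup K) - g (Inf K))"
          using sub[of s t] uv(2) st by (auto simp: integral_unique)
      qed
      also have "\<dots> < 1"
      proof (rule abs_continuous_on_division[OF acd D])
        show "cbox u v \<subseteq> {a..b}" using uv by simp
        show "(\<Sum>K\<in>\<D>. measure lborel K) < d"
          using subadditive_content_division[OF D order_refl] uv by simp
      qed auto
      finally show "(\<Sum>K\<in>\<D>. norm (integral K h)) \<le> 1" by simp
    qed
    thus ?thesis by simp
  qed
  have "v \<le> b \<Longrightarrow> v - a \<le> real n * (d / 2) \<Longrightarrow> h absolutely_integrable_on {a..v}" for n v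
  proof (induction n arbitrary: v)
    case 0
    hence "v - a \<le> 0" by simp
    thus ?case using short[of a a] ab d by (cases "v = a") auto
  next
    case (Suc n)
    show ?case
    proof (cases "v \<ge> a + d / 2")
      case True
      have "h absolutely_integrable_on {a..v - d / 2}"
        using Suc.prems True d by (intro Suc.IH) (auto simp: algebra_simps)
      moreover have "h absolutely_integrable_on {v - d / 2..v}"
        using Suc.prems True d by (intro short) auto
      ultimately have "h absolutely_integrable_on ({a..v - d / 2} \<union> {v - d / 2..v})"
        by (rule absolutely_integrable_Un)
      also have "{a..v - d / 2} \<union> {v - d / 2..v} = {a..v}" using True d by auto
      finally show ?thesis .
    next
      case False
      show ?thesis
      proof (cases "a \<le> v")
        case True
        thus ?thesis using False Suc.prems by (intro short) auto
      qed auto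
    qed
  qed
  moreover obtain n where "b - a \<le> real n * (d / 2)"
    using reals_Archimedean3[of "d / 2"] d by (metis half_gt_zero less_imp_le)
  ultimately show ?thesis by blast
qed

text \<open>At most one nondegenerate interval of a disjoint family ends at \<beta>. It is shortened
  to end at some t < \<beta>, where the hypothesis applies, and t tends to \<beta>; starting from e
  / 2 leaves room for the loss of strictness in the limit.\<close>

lemma abs_continuous_on_extend_right:
  fixes g :: "real \<Rightarrow> complex"
  assumes x: "x < \<beta>" and ac: "abs_continuous_on {x..<\<beta>} g" and lim: "(g \<longlongrightarrow> g \<beta>) (at_left \<beta>)"
  shows "abs_continuous_on {x..\<beta>} g"
  unfolding abs_continuous_on_def
proof (intro allI impI)
  fix e :: real assume e: "e > 0"
  obtain d where d: "d > 0" and acd: "\<And>D. finite D \<Longrightarrow> \<forall>(u, v)\<in>D. u \<le> v \<and> {u..v} \<subseteq> {x..<\<beta>} \<Longrightarrow>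
      disjoint_family_on (\<lambda>(a, b). {a<..<b}) D \<Longrightarrow> (\<Sum>(a, b)\<in>D. b - a) < d \<Longrightarrow> (\<Sum>(a, b)\<in>D. norm (g b - g a)) < e / 2"
    using ac[unfolded abs_continuous_on_def, rule_format, of "e / 2"] e by auto
  have "(\<Sum>(a, b)\<in>D. norm (g b - g a)) < e"
    if fin: "finite D" and D: "\<forall>(a, b)\<in>D. a \<le> b \<and> {a..b} \<subseteq> {x..\<beta>}"
      and dis: "disjoint_family_on (\<lambda>(a, b). {a<..<b}) D" and small: "(\<Sum>(a, b)\<in>D. b - a) < d" for D
  proof -
    \<comment> \<open>Degenerate intervals contribute nothing and are dropped; one at \<beta> would
      spoil the uniqueness of the interval ending there.\<close>
    define D1 where "D1 = {(p, q). (p, q) \<in> D \<and> p < q \<and> q < \<beta>}"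
    define D2 where "D2 = {(p, q). (p, q) \<in> D \<and> p < q \<and> q = \<beta>}"
    have sub: "D1 \<subseteq> D" "D2 \<subseteq> D" by (auto simp: D1_def D2_def)
    have fin12: "finite D1" "finite D2" using sub fin finite_subset by blast+
    have D1x: "x \<le> p \<and> p < q \<and> q < \<beta>" if "(p, q) \<in> D1" for p q
      using that D by (force simp: D1_def)
    have "(\<Sum>(a, b)\<in>D. norm (g b - g a)) = (\<Sum>(a, b)\<in>D1 \<union> D2. norm (g b - g a))"
    proof (rule sum.mono_neutral_right[OF fin])
      show "\<forall>z\<in>D - (D1 \<union> D2). (case z of (a, b) \<Rightarrow> norm (g b - g a)) = 0"
      proof
        fix z assume z: "z \<in> D - (D1 \<union> D2)"
        obtain a b where zab: "z = (a, b)" by (cases z)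
        hence "a \<le> b" "{a..b} \<subseteq> {x..\<beta>}" using D z by auto
        hence "a = b" using z zab by (auto simp: D1_def D2_def)
        thus "(case z of (a, b) \<Rightarrow> norm (g b - g a)) = 0" using zab by simp
      qed
    qed (use sub in auto)
    also have "\<dots> = (\<Sum>(a, b)\<in>D1. norm (g b - g a)) + (\<Sum>(a, b)\<in>D2. norm (g b - g a))"
      using fin12 by (intro sum.union_disjoint) (auto simp: D1_def D2_def)
    finally have eq: "(\<Sum>(a, b)\<in>D. norm (g b - g a)) = (\<Sum>(a, b)\<in>D1. norm (g b - g a)) + (\<Sum>(a, b)\<in>D2. norm (g b - g a))" .
    have sum12: "(\<Sum>(a, b)\<in>D1. b - a) + (\<Sum>(a, b)\<in>D2. b - a) \<le> (\<Sum>(a, b)\<in>D. b - a)"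
    proof -
      have "(\<Sum>(a, b)\<in>D1. b - a) + (\<Sum>(a, b)\<in>D2. b - a) = (\<Sum>(a, b)\<in>D1 \<union> D2. b - a)"
        using fin12 by (intro sum.union_disjoint[symmetric]) (auto simp: D1_def D2_def)
      also have "\<dots> \<le> (\<Sum>(a, b)\<in>D. b - a)" using fin sub D by (intro sum_mono2) auto
      finally show ?thesis .
    qed
    have dis1: "disjoint_family_on (\<lambda>(a, b). {a<..<b}) D1" by (rule disjoint_family_on_mono[OF sub(1) dis])
    show ?thesis
    proof (cases "D2 = {}")
      case True
      have "(\<Sum>(a, b)\<in>D1. norm (g b - g a)) < e / 2"
        using D1x sum12 small True by (intro acd fin12 dis1) fastforce+
      thus ?thesis using eq True e by simp
    next
      case False
      then obtain p0 where p0: "(p0, \<beta>) \<in> D" "p0 < \<beta>" by (auto simp: D2_def)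
      have xp0: "x \<le> p0" using D p0 by force
      have uniq: "p = p0" if "(p, \<beta>) \<in> D" "p < \<beta>" for p
      proof (rule ccontr)
        assume "p \<noteq> p0"
        hence "{p<..<\<beta>} \<inter> {p0<..<\<beta>} = {}"
          using disjoint_family_onD[OF dis that(1) p0(1)] by auto
        moreover have "(max p p0 + \<beta>) / 2 \<in> {p<..<\<beta>} \<inter> {p0<..<\<beta>}" using that p0 by (auto simp: max_def)
        ultimately show False by blast
      qed
      have D2: "D2 = {(p0, \<beta>)}"
      proof (intro equalityI subsetI)
        fix z assume "z \<in> D2"
        then obtain p where "z = (p, \<beta>)" "(p, \<beta>) \<in> D" "p < \<beta>" by (auto simp: D2_def)
        thus "z \<in> {(p0, \<beta>)}" using uniq[of p] by simp
      qed (use p0 in \<open>simp add: D2_def\<close>)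
      \<comment> \<open>For t beyond M the pair (p0, t) is not in D1 and is nondegenerate, so it may
        be inserted.\<close>
      define M where "M = Max (insert p0 (snd ` D1))"
      have M: "M < \<beta>" "p0 \<le> M" "\<And>p q. (p, q) \<in> D1 \<Longrightarrow> q \<le> M"
        unfolding M_def using fin12 p0 D1x by (auto intro!: Max_ge) force
      have bound: "(\<Sum>(a, b)\<in>D1. norm (g b - g a)) + norm (g t - g p0) \<le> e / 2" if t: "M < t" "t < \<beta>" for t
      proof -
        have nin: "(p0, t) \<notin> D1" using M(3) t by fastforce
        have "(\<Sum>(a, b)\<in>insert (p0, t) D1. norm (g b - g a)) < e / 2"
        proof (rule acd)
          show "\<forall>(u, v)\<in>insert (p0, t) D1. u \<le> v \<and> {u..v} \<subseteq> {x..<\<beta>}"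
            using t M(2) xp0 D1x by fastforce
          have dj: "{p0<..<t} \<inter> {p<..<q} = {}" if "(p, q) \<in> D1" for p q
          proof -
            have "(p0, \<beta>) \<noteq> (p, q)" using D1x[OF that] by auto
            hence "{p0<..<\<beta>} \<inter> {p<..<q} = {}"
              using disjoint_family_onD[OF dis p0(1), of "(p, q)"] sub(1) that by auto
            thus ?thesis using t by auto
          qed
          have dj': "{p0<..<t} \<inter> (case z of (a, b) \<Rightarrow> {a<..<b}) = {}" if "z \<in> D1" for z
            using dj[of "fst z" "snd z"] that by (cases z) (simp only: prod.case fst_conv snd_conv)
          show "disjoint_family_on (\<lambda>(a, b). {a<..<b}) (insert (p0, t) D1)"
            unfolding disjoint_family_on_insert[OF nin] prod.case using dis1 dj' by blast
          have "(\<Sum>(a, b)\<in>insert (p0, t) D1. b - a) = (t - p0) + (\<Sum>(a, b)\<in>D1. b - a)"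
            using fin12 nin by simp
          also have "\<dots> \<le> (\<Sum>(a, b)\<in>D2. b - a) + (\<Sum>(a, b)\<in>D1. b - a)" using t by (simp add: D2)
          finally show "(\<Sum>(a, b)\<in>insert (p0, t) D1. b - a) < d" using sum12 small by simp
        qed (use fin12 in auto)
        thus ?thesis using fin12 nin by simp
      qed
      have "((\<lambda>t. (\<Sum>(a, b)\<in>D1. norm (g b - g a)) + norm (g t - g p0)) \<longlongrightarrow>
          (\<Sum>(a, b)\<in>D1. norm (g b - g a)) + norm (g \<beta> - g p0)) (at_left \<beta>)"
        by (intro tendsto_intros lim)
      moreover have "\<forall>\<^sub>F t in at_left \<beta>. (\<Sum>(a, b)\<in>D1. norm (g b - g a)) + norm (g t - g p0) \<le> e / 2"
        using eventually_at_left_real[OF M(1)] by eventually_elim (use bound in auto)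
      ultimately have "(\<Sum>(a, b)\<in>D1. norm (g b - g a)) + norm (g \<beta> - g p0) \<le> e / 2"
        by (intro tendsto_upperbound) auto
      thus ?thesis using eq e by (simp add: D2)
    qed
  qed
  thus "\<exists>d>0. \<forall>D. finite D \<and> (\<forall>(a, b)\<in>D. a \<le> b \<and> {a..b} \<subseteq> {x..\<beta>}) \<and>
      disjoint_family_on (\<lambda>(a, b). {a<..<b}) D \<and> (\<Sum>(a, b)\<in>D. b - a) < d \<longrightarrow> (\<Sum>(a, b)\<in>D. norm (g b - g a)) < e"
    using d by (intro exI[of _ d]) auto
qed

text \<open>Serves the antiderivative in Taylor's formula, whose increments are controlled by those
  of an absolutely continuous function and of a Lipschitz function.\<close>

lemma abs_continuous_on_dominated:
  fixes g P :: "real \<Rightarrow> complex"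
  assumes ac: "abs_continuous_on I g" and A: "A \<ge> 0" "B \<ge> 0"
    and le: "\<And>u v. u \<le> v \<Longrightarrow> {u..v} \<subseteq> I \<Longrightarrow> norm (P v - P u) \<le> A * norm (g v - g u) + B * (v - u)"
  shows "abs_continuous_on I P"
  unfolding abs_continuous_on_def
proof (intro allI impI)
  fix e :: real assume e: "e > 0"
  define e1 where "e1 = e / (2 * (A + 1))"
  have e1: "e1 > 0" using e A by (simp add: e1_def)
  obtain d1 where d1: "d1 > 0" and acd: "\<And>D. finite D \<Longrightarrow> \<forall>(u, v)\<in>D. u \<le> v \<and> {u..v} \<subseteq> I \<Longrightarrow>
      disjoint_family_on (\<lambda>(a, b). {a<..<b}) D \<Longrightarrow> (\<Sum>(a, b)\<in>D. b - a) < d1 \<Longrightarrow> (\<Sum>(a, b)\<in>D. norm (g b - g a)) < e1"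
    using ac[unfolded abs_continuous_on_def, rule_format, of e1] e1 by auto
  define d where "d = min d1 (e / (2 * (B + 1)))"
  have "(\<Sum>(a, b)\<in>D. norm (P b - P a)) < e"
    if fin: "finite D" and D: "\<forall>(a, b)\<in>D. a \<le> b \<and> {a..b} \<subseteq> I"
      and dis: "disjoint_family_on (\<lambda>(a, b). {a<..<b}) D" and small: "(\<Sum>(a, b)\<in>D. b - a) < d" for D
  proof -
    have 1: "(\<Sum>(a, b)\<in>D. norm (g b - g a)) < e1" using small by (intro acd fin D dis) (simp add: d_def)
    have 2: "(\<Sum>(a, b)\<in>D. b - a) < e / (2 * (B + 1))" using small by (simp add: d_def)
    have "(\<Sum>(a, b)\<in>D. norm (P b - P a)) \<le> (\<Sum>(a, b)\<in>D. A * norm (g b - g a) + B * (b - a))"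
      using D le by (intro sum_mono) auto
    also have "\<dots> = A * (\<Sum>(a, b)\<in>D. norm (g b - g a)) + B * (\<Sum>(a, b)\<in>D. b - a)"
      by (simp add: split_beta' sum.distrib sum_distrib_left)
    also have "\<dots> \<le> A * e1 + B * (e / (2 * (B + 1)))"
      using 1 2 A by (intro add_mono mult_left_mono) auto
    also have "\<dots> < (A + 1) * e1 + (B + 1) * (e / (2 * (B + 1)))"
      using e1 e A by (intro add_strict_mono mult_strict_right_mono) auto
    also have "(A + 1) * e1 = e / 2" using A by (simp add: e1_def field_simps)
    also have "(B + 1) * (e / (2 * (B + 1))) = e / 2" using A by (simp add: field_simps)
    finally show ?thesis by simp
  qed
  moreover have "d > 0" using d1 e A by (simp add: d_def)
  ultimately show "\<exists>d>0. \<forall>D. finite D \<and> (\<forall>(a, b)\<in>D. a \<le> b \<and> {a..b} \<subseteq> I) \<and>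
      disjoint_family_on (\<lambda>(a, b). {a<..<b}) D \<and> (\<Sum>(a, b)\<in>D. b - a) < d \<longrightarrow> (\<Sum>(a, b)\<in>D. norm (P b - P a)) < e"
    by (intro exI[of _ d]) auto
qed

lemma abs_continuous_on_cong:
  assumes "abs_continuous_on I f" "\<And>x. x \<in> I \<Longrightarrow> f x = g x"
  shows "abs_continuous_on I g"
proof (rule abs_continuous_on_dominated[OF assms(1), of 1 0])
  fix u v :: real assume "u \<le> v" "{u..v} \<subseteq> I"
  hence "u \<in> I" "v \<in> I" by auto
  thus "norm (g v - g u) \<le> 1 * norm (f v - f u) + 0 * (v - u)" using assms(2) by simp
qed auto

section \<open>Taylor's formula for the weight and the integrand of E1\<close>

locale admissible_weight =
  fixes \<beta> :: real and f f' f'' :: "real \<Rightarrow> complex"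
  assumes beta: "\<beta> > 0" and adm: "admissible \<beta> f f' f''"
begin

text \<open>\<open>admissible\<close> leaves the value of f' at \<beta> open; g puts the limit 0 in
  its place, which makes it absolutely continuous up to and including \<beta>.\<close>

definition g where "g w = (if w < \<beta> then f' w else 0)"

lemma f_beta: "f w = 0" if "w \<ge> \<beta>"
proof (rule ccontr)
  assume "f w \<noteq> 0"
  hence "w \<in> {0..<\<beta>}" using adm unfolding admissible_def by blast
  thus False using that by simp
qed

lemma g_tendsto: "(g \<longlongrightarrow> 0) (at_left \<beta>)"
proof -
  have "(f' \<longlongrightarrow> 0) (at_left \<beta>)" using adm by (simp add: admissible_def)
  moreover have "\<forall>\<^sub>F w in at_left \<beta>. f' w = g w"
    using eventually_at_left_real[OF beta] by eventually_elim (simp add: g_def)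
  ultimately show ?thesis by (rule Lim_transform_eventually)
qed

lemma g_abs_continuous: "0 < x \<Longrightarrow> x < \<beta> \<Longrightarrow> abs_continuous_on {x..\<beta>} g"
proof (rule abs_continuous_on_extend_right)
  assume x: "0 < x" "x < \<beta>"
  have "abs_continuous_on {0<..<\<beta>} f'" using adm by (simp add: admissible_def)
  hence "abs_continuous_on {x..<\<beta>} f'" by (rule abs_continuous_on_subset) (use x in auto)
  thus "abs_continuous_on {x..<\<beta>} g" by (rule abs_continuous_on_cong) (auto simp: g_def)
  show "(g \<longlongrightarrow> g \<beta>) (at_left \<beta>)" using g_tendsto by (simp add: g_def)
qed

text \<open>The point \<beta> is put into the null set, because \<open>admissible\<close> provides a
  two-sided derivative only inside the open interval.\<close>

lemma derivative_ae:
  "\<exists>S. negligible S \<and> \<beta> \<in> S \<and>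
     (\<forall>w\<in>{0<..\<beta>} - S. 0 < w \<and> w < \<beta> \<and> (g has_vector_derivative f'' w) (at w))"
proof -
  have "AE x in lebesgue. x \<in> {0<..<\<beta>} \<longrightarrow> (f' has_vector_derivative f'' x) (at x)"
    using adm by (simp add: admissible_def)
  then obtain N where N: "{x \<in> space lebesgue. \<not> (x \<in> {0<..<\<beta>} \<longrightarrow> (f' has_vector_derivative f'' x) (at x))} \<subseteq> N"
    "N \<in> null_sets lebesgue" unfolding eventually_ae_filter by blast
  show ?thesis
  proof (intro exI[of _ "insert \<beta> N"] conjI ballI)
    show "negligible (insert \<beta> N)" using N(2) by (simp add: negligible_iff_null_sets[symmetric])
    fix w assume w: "w \<in> {0<..\<beta>} - insert \<beta> N"
    hence w': "w \<in> {0<..<\<beta>}" by auto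
    have "(f' has_vector_derivative f'' w) (at w)" using N(1) w w' by auto
    hence "(g has_vector_derivative f'' w) (at w)"
      by (rule has_vector_derivative_transform_within_open[of _ _ _ "{0<..<\<beta>}"]) (use w' in \<open>auto simp: g_def\<close>)
    thus "0 < w" "w < \<beta>" "(g has_vector_derivative f'' w) (at w)" using w' by auto
  qed auto
qed

lemma f''_absolutely_integrable:
  assumes x: "0 < x" "x < \<beta>"
  shows "f'' absolutely_integrable_on {x..\<beta>}"
proof -
  obtain S where S: "negligible S" "\<beta> \<in> S"
    "\<forall>w\<in>{0<..\<beta>} - S. 0 < w \<and> w < \<beta> \<and> (g has_vector_derivative f'' w) (at w)"
    using derivative_ae by blast
  show ?thesis
  proof (rule abs_continuous_on_absolutely_integrable[OF _ g_abs_continuous[OF x] S(1)])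
    fix w assume "w \<in> {x..\<beta>} - S"
    hence "(g has_vector_derivative f'' w) (at w)" using S(3) x by auto
    thus "(g has_vector_derivative f'' w) (at w within {x..\<beta>})" by (rule has_vector_derivative_at_within)
  qed (use x in auto)
qed

lemma continuous_on_g:
  assumes x: "0 < x" "x < \<beta>"
  shows "continuous_on {x..\<beta>} g"
proof -
  have c: "continuous_on {0<..<\<beta>} f'" using adm by (simp add: admissible_def)
  show ?thesis
    unfolding continuous_on_def
  proof
    fix w assume w: "w \<in> {x..\<beta>}"
    show "(g \<longlongrightarrow> g w) (at w within {x..\<beta>})"
    proof (cases "w = \<beta>")
      case True
      have "(g \<longlongrightarrow> g \<beta>) (at \<beta> within {x..\<beta>})"
        using g_tendsto x by (simp add: g_def at_within_Icc_at_left)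
      thus ?thesis using True by simp
    next
      case False
      hence w': "w \<in> {0<..<\<beta>}" using w x by auto
      have "isCont f' w" by (rule continuous_on_interior[OF c]) (use w' in simp)
      hence "(f' \<longlongrightarrow> f' w) (at w)" by (simp add: isCont_def)
      hence "(g \<longlongrightarrow> f' w) (at w)"
        by (rule Lim_transform_within_open[of _ _ _ _ "{0<..<\<beta>}"]) (use w' in \<open>auto simp: g_def\<close>)
      moreover have "f' w = g w" using w' by (simp add: g_def)
      ultimately have "(g \<longlongrightarrow> g w) (at w)" by simp
      thus ?thesis by (rule tendsto_within_subset) auto
    qed
  qed
qed

text \<open>f vanishes at \<beta> by its support and tends to 0 there, so it is continuous on the
  closed interval; the mean value inequality with the bounded derivative g does the rest.\<close>

lemma f_lipschitz:
  assumes x: "0 < x" "x < \<beta>"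
  obtains M where "M \<ge> 0" "\<And>w. w \<in> {x..\<beta>} \<Longrightarrow> norm (g w) \<le> M"
    "\<And>u v. u \<le> v \<Longrightarrow> {u..v} \<subseteq> {x..\<beta>} \<Longrightarrow> norm (f v - f u) \<le> M * (v - u)"
proof -
  have "bounded (g ` {x..\<beta>})"
    by (intro compact_imp_bounded compact_continuous_image continuous_on_g x) auto
  then obtain M where M: "M > 0" "\<And>w. w \<in> {x..\<beta>} \<Longrightarrow> norm (g w) \<le> M"
    by (auto simp: bounded_pos)
  have der: "(f has_vector_derivative f' w) (at w)" if "w \<in> {0<..<\<beta>}" for w
    using adm that by (simp add: admissible_def)
  have cont: "continuous_on {x..\<beta>} f"
    unfolding continuous_on_def
  proof
    fix w assume w: "w \<in> {x..\<beta>}"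
    show "(f \<longlongrightarrow> f w) (at w within {x..\<beta>})"
    proof (cases "w = \<beta>")
      case True
      have "(f \<longlongrightarrow> 0) (at_left \<beta>)" using adm by (simp add: admissible_def)
      hence "(f \<longlongrightarrow> f \<beta>) (at \<beta> within {x..\<beta>})"
        using x by (simp add: f_beta at_within_Icc_at_left)
      thus ?thesis using True by simp
    next
      case False
      hence "w \<in> {0<..<\<beta>}" using w x by auto
      from has_vector_derivative_continuous[OF der[OF this]] have "(f \<longlongrightarrow> f w) (at w)"
        by (simp add: continuous_within)
      thus ?thesis by (rule tendsto_within_subset) auto
    qed
  qed
  have "norm (f v - f u) \<le> M * (v - u)" if uv: "u \<le> v" "{u..v} \<subseteq> {x..\<beta>}" for u v
  proof (cases "u = v")
    case False
    hence less: "u < v" using uv by simp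
    have uv': "x \<le> u" "v \<le> \<beta>" using uv by auto
    have "\<exists>w\<in>{u<..<v}. norm (f v - f u) \<le> norm ((v - u) *\<^sub>R f' w)"
    proof (rule mvt_general[OF less, of f "\<lambda>w y. y *\<^sub>R f' w"])
      show "continuous_on {u..v} f" using cont uv(2) continuous_on_subset by blast
      fix w assume "u < w" "w < v"
      thus "(f has_derivative (\<lambda>y. y *\<^sub>R f' w)) (at w)"
        using der[of w] uv' x by (simp add: has_vector_derivative_def)
    qed
    then obtain w where w: "w \<in> {u<..<v}" "norm (f v - f u) \<le> norm ((v - u) *\<^sub>R f' w)" by blast
    have "norm (f' w) \<le> M" using M(2)[of w] w uv' by (auto simp: g_def)
    hence "(v - u) * norm (f' w) \<le> (v - u) * M" using less by (intro mult_left_mono) auto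
    moreover have "norm (f v - f u) \<le> (v - u) * norm (f' w)" using w(2) less by simp
    ultimately show ?thesis by (simp only: mult.commute[of M])
  qed auto
  thus ?thesis using that M by (metis less_imp_le)
qed

text \<open>Taylor's formula with integral remainder, expanded at \<beta>, where f and f' vanish. P
  is the antiderivative found by parts; it is absolutely continuous because g is and f is Lipschitz
  on the interval.\<close>

lemma f_representation_Icc:
  assumes x: "0 < x" "x < \<beta>"
  shows "(\<lambda>w. (w - x) *\<^sub>R f'' w) absolutely_integrable_on {x..\<beta>}"
    and "((\<lambda>w. (w - x) *\<^sub>R f'' w) has_integral f x) {x..\<beta>}"
proof -
  obtain S where S: "negligible S" "\<beta> \<in> S"
    "\<forall>w\<in>{0<..\<beta>} - S. 0 < w \<and> w < \<beta> \<and> (g has_vector_derivative f'' w) (at w)"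
    using derivative_ae by blast
  obtain M where M: "M \<ge> 0" "\<And>w. w \<in> {x..\<beta>} \<Longrightarrow> norm (g w) \<le> M"
    "\<And>u v. u \<le> v \<Longrightarrow> {u..v} \<subseteq> {x..\<beta>} \<Longrightarrow> norm (f v - f u) \<le> M * (v - u)"
    using f_lipschitz[OF x] by blast
  define P where "P = (\<lambda>w. (w - x) *\<^sub>R g w - f w)"
  have acP: "abs_continuous_on {x..\<beta>} P"
  proof (rule abs_continuous_on_dominated[OF g_abs_continuous[OF x], of "\<beta> - x" "2 * M"])
    fix u v :: real assume uv: "u \<le> v" "{u..v} \<subseteq> {x..\<beta>}"
    hence uv': "x \<le> u" "v \<le> \<beta>" by auto
    have "P v - P u = (v - x) *\<^sub>R (g v - g u) + (v - u) *\<^sub>R g u - (f v - f u)"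
      by (simp add: P_def algebra_simps)
    also have "norm \<dots> \<le> norm ((v - x) *\<^sub>R (g v - g u)) + norm ((v - u) *\<^sub>R g u) + norm (f v - f u)"
      by (rule order_trans[OF norm_triangle_ineq4]) (intro add_mono norm_triangle_ineq order_refl)
    also have "\<dots> \<le> (\<beta> - x) * norm (g v - g u) + (v - u) * M + M * (v - u)"
      using uv uv' x M(2)[of u] M(3)[OF uv] by (intro add_mono) (auto intro!: mult_right_mono mult_left_mono)
    finally show "norm (P v - P u) \<le> (\<beta> - x) * norm (g v - g u) + 2 * M * (v - u)"
      by (simp add: algebra_simps)
  qed (use x M in auto)
  have dP: "(P has_vector_derivative (w - x) *\<^sub>R f'' w) (at w within {x..\<beta>})" if "w \<in> {x..\<beta>} - S" for w
  proof -
    have w: "0 < w" "w < \<beta>" "(g has_vector_derivative f'' w) (at w)" using S(3)[rule_format, of w] that x by auto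
    have f: "(f has_vector_derivative g w) (at w)" using adm w by (simp add: admissible_def g_def)
    have "(P has_vector_derivative ((w - x) *\<^sub>R f'' w + 1 *\<^sub>R g w - g w)) (at w)"
      unfolding P_def
      by (intro has_vector_derivative_diff has_vector_derivative_scaleR f w(3)) (auto intro!: derivative_eq_intros)
    hence "(P has_vector_derivative (w - x) *\<^sub>R f'' w) (at w)" by simp
    thus ?thesis by (rule has_vector_derivative_at_within)
  qed
  show "(\<lambda>w. (w - x) *\<^sub>R f'' w) absolutely_integrable_on {x..\<beta>}"
    by (rule abs_continuous_on_absolutely_integrable[OF _ acP S(1) dP]) (use x in auto)
  have "((\<lambda>w. (w - x) *\<^sub>R f'' w) has_integral P \<beta> - P x) {x..\<beta>}"
    by (rule abs_continuous_on_has_integral[OF _ acP S(1) dP]) (use x in auto)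
  thus "((\<lambda>w. (w - x) *\<^sub>R f'' w) has_integral f x) {x..\<beta>}"
    by (simp add: P_def f_beta g_def)
qed

text \<open>With the kernel \<open>max 0 (w - x)\<close> the range of integration no longer depends
  on x, so a finite sum over x can be taken under a single integral. The change of range alters the
  integrand only on the null set {\<beta>}.\<close>

lemma f_representation:
  assumes x: "0 < x"
  shows "set_integrable lebesgue {0<..<\<beta>} (\<lambda>w. max 0 (w - x) *\<^sub>R f'' w)"
    and "(LINT w:{0<..<\<beta>}|lebesgue. max 0 (w - x) *\<^sub>R f'' w) = f x"
proof -
  let ?F = "\<lambda>w. max 0 (w - x) *\<^sub>R f'' w"
  have "?F absolutely_integrable_on {0<..<\<beta>} \<and> (?F has_integral f x) {0<..<\<beta>}"
  proof (cases "x < \<beta>")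
    case True
    let ?G = "\<lambda>w. if w \<in> {x..\<beta>} then (w - x) *\<^sub>R f'' w else 0"
    let ?H = "\<lambda>w. if w \<in> {0<..<\<beta>} then ?F w else 0"
    have eq: "?H w = ?G w" if "w \<in> UNIV - {\<beta>}" for w
      using that x by auto
    have "?G absolutely_integrable_on UNIV" "(?G has_integral f x) UNIV"
      using f_representation_Icc[OF x True]
      by (simp_all only: absolutely_integrable_restrict_UNIV has_integral_restrict_UNIV)
    hence "?H absolutely_integrable_on UNIV" "(?H has_integral f x) UNIV"
      using absolutely_integrable_spike[where f = ?G and T = UNIV and S = "{\<beta>}" and g = ?H]
        has_integral_spike[where f = ?G and T = UNIV and S = "{\<beta>}" and g = ?H and y = "f x"] eq by auto
    thus ?thesis by (simp only: absolutely_integrable_restrict_UNIV has_integral_restrict_UNIV)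
  next
    case False
    have z: "?F w = 0" if "w \<in> {0<..<\<beta>}" for w using that False by auto
    have "?F absolutely_integrable_on {0<..<\<beta>}"
      using z by (intro absolutely_integrable_onI) (auto intro: integrable_eq[OF integrable_0])
    moreover have "(?F has_integral 0) {0<..<\<beta>}" using z by (intro has_integral_is_0) auto
    ultimately show ?thesis using False f_beta[of x] by simp
  qed
  hence ai: "?F absolutely_integrable_on {0<..<\<beta>}" and hi: "(?F has_integral f x) {0<..<\<beta>}" by auto
  show "set_integrable lebesgue {0<..<\<beta>} ?F" by (rule ai)
  show "(LINT w:{0<..<\<beta>}|lebesgue. ?F w) = f x"
    by (rule trans[OF set_lebesgue_integral_eq_integral(2)[OF ai] integral_unique[OF hi]])
qed

text \<open>Integrability is known only on intervals bounded away from 0, so measurability is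
  obtained as a limit of cut-offs at points tending to 0.\<close>

lemma f''_measurable: "(\<lambda>w. indicator {0<..\<beta>} w *\<^sub>R f'' w) \<in> borel_measurable lebesgue"
proof (rule borel_measurable_LIMSEQ_metric)
  fix n :: nat
  have "f'' absolutely_integrable_on {\<beta> / (real n + 2)..\<beta>}"
    using beta by (intro f''_absolutely_integrable) (auto simp: field_simps intro: add_pos_nonneg)
  thus "(\<lambda>w. indicator {\<beta> / (real n + 2)..\<beta>} w *\<^sub>R f'' w) \<in> borel_measurable lebesgue"
    unfolding set_integrable_def by (rule borel_measurable_integrable)
next
  fix w :: real
  show "(\<lambda>n. indicator {\<beta> / (real n + 2)..\<beta>} w *\<^sub>R f'' w) \<longlonglongrightarrow> indicator {0<..\<beta>} w *\<^sub>R f'' w"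
  proof (cases "w > 0")
    case True
    obtain n0 where n0: "\<beta> / w \<le> real n0" using real_arch_simple by blast
    have "\<forall>\<^sub>F n in sequentially. indicator {\<beta> / (real n + 2)..\<beta>} w *\<^sub>R f'' w = indicator {0<..\<beta>} w *\<^sub>R f'' w"
      using eventually_ge_at_top[of n0]
    proof eventually_elim
      case (elim n)
      have "\<beta> / w \<le> real n + 2" using n0 elim by linarith
      hence "\<beta> / (real n + 2) \<le> w" using True by (simp add: field_simps)
      thus ?case using True by (auto simp: indicator_def)
    qed
    thus ?thesis by (rule tendsto_eventually)
  next
    case False
    have "\<not> \<beta> / (real n + 2) \<le> w" for n
      using False beta divide_pos_pos[of \<beta> "real n + 2"] by linarith
    thus ?thesis using False by (simp add: indicator_def)
  qed
qed

text \<open>A Bochner integral without integrability is 0 by convention, which would leave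
  \<open>E1\<close> without meaning and the domination argument without a majorant. Near 0 the
  boundedness of f'' leaves only the integrable singularity of |ln w|^3; away from 0 the weight is
  bounded and f'' is integrable.\<close>

lemma weight_integrable:
  assumes p: "p > 0"
  shows "set_integrable lebesgue {0<..<\<beta>} (\<lambda>w. norm (f'' w) * (1 + \<bar>ln w\<bar> ^ 3) * (1 + w powr p))"
proof -
  define W where "W = (\<lambda>w::real. (1 + \<bar>ln w\<bar> ^ 3) * (1 + w powr p))"
  have W0: "W w \<ge> 0" for w by (simp add: W_def)
  obtain \<delta> B where \<delta>: "\<delta> > 0" and B: "AE x in lebesgue. x \<in> {0<..<\<beta>} \<and> x < \<delta> \<longrightarrow> norm (f'' x) \<le> B"
    using adm unfolding admissible_def by blast
  define c where "c = min (min (\<delta> / 2) (\<beta> / 2)) 1"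
  have c: "0 < c" "c < \<beta>" "c < \<delta>" "c \<le> 1" using \<delta> beta by (auto simp: c_def)
  have 1: "set_integrable lebesgue {c..\<beta>} (\<lambda>w. W w * norm (f'' w))"
  proof (rule absolutely_integrable_bounded_measurable_product_real)
    have contW: "continuous_on {c..\<beta>} W" unfolding W_def using c by (intro continuous_intros) auto
    show "W \<in> borel_measurable (lebesgue_on {c..\<beta>})"
      by (rule continuous_imp_measurable_on_sets_lebesgue[OF contW]) simp
    show "bounded (W ` {c..\<beta>})" by (intro compact_imp_bounded compact_continuous_image contW) simp
    show "(\<lambda>w. norm (f'' w)) absolutely_integrable_on {c..\<beta>}"
      using f''_absolutely_integrable[OF c(1,2)] by (rule set_integrable_norm)
  qed simp
  have 2: "set_integrable lebesgue {0<..c} (\<lambda>w. W w * norm (f'' w))"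
    unfolding set_integrable_def
  proof (rule Bochner_Integration.integrable_bound)
    have "(\<lambda>w::real. w powr (-1/2)) absolutely_integrable_on {0<..c}"
      using c by (intro nonnegative_absolutely_integrable_1 integrable_on_powr_from_0') auto
    \<comment> \<open>434 = 2 * (1 + 6^3): for w <= 1, |ln w| <= 6 w^(-1/6), so 1 + |ln w|^3 <= 217
      w^(-1/2), and 1 + w^p <= 2.\<close>
    hence "set_integrable lebesgue {0<..c} (\<lambda>w. 434 * \<bar>B\<bar> * w powr (-1/2))"
      by (intro set_integrable_mult_right) auto
    thus "integrable lebesgue (\<lambda>w. indicator {0<..c} w *\<^sub>R (434 * \<bar>B\<bar> * w powr (-1/2)))"
      by (simp add: set_integrable_def)
    have "W \<in> borel_measurable borel" unfolding W_def by measurable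
    hence Wm: "W \<in> borel_measurable lebesgue" by (simp add: measurable_completion)
    have im: "(\<lambda>w. indicat_real {0<..c} w) \<in> borel_measurable lebesgue"
      by (rule borel_measurable_indicator) simp
    have nm: "(\<lambda>w. norm (indicat_real {0<..\<beta>} w *\<^sub>R f'' w)) \<in> borel_measurable lebesgue"
      by (rule measurable_compose[OF f''_measurable]) measurable
    have "(\<lambda>w. indicat_real {0<..c} w * (W w * norm (indicat_real {0<..\<beta>} w *\<^sub>R f'' w))) \<in> borel_measurable lebesgue"
      by (intro borel_measurable_times im Wm nm)
    also have "(\<lambda>w. indicat_real {0<..c} w * (W w * norm (indicat_real {0<..\<beta>} w *\<^sub>R f'' w))) =
        (\<lambda>w. indicator {0<..c} w *\<^sub>R (W w * norm (f'' w)))"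
      using c by (auto simp: fun_eq_iff indicator_def)
    finally show "(\<lambda>w. indicator {0<..c} w *\<^sub>R (W w * norm (f'' w))) \<in> borel_measurable lebesgue" .
    show "AE w in lebesgue. norm (indicator {0<..c} w *\<^sub>R (W w * norm (f'' w))) \<le> norm (indicator {0<..c} w *\<^sub>R (434 * \<bar>B\<bar> * w powr (-1/2)))"
      using B
    proof eventually_elim
      case (elim w)
      show ?case
      proof (cases "w \<in> {0<..c}")
        case True
        hence w: "0 < w" "w \<le> 1" "w \<in> {0<..<\<beta>}" "w < \<delta>" using c by auto
        have fB: "norm (f'' w) \<le> \<bar>B\<bar>" using elim w by auto
        have "\<bar>ln w\<bar> = ln (1 / w)" using w by (simp add: ln_div)
        also have "\<dots> \<le> (1 / w) powr (1/6) / (1/6)" using w by (intro ln_powr_bound) auto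
        finally have l: "\<bar>ln w\<bar> \<le> 6 * (1 / w) powr (1/6)" by simp
        have "\<bar>ln w\<bar> ^ 3 \<le> (6 * (1 / w) powr (1/6)) ^ 3" by (rule power_mono[OF l]) simp
        also have "\<dots> = 216 * ((1 / w) powr (1/6)) ^ 3" by (simp add: power_mult_distrib)
        also have "((1 / w) powr (1/6)) ^ 3 = (1 / w) powr (1/2)"
          using w by (simp add: powr_powr flip: powr_realpow)
        also have "(1 / w) powr (1/2) = w powr (-1/2)" using w by (simp add: powr_divide powr_minus_divide)
        finally have l3: "\<bar>ln w\<bar> ^ 3 \<le> 216 * w powr (-1/2)" .
        have "1 \<le> w powr (-1/2)" using powr_mono'[of "-1/2" 0 w] w by simp
        hence "1 + \<bar>ln w\<bar> ^ 3 \<le> 217 * w powr (-1/2)" using l3 by linarith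
        moreover have "1 + w powr p \<le> 2" using powr_le1[of p w] w p by simp
        ultimately have "W w \<le> (217 * w powr (-1/2)) * 2"
          unfolding W_def by (intro mult_mono) auto
        hence "W w * norm (f'' w) \<le> (217 * w powr (-1/2)) * 2 * \<bar>B\<bar>"
          using fB W0[of w] by (intro mult_mono) auto
        thus ?thesis using True W0[of w] by (simp add: mult_ac)
      qed simp
    qed
  qed
  have "set_integrable lebesgue ({0<..c} \<union> {c..\<beta>}) (\<lambda>w. W w * norm (f'' w))"
    by (rule set_integrable_Un[OF 2 1]) auto
  hence "set_integrable lebesgue {0<..<\<beta>} (\<lambda>w. W w * norm (f'' w))"
    by (rule set_integrable_subset) auto
  thus ?thesis by (simp add: W_def mult_ac)
qed

end

section \<open>Primitive characters\<close>

text \<open>Take for k the product of the primes dividing q but not a. A prime divisor of q then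
  divides exactly one of a and k d.\<close>

lemma exists_coprime_shift:
  fixes a d q :: nat
  assumes cop: "coprime a d" and q: "q > 0"
  shows "\<exists>k. coprime (a + k * d) q"
proof -
  define k where "k = \<Prod>{p \<in> prime_factors q. \<not> p dvd a}"
  have "coprime (a + k * d) q"
  proof (rule ccontr)
    assume "\<not> coprime (a + k * d) q"
    then obtain p where p: "prime p" "p dvd a + k * d" "p dvd q"
      by (metis coprime_iff_gcd_eq_1 gcd_nat.bounded_iff prime_factor_nat)
    have pq: "p \<in> prime_factors q" using p q by (auto simp: in_prime_factors_iff)
    show False
    proof (cases "p dvd a")
      case True
      hence "p dvd k * d" using p(2) by (simp add: dvd_add_right_iff)
      moreover have "\<not> p dvd d"
        using True cop p(1) by (meson coprime_common_divisor not_prime_unit)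
      ultimately have "p dvd k" using p(1) by (simp add: prime_dvd_mult_iff)
      then obtain r where r: "r \<in> prime_factors q" "\<not> r dvd a" "p dvd r"
        unfolding k_def using p(1) by (subst (asm) prime_dvd_prod_iff) auto
      hence "p = r" using p(1) by (auto simp: primes_dvd_imp_eq in_prime_factors_iff)
      thus False using r True by simp
    next
      case False
      hence "p dvd k" unfolding k_def using pq by (intro dvd_prodI) auto
      hence "p dvd a" using p(2) by (metis dvd_add_left_iff dvd_mult2)
      thus False using False by simp
    qed
  qed
  thus ?thesis by blast
qed

lemma induces_trans:
  assumes "induces d' \<psi>' d \<psi>" "induces d \<psi> q chi"
  shows "induces d' \<psi>' q chi"
proof -
  have "d dvd q" "d' dvd d" using assms by (auto simp: induces_def)
  moreover have "coprime a d" if "coprime a q" for a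
    by (rule coprime_divisors[OF dvd_refl \<open>d dvd q\<close> that])
  ultimately show ?thesis using assms unfolding induces_def by (auto intro: dvd_trans)
qed

text \<open>A character of least modulus among those inducing chi is primitive, by transitivity of
  induction.\<close>

lemma exists_primitive_inducing:
  assumes chi: "dirichlet_character q chi"
  shows "\<exists>\<psi> d. primitive_character d \<psi> \<and> induces d \<psi> q chi"
proof -
  define P where "P = (\<lambda>d. \<exists>\<psi>. induces d \<psi> q chi)"
  have "P q" unfolding P_def using chi by (auto simp: induces_def)
  hence P: "P (Least P)" by (rule LeastI)
  then obtain \<psi> where \<psi>: "induces (Least P) \<psi> q chi" unfolding P_def by blast
  have "primitive_character (Least P) \<psi>"
    unfolding primitive_character_def
  proof (intro conjI allI impI)
    show "dirichlet_character (Least P) \<psi>" using \<psi> by (simp add: induces_def)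
    fix d \<psi>' assume ind: "induces d \<psi>' (Least P) \<psi>"
    have "P d" unfolding P_def using induces_trans[OF ind \<psi>] by blast
    hence "Least P \<le> d" by (rule Least_le)
    moreover have "d \<le> Least P"
      using ind by (intro dvd_imp_le) (auto simp: induces_def dirichlet_character_def)
    ultimately show "d = Least P" by simp
  qed
  thus ?thesis using \<psi> by blast
qed

lemma coprime_cong_nat: "[a = b] (mod n) \<Longrightarrow> coprime a n \<Longrightarrow> coprime b (n :: nat)"
  using cong_imp_coprime by blast

text \<open>A Chinese remainder argument: some c coprime to q is congruent to a modulo d1 and to b
  modulo d2, so chi takes the same value at a and c through \<psi>1, and at c and b through
  \<psi>2.\<close>

lemma induces_well_defined:
  assumes i1: "induces d1 \<psi>1 q chi" and i2: "induces d2 \<psi>2 q chi"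
    and a: "coprime a q" and b: "coprime b q" and cong: "[a = b] (mod gcd d1 d2)"
  shows "chi a = chi b"
proof -
  have d: "d1 > 0" "d2 > 0" "d1 dvd q" "d2 dvd q" "q > 0"
    using i1 i2 by (auto simp: induces_def dirichlet_character_def)
  \<comment> \<open>The moduli need not be coprime; the two congruences are compatible because gcd
    d1 d2 divides b - a, and Bezout supplies a solution.\<close>
  obtain c0 where c0: "[c0 = a] (mod d1)" "[c0 = b] (mod d2)"
  proof -
    obtain x y where xy: "int d1 * x - int d2 * y = int b - int a"
    proof -
      have "int (gcd d1 d2) dvd int b - int a"
        using cong by (metis cong_iff_dvd_diff cong_int_iff cong_sym)
      then obtain k where k: "int b - int a = int (gcd d1 d2) * k" by blast
      obtain u v where uv: "u * int d1 + v * int d2 = gcd (int d1) (int d2)" using bezout_int by blast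
      have "int d1 * (u * k) - int d2 * (- v * k) = (u * int d1 + v * int d2) * k" by (simp add: algebra_simps)
      also have "\<dots> = int b - int a" unfolding uv k by (simp add: gcd_int_int_eq)
      finally show ?thesis using that by blast
    qed
    define z where "z = int a + int d1 * x"
    \<comment> \<open>A natural representative: adding a multiple of d1 d2 at least as large as |z|
      makes z nonnegative and changes neither congruence.\<close>
    define n where "n = nat (z + int (d1 * d2) * \<bar>z\<bar>)"
    have "d1 * d2 > 0" using d by simp
    hence "1 \<le> int (d1 * d2)" by linarith
    hence "1 * \<bar>z\<bar> \<le> int (d1 * d2) * \<bar>z\<bar>" by (intro mult_right_mono) auto
    hence n: "int n = z + int (d1 * d2) * \<bar>z\<bar>" unfolding n_def by (subst nat_0_le) auto
    have zb: "z = int b + int d2 * y" using xy by (simp add: z_def)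
    have "[int n = int a] (mod int d1)" unfolding n z_def cong_iff_dvd_diff by (simp add: dvd_add)
    moreover have "[int n = int b] (mod int d2)" unfolding n cong_iff_dvd_diff
      by (subst (1) zb) (simp add: dvd_add)
    ultimately show ?thesis using that[of n] by (simp add: cong_int_iff)
  qed
  have cop1: "coprime c0 d1"
    by (rule coprime_cong_nat[OF cong_sym[OF c0(1)]]) (use a d in \<open>meson coprime_divisors dvd_refl\<close>)
  have cop2: "coprime c0 d2"
    by (rule coprime_cong_nat[OF cong_sym[OF c0(2)]]) (use b d in \<open>meson coprime_divisors dvd_refl\<close>)
  have "coprime c0 (d1 * d2)" using cop1 cop2 by simp
  then obtain k where k: "coprime (c0 + k * (d1 * d2)) q" using exists_coprime_shift d(5) by blast
  define c where "c = c0 + k * (d1 * d2)"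
  have c1: "[c = a] (mod d1)"
    unfolding c_def using c0(1) by (metis cong_add_rcancel_0_nat cong_def mod_mult_self2 mult.assoc mult.commute)
  have c2: "[c = b] (mod d2)"
    unfolding c_def using c0(2) by (metis cong_def mod_mult_self2 mult.assoc mult.commute)
  have ch: "dirichlet_character d1 \<psi>1" "dirichlet_character d2 \<psi>2" using i1 i2 by (auto simp: induces_def)
  have "chi a = \<psi>1 a" using i1 a by (simp add: induces_def)
  also have "\<dots> = \<psi>1 c" using dirichlet_character_cong[OF ch(1) c1] by simp
  also have "\<dots> = chi c" using i1 k by (simp add: induces_def c_def)
  also have "\<dots> = \<psi>2 c" using i2 k by (simp add: induces_def c_def)
  also have "\<dots> = \<psi>2 b" using dirichlet_character_cong[OF ch(2) c2] by simp
  also have "\<dots> = chi b" using i2 b by (simp add: induces_def)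
  finally show ?thesis .
qed

text \<open>Every class coprime to d contains an integer coprime to q, and there both characters
  agree with chi.\<close>

lemma induces_determined:
  assumes i1: "induces d \<psi>1 q chi" and i2: "induces d \<psi>2 q chi"
  shows "\<psi>1 = \<psi>2"
proof
  fix a
  have ch: "dirichlet_character d \<psi>1" "dirichlet_character d \<psi>2" and q: "q > 0"
    using i1 i2 by (auto simp: induces_def dirichlet_character_def)
  show "\<psi>1 a = \<psi>2 a"
  proof (cases "coprime a d")
    case True
    obtain k where k: "coprime (a + k * d) q" using exists_coprime_shift[OF True q] by blast
    have "\<psi>1 a = \<psi>1 (a + k * d)" using dirichlet_character_mod[OF ch(1)] by simp
    also have "\<dots> = \<psi>2 (a + k * d)" using i1 i2 k unfolding induces_def by metis
    also have "\<dots> = \<psi>2 a" using dirichlet_character_mod[OF ch(2)] by simp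
    finally show ?thesis .
  next
    case False
    thus ?thesis using ch unfolding dirichlet_character_def by metis
  qed
qed

text \<open>On integers coprime to q, chi depends only on the class modulo e = gcd d1 d2. A
  character modulo e is therefore defined by moving each a coprime to e within its class to some r a
  coprime to q. Primitivity of \<psi>1 will force e = d1, from which the uniqueness of the inducing
  primitive character follows.\<close>

lemma induces_gcd:
  assumes i1: "induces d1 \<psi>1 q chi" and i2: "induces d2 \<psi>2 q chi"
  shows "\<exists>\<psi>. induces (gcd d1 d2) \<psi> d1 \<psi>1"
proof -
  define e where "e = gcd d1 d2"
  have d: "d1 > 0" "d2 > 0" "d1 dvd q" "d2 dvd q" "q > 0" and chi: "dirichlet_character q chi"
    and ch1: "dirichlet_character d1 \<psi>1"
    using i1 i2 by (auto simp: induces_def dirichlet_character_def)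
  have e: "e > 0" "e dvd d1" "e dvd q" using d by (auto simp: e_def)
  define s where "s = (\<lambda>a. SOME k. coprime (a + k * e) q)"
  define r where "r = (\<lambda>a. a + s a * e)"
  have r: "coprime (r a) q" "[r a = a] (mod e)" if "coprime a e" for a
  proof -
    show "coprime (r a) q"
      unfolding r_def s_def by (rule someI_ex[OF exists_coprime_shift[OF that d(5)]])
    show "[r a = a] (mod e)" by (simp add: r_def cong_def)
  qed
  have wd: "chi a = chi b" if "coprime a q" "coprime b q" "[a = b] (mod e)" for a b
    using induces_well_defined[OF i1 i2 that(1,2)] that(3) by (simp add: e_def)
  define \<psi> where "\<psi> = (\<lambda>a. if coprime a e then chi (r a) else 0)"
  have chin: "chi a \<noteq> 0 \<longleftrightarrow> coprime a q" and chim: "chi (a * b) = chi a * chi b" for a b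
    using chi by (auto simp: dirichlet_character_def)
  have "dirichlet_character e \<psi>"
    unfolding dirichlet_character_def
  proof (intro conjI allI e(1))
    fix a b
    show "\<psi> (a * b) = \<psi> a * \<psi> b"
    proof (cases "coprime a e \<and> coprime b e")
      case True
      hence ab: "coprime (a * b) e" by simp
      have "chi (r (a * b)) = chi (r a * r b)"
      proof (rule wd)
        show "coprime (r (a * b)) q" using r ab by blast
        show "coprime (r a * r b) q" using r True by simp
        show "[r (a * b) = r a * r b] (mod e)"
          using r(2)[OF ab] r(2)[of a] r(2)[of b] True by (meson cong_mult cong_sym cong_trans)
      qed
      thus ?thesis using True ab by (simp add: \<psi>_def chim)
    next
      case False
      hence "\<not> coprime (a * b) e" by simp
      thus ?thesis using False unfolding \<psi>_def by (metis mult_zero_left mult_zero_right)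
    qed
    have ae_iff: "coprime (a + e) e \<longleftrightarrow> coprime a e" by (simp only: coprime_iff_gcd_eq_1 gcd_add1)
    show "\<psi> (a + e) = \<psi> a"
    proof (cases "coprime a e")
      case True
      hence ae: "coprime (a + e) e" by (simp only: ae_iff)
      have "chi (r (a + e)) = chi (r a)"
      proof (rule wd)
        show "[r (a + e) = r a] (mod e)"
          using r(2)[OF ae] r(2)[OF True] by (simp add: cong_def)
      qed (use r ae True in auto)
      thus ?thesis using True ae by (simp add: \<psi>_def)
    qed (simp add: \<psi>_def ae_iff)
    show "\<psi> a \<noteq> 0 \<longleftrightarrow> coprime a e" using r(1) by (auto simp: \<psi>_def chin)
  qed
  moreover have "\<psi>1 a = \<psi> a" if a: "coprime a d1" for a
  proof -
    obtain k where k: "coprime (a + k * d1) q" using exists_coprime_shift[OF a d(5)] by blast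
    have ae: "coprime a e" using a e(2) by (meson coprime_divisors dvd_refl)
    have "\<psi>1 a = \<psi>1 (a + k * d1)" using dirichlet_character_mod[OF ch1] by simp
    also have "\<dots> = chi (a + k * d1)" using i1 k by (simp add: induces_def)
    also have "\<dots> = chi (r a)"
    proof (rule wd[OF k r(1)[OF ae]])
      have "[a + k * d1 = a] (mod d1)" by (simp add: cong_def)
      hence "[a + k * d1 = a] (mod e)" using e(2) by (rule cong_dvd_modulus_nat)
      thus "[a + k * d1 = r a] (mod e)" using r(2)[OF ae] cong_sym cong_trans by blast
    qed
    finally show ?thesis using ae by (simp add: \<psi>_def)
  qed
  ultimately have "induces e \<psi> d1 \<psi>1" using e ch1 by (simp add: induces_def)
  thus ?thesis by (auto simp: e_def)
qed

lemma primitive_inducing_unique: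
  assumes "primitive_character d1 \<psi>1" "induces d1 \<psi>1 q chi" "primitive_character d2 \<psi>2" "induces d2 \<psi>2 q chi"
  shows "\<psi>1 = \<psi>2"
proof -
  have "gcd d1 d2 = d1"
    using induces_gcd[OF assms(2,4)] assms(1) unfolding primitive_character_def by blast
  moreover have "gcd d2 d1 = d2"
    using induces_gcd[OF assms(4,2)] assms(3) unfolding primitive_character_def by blast
  ultimately have "d1 = d2" by (simp add: gcd.commute)
  thus ?thesis using induces_determined assms by blast
qed

text \<open>Existence and uniqueness resolve the definite description. A principal \<psi> would make
  chi equal to 1 at all integers coprime to q, and chi vanishes at the others, so chi would be
  principal.\<close>

lemma primitive_inducing_character:
  assumes chi: "dirichlet_character q chi" and np: "chi \<noteq> principal_character q"
  obtains d where "d \<le> q" "dirichlet_character d (primitive_inducing q chi)"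
    "primitive_inducing q chi \<noteq> principal_character d"
proof -
  obtain \<psi> d where \<psi>: "primitive_character d \<psi>" "induces d \<psi> q chi"
    using exists_primitive_inducing[OF chi] by blast
  have "primitive_inducing q chi = \<psi>"
    unfolding primitive_inducing_def
    by (rule the_equality) (use \<psi> primitive_inducing_unique in blast)+
  moreover have "\<psi> \<noteq> principal_character d"
  proof
    assume eq: "\<psi> = principal_character d"
    have "chi a = principal_character q a" for a
    proof (cases "coprime a q")
      case True
      hence "chi a = \<psi> a" using \<psi>(2) by (simp add: induces_def)
      moreover have "coprime a d" using True \<psi>(2) unfolding induces_def by (meson coprime_divisors dvd_refl)
      ultimately show ?thesis using True eq by (simp add: principal_character_def)
    next
      case False
      thus ?thesis using chi unfolding dirichlet_character_def principal_character_def by auto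
    qed
    thus False using np by blast
  qed
  moreover have "d \<le> q" using \<psi>(2) by (intro dvd_imp_le) (auto simp: induces_def dirichlet_character_def)
  ultimately show ?thesis using that \<psi>(2) by (auto simp: induces_def)
qed

section \<open>Orthogonality and the number of characters\<close>

lemma character_orthogonality:
  assumes chi: "dirichlet_character q chi" and psi: "dirichlet_character q \<psi>"
  shows "(\<Sum>a\<in>{1..q}. chi a * cnj (\<psi> a)) = (if chi = \<psi> then of_nat (totient q) else 0)"
proof (cases "chi = \<psi>")
  case True
  have "(\<Sum>a\<in>{1..q}. chi a * cnj (chi a)) = (\<Sum>a\<in>{1..q}. if coprime a q then 1 else 0)"
    using dirichlet_character_norm[OF chi] by (intro sum.cong refl) (auto simp: complex_norm_square[symmetric])
  also have "\<dots> = (\<Sum>a\<in>totatives q. 1)"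
    by (intro sum.mono_neutral_cong_right) (auto simp: totatives_def)
  finally show ?thesis using True by (simp add: totient_def)
next
  case False
  define \<theta> where "\<theta> = (\<lambda>a. chi a * cnj (\<psi> a))"
  have th: "dirichlet_character q \<theta>"
    using chi psi by (auto simp: dirichlet_character_def \<theta>_def)
  have "\<theta> \<noteq> principal_character q"
  proof
    assume eq: "\<theta> = principal_character q"
    have "chi a = \<psi> a" for a
    proof (cases "coprime a q")
      case True
      have "chi a * cnj (\<psi> a) = 1" using fun_cong[OF eq, of a] True by (simp add: \<theta>_def principal_character_def)
      hence "chi a * (cnj (\<psi> a) * \<psi> a) = \<psi> a" by (simp flip: mult.assoc)
      moreover have "cnj (\<psi> a) * \<psi> a = 1"
        using dirichlet_character_norm[OF psi, of a] True by (simp add: complex_norm_square[symmetric] mult.commute)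
      ultimately show ?thesis by simp
    next
      case False
      thus ?thesis using chi psi unfolding dirichlet_character_def by metis
    qed
    thus False using False by blast
  qed
  from character_sum_zero[OF th this] show ?thesis using False by (simp add: \<theta>_def)
qed

text \<open>Bessel's inequality for the indicator of the residue class 1.\<close>

lemma card_characters_le:
  assumes fin: "finite X" and X: "\<And>chi. chi \<in> X \<Longrightarrow> dirichlet_character q chi" and q: "q > 0"
  shows "card X \<le> totient q"
proof -
  define t where "t = real (totient q)"
  have t: "t > 0" using q by (simp add: t_def)
  define S where "S = (\<lambda>a. \<Sum>chi\<in>X. chi a)"
  define D where "D = (\<lambda>a::nat. if a = 1 then 1 else 0 :: complex)"
  have S1: "S 1 = of_nat (card X)"
  proof -
    have "S 1 = (\<Sum>chi\<in>X. 1)"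
      unfolding S_def by (intro sum.cong refl) (use X dirichlet_character_1 in force)
    thus ?thesis by simp
  qed
  have SS: "(\<Sum>a\<in>{1..q}. S a * cnj (S a)) = of_real (real (card X) * t)"
  proof -
    have "(\<Sum>a\<in>{1..q}. S a * cnj (S a)) = (\<Sum>a\<in>{1..q}. \<Sum>chi\<in>X. \<Sum>\<psi>\<in>X. chi a * cnj (\<psi> a))"
      by (simp add: S_def sum_product)
    also have "\<dots> = (\<Sum>chi\<in>X. \<Sum>\<psi>\<in>X. \<Sum>a\<in>{1..q}. chi a * cnj (\<psi> a))"
      by (subst sum.swap, intro sum.cong refl, rule sum.swap)
    also have "\<dots> = (\<Sum>chi\<in>X. \<Sum>\<psi>\<in>X. if chi = \<psi> then of_nat (totient q) else 0)"
      using X by (intro sum.cong refl character_orthogonality) auto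
    also have "\<dots> = (\<Sum>chi\<in>X. of_nat (totient q))" using fin by (intro sum.cong refl) simp
    finally show ?thesis by (simp add: t_def)
  qed
  \<comment> \<open>The squared distance of D from S / t, its projection onto the span of X. It
    expands to 1 - card X / t, and its nonnegativity is the bound.\<close>
  let ?E = "\<Sum>a\<in>{1..q}. (norm (D a - S a / of_real t))\<^sup>2"
  have "complex_of_real ?E = (\<Sum>a\<in>{1..q}. (D a - S a / of_real t) * cnj (D a - S a / of_real t))"
    unfolding of_real_sum by (intro sum.cong refl complex_norm_square)
  also have "\<dots> = (\<Sum>a\<in>{1..q}. D a * cnj (D a) - D a * cnj (S a) / of_real t - S a * cnj (D a) / of_real t + S a * cnj (S a) / of_real (t ^ 2))"
    using t by (intro sum.cong refl) (simp add: field_simps power2_eq_square)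
  also have "\<dots> = (\<Sum>a\<in>{1..q}. D a * cnj (D a)) - (\<Sum>a\<in>{1..q}. D a * cnj (S a)) / of_real t
       - (\<Sum>a\<in>{1..q}. S a * cnj (D a)) / of_real t + (\<Sum>a\<in>{1..q}. S a * cnj (S a)) / of_real (t ^ 2)"
    by (simp only: sum.distrib sum_subtractf sum_divide_distrib)
  also have "\<dots> = complex_of_real (1 - real (card X) / t)"
  proof -
    have D1: "(\<Sum>a\<in>{1..q}. D a * g a) = g 1" "(\<Sum>a\<in>{1..q}. g a * cnj (D a)) = g 1" for g :: "nat \<Rightarrow> complex"
    proof -
      have "(\<Sum>a\<in>{1..q}. D a * g a) = (\<Sum>a\<in>{1}. D a * g a)" "(\<Sum>a\<in>{1..q}. g a * cnj (D a)) = (\<Sum>a\<in>{1}. g a * cnj (D a))"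
        using q by (intro sum.mono_neutral_right; auto simp: D_def)+
      thus "(\<Sum>a\<in>{1..q}. D a * g a) = g 1" "(\<Sum>a\<in>{1..q}. g a * cnj (D a)) = g 1" by (simp_all add: D_def)
    qed
    show ?thesis
      unfolding D1 SS S1 using t by (simp add: D_def field_simps power2_eq_square)
  qed
  finally have "?E = 1 - real (card X) / t" unfolding of_real_eq_iff .
  moreover have "?E \<ge> 0" by (intro sum_nonneg) simp
  ultimately have "real (card X) / t \<le> 1" by linarith
  thus ?thesis using t by (simp add: t_def field_simps)
qed

section \<open>Bounds for the additive convolution\<close>

text \<open>Perron's formula for F = -L'/L, which is holomorphic because L has no zeros to the right
  of 1/2. K is taken from the majorant log n and is independent of chi, so the modulus enters only
  through q^\<eta>.\<close>

lemma mangoldt_character_sum_bound: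
  assumes grh: "generalized_riemann_hypothesis" and \<eta>: "0 < \<eta>" "\<eta> < 1 / 8"
  shows "\<exists>C>0. \<forall>q chi k. dirichlet_character q chi \<longrightarrow> chi \<noteq> principal_character q \<longrightarrow> k \<ge> 1 \<longrightarrow>
    norm (\<Sum>n=1..k. mangoldt n * chi n) \<le> C * real q powr \<eta> * real k powr (1 / 2 + 4 * \<eta>)"
proof -
  obtain C1 where C1: "C1 > 0" "\<And>q chi s. dirichlet_character q chi \<Longrightarrow> chi \<noteq> principal_character q \<Longrightarrow>
     1 / 2 + 2 * \<eta> \<le> Re s \<Longrightarrow> Re s \<le> 3 \<Longrightarrow>
     norm (deriv (dirichlet_L chi) s / dirichlet_L chi s) \<le> C1 * (real q * (8 + \<bar>Im s\<bar>)) powr \<eta>"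
    using dirichlet_L_logderiv_bound[OF grh, of \<eta> \<eta>] \<eta> by auto
  obtain C2 where C2: "C2 > 0" "\<forall>a F B K k. abs_conv_beyond a 1 \<longrightarrow> (\<Sum>n. norm (a n) * real n powr (-(1 + \<eta>))) \<le> K \<longrightarrow>
     F holomorphic_on {s. Re s > 1 / 2} \<longrightarrow> (\<forall>s. Re s > 1 \<longrightarrow> F s = dirichlet_series a s) \<longrightarrow> B \<ge> 0 \<longrightarrow>
     (\<forall>s. 1 / 2 + 2 * \<eta> \<le> Re s \<longrightarrow> Re s \<le> 2 \<longrightarrow> norm (F s) \<le> B * (8 + \<bar>Im s\<bar>) powr \<eta>) \<longrightarrow> k \<ge> 1 \<longrightarrow>
     norm (\<Sum>n=1..k. a n) \<le> C2 * (B + K) * real k powr (1 / 2 + 4 * \<eta>)"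
    using perron_bound[OF \<eta>] by blast
  have lnconv: "abs_conv_beyond (\<lambda>n. complex_of_real (ln (real n)) * 1) 1"
    by (intro abs_conv_beyond_ln abs_conv_beyond_bounded) simp
  define K where "K = (\<Sum>n. norm (complex_of_real (ln (real n)) * 1) * real n powr (-(1 + \<eta>)))"
  have sK: "summable (\<lambda>n. norm (complex_of_real (ln (real n)) * 1) * real n powr (-(1 + \<eta>)))"
    using lnconv[unfolded abs_conv_beyond_def, rule_format, of "1 + \<eta>"] \<eta> by simp
  have K0: "K \<ge> 0" unfolding K_def by (intro suminf_nonneg sK) simp
  have main: "norm (\<Sum>n=1..k. mangoldt n * chi n) \<le> C2 * (C1 + K) * real q powr \<eta> * real k powr (1 / 2 + 4 * \<eta>)"
    if chi: "dirichlet_character q chi" and np: "chi \<noteq> principal_character q" and k: "k \<ge> 1" for q chi k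
  proof -
    have q: "q > 0" using chi by (simp add: dirichlet_character_def)
    have nz: "dirichlet_L chi s \<noteq> 0" if "Re s > 1 / 2" for s
      using dirichlet_L_nonzero[OF grh chi that] np by blast
    let ?a = "\<lambda>n. mangoldt n * chi n"
    define F where "F = (\<lambda>s. - (deriv (dirichlet_L chi) s / dirichlet_L chi s))"
    have 1: "abs_conv_beyond ?a 1" by (rule abs_conv_mangoldt_character[OF chi])
    have le: "norm (?a n) \<le> norm (complex_of_real (ln (real n)) * 1)" for n
      using mult_mono[OF norm_mangoldt_le[of n] dirichlet_character_norm_le[OF chi, of n]]
      by (simp add: norm_mult del: norm_mangoldt)
    have 2: "(\<Sum>n. norm (?a n) * real n powr (-(1 + \<eta>))) \<le> K" unfolding K_def
    proof (rule suminf_le[OF _ _ sK])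
      show "summable (\<lambda>n. norm (?a n) * real n powr (-(1 + \<eta>)))"
        using 1[unfolded abs_conv_beyond_def, rule_format, of "1 + \<eta>"] \<eta> by simp
    qed (intro mult_right_mono le, simp)
    have 3: "F holomorphic_on {s. Re s > 1 / 2}"
    proof -
      have L: "dirichlet_L chi holomorphic_on {s. Re s > 1 / 2}"
        by (rule holomorphic_on_subset[OF dirichlet_L_holomorphic[OF chi np]]) simp
      show ?thesis unfolding F_def
        by (intro holomorphic_intros L open_halfspace_Re_gt) (use nz in auto)
    qed
    have 4: "F s = dirichlet_series ?a s" if "Re s > 1" for s
      using DERIV_imp_deriv[OF dirichlet_L_has_derivative[OF chi that]] nz[of s] that by (simp add: F_def)
    have 5: "norm (F s) \<le> (C1 * real q powr \<eta>) * (8 + \<bar>Im s\<bar>) powr \<eta>" if "1 / 2 + 2 * \<eta> \<le> Re s" "Re s \<le> 2" for s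
      using C1(2)[OF chi np that(1)] that by (simp add: F_def powr_mult mult_ac)
    have "norm (\<Sum>n=1..k. ?a n) \<le> C2 * (C1 * real q powr \<eta> + K) * real k powr (1 / 2 + 4 * \<eta>)"
      by (rule C2(2)[rule_format, OF 1 2 3 4 _ 5 k]) (use C1 in auto)
    also have "\<dots> \<le> C2 * (C1 * real q powr \<eta> + K * real q powr \<eta>) * real k powr (1 / 2 + 4 * \<eta>)"
    proof -
      have "1 \<le> real q powr \<eta>" using q \<eta> by (intro ge_one_powr_ge_zero) auto
      hence "K * 1 \<le> K * real q powr \<eta>" using K0 by (intro mult_left_mono)
      thus ?thesis using C2(1) by (intro mult_right_mono mult_left_mono add_left_mono) auto
    qed
    finally show ?thesis by (simp add: algebra_simps)
  qed
  have "C2 * (C1 + K) > 0" using C1(1) C2(1) K0 by (intro mult_pos_pos add_pos_nonneg)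
  thus ?thesis using main by blast
qed

text \<open>The generating series of \<mu>(m) log m is minus the derivative of 1/zeta, so Perron's
  formula is fed with \<open>inverse_zeta_deriv_bound\<close>.\<close>

lemma moebius_ln_sum_bound:
  assumes grh: "generalized_riemann_hypothesis" and \<eta>: "0 < \<eta>" "\<eta> < 1 / 8"
  shows "\<exists>C>0. \<forall>k\<ge>1. norm (\<Sum>m=1..k. complex_of_real (ln (real m)) * moebius_mu m) \<le> C * real k powr (1 / 2 + 4 * \<eta>)"
proof -
  obtain C1 where C1: "C1 > 0" "\<And>s. 1 / 2 + 2 * \<eta> \<le> Re s \<Longrightarrow> Re s \<le> 2 \<Longrightarrow>
      norm (deriv inverse_zeta s) \<le> C1 * (8 + \<bar>Im s\<bar>) powr \<eta>"
    using inverse_zeta_deriv_bound[OF grh, of \<eta> \<eta>] \<eta> by auto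
  obtain C2 where C2: "C2 > 0" "\<forall>a F B K k. abs_conv_beyond a 1 \<longrightarrow> (\<Sum>n. norm (a n) * real n powr (-(1 + \<eta>))) \<le> K \<longrightarrow>
     F holomorphic_on {s. Re s > 1 / 2} \<longrightarrow> (\<forall>s. Re s > 1 \<longrightarrow> F s = dirichlet_series a s) \<longrightarrow> B \<ge> 0 \<longrightarrow>
     (\<forall>s. 1 / 2 + 2 * \<eta> \<le> Re s \<longrightarrow> Re s \<le> 2 \<longrightarrow> norm (F s) \<le> B * (8 + \<bar>Im s\<bar>) powr \<eta>) \<longrightarrow> k \<ge> 1 \<longrightarrow>
     norm (\<Sum>n=1..k. a n) \<le> C2 * (B + K) * real k powr (1 / 2 + 4 * \<eta>)"
    using perron_bound[OF \<eta>] by blast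
  let ?a = "\<lambda>n. complex_of_real (ln (real n)) * moebius_mu n"
  have mu: "abs_conv_beyond moebius_mu 1" by (intro abs_conv_beyond_bounded norm_moebius_mu_le)
  have 1: "abs_conv_beyond ?a 1" by (rule abs_conv_beyond_ln[OF mu])
  define K where "K = (\<Sum>n. norm (?a n) * real n powr (-(1 + \<eta>)))"
  have K0: "K \<ge> 0" unfolding K_def
    using 1[unfolded abs_conv_beyond_def, rule_format, of "1 + \<eta>"] \<eta> by (intro suminf_nonneg) auto
  define F where "F = (\<lambda>s. - deriv inverse_zeta s)"
  have 3: "F holomorphic_on {s. Re s > 1 / 2}" unfolding F_def
    by (intro holomorphic_intros inverse_zeta_holomorphic[OF grh] open_halfspace_Re_gt)
  have iz: "inverse_zeta s = dirichlet_series moebius_mu s" if "Re s > 1" for s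
  proof -
    have "dirichlet_L (\<lambda>_. 1) s * dirichlet_series moebius_mu s = 1"
      using zeta_mult_dser_moebius[OF that] by (simp add: riemann_zeta_def)
    moreover have "s \<noteq> 1" using that by auto
    ultimately show ?thesis using inverse_zeta_eq[of s] by (metis inverse_eq_divide inverse_unique)
  qed
  have 4: "F s = dirichlet_series ?a s" if s: "Re s > 1" for s
  proof -
    have "(inverse_zeta has_field_derivative dirichlet_series (\<lambda>n. - ?a n) s) (at s)"
      by (rule has_field_derivative_transform_within_open[OF dirichlet_series_has_derivative[OF mu s], of "{s. Re s > 1}"])
         (use s iz in \<open>auto simp: open_halfspace_Re_gt\<close>)
    thus ?thesis using dirichlet_series_minus[OF 1 s] by (simp add: F_def DERIV_imp_deriv)
  qed
  have "norm (\<Sum>n=1..k. ?a n) \<le> C2 * (C1 + K) * real k powr (1 / 2 + 4 * \<eta>)" if k: "k \<ge> 1" for k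
    by (rule C2(2)[rule_format, OF 1 _ 3 4 _ _ k]) (use C1 in \<open>auto simp: F_def K_def\<close>)
  moreover have "C2 * (C1 + K) > 0" using C1(1) C2(1) K0 by (intro mult_pos_pos add_pos_nonneg)
  ultimately show ?thesis by blast
qed

section \<open>Riesz means by double summation by parts\<close>

lemma summation_by_parts:
  fixes b h :: "nat \<Rightarrow> complex"
  shows "(\<Sum>m=1..K. b m * h m) = (\<Sum>m=1..K. (\<Sum>j=1..m. b j) * (h m - h (Suc m))) + (\<Sum>j=1..K. b j) * h (Suc K)"
  by (induction K) (simp_all add: algebra_simps)

text \<open>Summing by parts in both variables replaces the kernel \<open>max 0 (Y - n - m)\<close> by its second
  difference, which is supported on \<open>n + m \<le> Y\<close> and has total mass at most 1 in \<open>m\<close>.\<close>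

lemma riesz_double_sum_bound:
  fixes a b :: "nat \<Rightarrow> complex"
  assumes A: "\<And>k. k \<ge> 1 \<Longrightarrow> norm (\<Sum>n=1..k. a n) \<le> A * real k powr \<alpha>" "A \<ge> 0"
    and B: "\<And>k. k \<ge> 1 \<Longrightarrow> norm (\<Sum>m=1..k. b m) \<le> B * real k powr \<alpha>" "B \<ge> 0"
    and \<alpha>: "\<alpha> \<ge> 0" and Y: "0 < Y" "Y \<le> real K"
  shows "norm (\<Sum>n=1..K. \<Sum>m=1..K. a n * b m * of_real (max 0 (Y - real n - real m)))
    \<le> A * B * Y powr (1 + 2 * \<alpha>)"
proof -
  define P where "P = (\<lambda>z::real. \<Sum>m=1..K. b m * of_real (max 0 (z - real m)))"
  \<comment> \<open>The backward difference of the hinge function max 0 t: it rises from 0 to 1 on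
    [0, 1], and its monotonicity is what makes the variation in m telescope to at most 1.\<close>
  define c where "c = (\<lambda>t::real. max 0 t - max 0 (t - 1))"
  have c: "0 \<le> c t" "c t \<le> 1" "t \<le> 0 \<Longrightarrow> c t = 0" "c (t - 1) \<le> c t" for t by (auto simp: c_def max_def)
  have P0: "P z = 0" if "z \<le> 1" for z unfolding P_def using that by (intro sum.neutral) auto
  have Pdiff: "norm (P z - P (z - 1)) \<le> B * Y powr \<alpha>" if z: "z \<le> Y" for z
  proof -
    define h where "h = (\<lambda>m::nat. complex_of_real (c (z - real m)))"
    have "P z - P (z - 1) = (\<Sum>m=1..K. b m * h m)"
      unfolding P_def h_def c_def by (simp add: sum_subtractf[symmetric] algebra_simps)
    also have "\<dots> = (\<Sum>m=1..K. (\<Sum>j=1..m. b j) * (h m - h (Suc m))) + (\<Sum>j=1..K. b j) * h (Suc K)"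
      by (rule summation_by_parts)
    also have "h (Suc K) = 0" using z Y by (simp add: h_def c(3))
    finally have eq: "P z - P (z - 1) = (\<Sum>m=1..K. (\<Sum>j=1..m. b j) * (h m - h (Suc m)))" by simp
    have "norm (\<Sum>m=1..K. (\<Sum>j=1..m. b j) * (h m - h (Suc m)))
        \<le> (\<Sum>m=1..K. B * Y powr \<alpha> * (c (z - real m) - c (z - real (Suc m))))"
    proof (rule sum_norm_le)
      fix m assume m: "m \<in> {1..K}"
      have d: "c (z - real m - 1) \<le> c (z - real m)" by (rule c(4))
      have hm: "h m - h (Suc m) = complex_of_real (c (z - real m) - c (z - real (Suc m)))" by (simp add: h_def)
      have nh: "norm (h m - h (Suc m)) = c (z - real m) - c (z - real (Suc m))"
        unfolding hm norm_of_real using d by (simp add: algebra_simps)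
      show "norm ((\<Sum>j=1..m. b j) * (h m - h (Suc m))) \<le> B * Y powr \<alpha> * (c (z - real m) - c (z - real (Suc m)))"
      proof (cases "real m \<le> Y")
        case True
        have "norm (\<Sum>j=1..m. b j) \<le> B * real m powr \<alpha>" using B(1) m by simp
        also have "\<dots> \<le> B * Y powr \<alpha>" using True B(2) \<alpha> by (intro mult_left_mono powr_mono2) auto
        finally show ?thesis unfolding norm_mult nh using d by (intro mult_right_mono) (auto simp: algebra_simps)
      next
        case False
        thus ?thesis unfolding norm_mult nh using z by (simp add: c(3))
      qed
    qed
    also have "\<dots> = B * Y powr \<alpha> * (\<Sum>m=1..K. c (z - real m) - c (z - real (Suc m)))"
      by (simp add: sum_distrib_left)
    also have "(\<Sum>m=1..K. c (z - real m) - c (z - real (Suc m))) = c (z - 1) - c (z - real (Suc K))"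
      using sum_Suc_diff'[of 1 "Suc K" "\<lambda>m. - c (z - real m)"] by (simp add: atLeastLessThanSuc_atLeastAtMost)
    also have "B * Y powr \<alpha> * (c (z - 1) - c (z - real (Suc K))) \<le> B * Y powr \<alpha> * 1"
      using c(1)[of "z - real (Suc K)"] c(2)[of "z - 1"] B(2) by (intro mult_left_mono) auto
    finally show ?thesis unfolding eq by simp
  qed
  have "(\<Sum>n=1..K. \<Sum>m=1..K. a n * b m * of_real (max 0 (Y - real n - real m)))
      = (\<Sum>n=1..K. a n * P (Y - real n))"
    unfolding P_def sum_distrib_left by (simp add: mult.assoc)
  also have "\<dots> = (\<Sum>n=1..K. (\<Sum>j=1..n. a j) * (P (Y - real n) - P (Y - real (Suc n)))) + (\<Sum>j=1..K. a j) * P (Y - real (Suc K))"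
    by (rule summation_by_parts)
  also have "P (Y - real (Suc K)) = 0" using Y by (intro P0) simp
  finally have eq: "(\<Sum>n=1..K. \<Sum>m=1..K. a n * b m * of_real (max 0 (Y - real n - real m)))
      = (\<Sum>n=1..K. (\<Sum>j=1..n. a j) * (P (Y - real n) - P (Y - real (Suc n))))" by simp
  \<comment> \<open>For n > Y both values of P vanish, so at most Y indices remain; this is the
    source of the extra factor Y in the bound.\<close>
  also have "\<dots> = (\<Sum>n\<in>{1..nat \<lfloor>Y\<rfloor>}. (\<Sum>j=1..n. a j) * (P (Y - real n) - P (Y - real (Suc n))))"
  proof (rule sum.mono_neutral_right)
    have "nat \<lfloor>Y\<rfloor> \<le> K" using Y by linarith
    thus "{1..nat \<lfloor>Y\<rfloor>} \<subseteq> {1..K}" by auto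
    show "\<forall>n\<in>{1..K} - {1..nat \<lfloor>Y\<rfloor>}. (\<Sum>j=1..n. a j) * (P (Y - real n) - P (Y - real (Suc n))) = 0"
    proof
      fix n assume "n \<in> {1..K} - {1..nat \<lfloor>Y\<rfloor>}"
      hence "real n > Y" using Y by (auto simp: not_le le_nat_iff nat_less_iff floor_less_iff)
      thus "(\<Sum>j=1..n. a j) * (P (Y - real n) - P (Y - real (Suc n))) = 0" by (simp add: P0)
    qed
  qed simp
  finally have eq: "(\<Sum>n=1..K. \<Sum>m=1..K. a n * b m * of_real (max 0 (Y - real n - real m))) =
     (\<Sum>n\<in>{1..nat \<lfloor>Y\<rfloor>}. (\<Sum>j=1..n. a j) * (P (Y - real n) - P (Y - real (Suc n))))" .
  have "norm (\<Sum>n\<in>{1..nat \<lfloor>Y\<rfloor>}. (\<Sum>j=1..n. a j) * (P (Y - real n) - P (Y - real (Suc n))))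
     \<le> (\<Sum>n\<in>{1..nat \<lfloor>Y\<rfloor>}. (A * Y powr \<alpha>) * (B * Y powr \<alpha>))"
  proof (rule sum_norm_le)
    fix n assume n: "n \<in> {1..nat \<lfloor>Y\<rfloor>}"
    hence nY: "real n \<le> Y" using Y by (auto simp: le_nat_iff le_floor_iff)
    have "norm (\<Sum>j=1..n. a j) \<le> A * real n powr \<alpha>" using A(1) n by simp
    also have "\<dots> \<le> A * Y powr \<alpha>" using nY A(2) \<alpha> by (intro mult_left_mono powr_mono2) auto
    finally have 1: "norm (\<Sum>j=1..n. a j) \<le> A * Y powr \<alpha>" .
    have 2: "norm (P (Y - real n) - P (Y - real (Suc n))) \<le> B * Y powr \<alpha>"
      using Pdiff[of "Y - real n"] by (simp add: algebra_simps)
    show "norm ((\<Sum>j=1..n. a j) * (P (Y - real n) - P (Y - real (Suc n)))) \<le> (A * Y powr \<alpha>) * (B * Y powr \<alpha>)"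
      unfolding norm_mult by (intro mult_mono 1 2) (use A(2) in auto)
  qed
  also have "\<dots> = real (nat \<lfloor>Y\<rfloor>) * ((A * Y powr \<alpha>) * (B * Y powr \<alpha>))" by simp
  also have "\<dots> \<le> Y * ((A * Y powr \<alpha>) * (B * Y powr \<alpha>))"
    using Y A(2) B(2) by (intro mult_right_mono) auto
  also have "\<dots> = A * B * (Y * (Y powr \<alpha> * Y powr \<alpha>))" by (simp only: mult_ac)
  also have "Y * (Y powr \<alpha> * Y powr \<alpha>) = Y powr (1 + 2 * \<alpha>)"
    unfolding powr_add[of Y 1] mult_2 powr_add[of Y \<alpha> \<alpha>] using Y by simp
  finally show ?thesis unfolding eq .
qed

text \<open>Since f vanishes from \<beta> on, the triangular range of (n, m) may be replaced by the
  square up to K, and Taylor's formula turns the sum into the integral of f''(w) / N against the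
  Riesz mean at Y = N w. Then Y^(1 + 2 \<alpha>) / N = N^(2 \<alpha>) w^(1 + 2 \<alpha>) separates N
  from w, and w^(1 + 2 \<alpha>) <= 1 + w^p brings the second factor under the weight in the
  integral.\<close>

lemma (in admissible_weight) additive_convolution_bound:
  fixes a b :: "nat \<Rightarrow> complex" and N :: nat
  assumes A: "\<And>k. k \<ge> 1 \<Longrightarrow> norm (\<Sum>n=1..k. a n) \<le> A * real k powr \<alpha>" "A \<ge> 0"
    and B: "\<And>k. k \<ge> 1 \<Longrightarrow> norm (\<Sum>m=1..k. b m) \<le> B * real k powr \<alpha>" "B \<ge> 0"
    and \<alpha>: "\<alpha> \<ge> 0" and p: "1 + 2 * \<alpha> \<le> p" and N: "N \<ge> 1"
  shows "norm (\<Sum>n | 0 < n \<and> real n \<le> real N * \<beta>. \<Sum>m | 0 < m \<and> real m \<le> real N * \<beta> - real n.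
        a n * b m * f (real (n + m) / real N))
     \<le> A * B * real N powr (2 * \<alpha>) * (LINT w:{0<..<\<beta>}|lebesgue. norm (f'' w) * (1 + \<bar>ln w\<bar> ^ 3) * (1 + w powr p))"
    (is "norm ?S \<le> _")
proof -
  define K where "K = nat \<lceil>real N * \<beta>\<rceil>"
  define x where "x = (\<lambda>n m :: nat. real (n + m) / real N)"
  define I where "I = {0<..<\<beta>}"
  define G where "G = (\<lambda>w. \<Sum>n=1..K. \<Sum>m=1..K. (a n * b m) * (indicator I w *\<^sub>R (max 0 (w - x n m) *\<^sub>R f'' w)))"
  define W where "W = (\<lambda>w. norm (f'' w) * (1 + \<bar>ln w\<bar> ^ 3) * (1 + w powr p))"
  have K: "real N * \<beta> \<le> real K" using beta by (simp add: K_def real_nat_ceiling_ge)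
  have fx: "f (x n m) = 0" if "real n + real m \<ge> real N * \<beta>" for n m
    by (rule f_beta) (use that N in \<open>simp add: x_def field_simps\<close>)
  have inner: "(\<Sum>m | 0 < m \<and> real m \<le> real N * \<beta> - real n. a n * b m * f (x n m)) = (\<Sum>m=1..K. a n * b m * f (x n m))" for n
  proof (rule sum.mono_neutral_left)
    show "{m. 0 < m \<and> real m \<le> real N * \<beta> - real n} \<subseteq> {1..K}"
    proof clarify
      fix m :: nat assume m: "0 < m" "real m \<le> real N * \<beta> - real n"
      hence "real m \<le> real K" using K by linarith
      thus "m \<in> {1..K}" using m by simp
    qed
    show "\<forall>m\<in>{1..K} - {m. 0 < m \<and> real m \<le> real N * \<beta> - real n}. a n * b m * f (x n m) = 0"
    proof
      fix m assume "m \<in> {1..K} - {m. 0 < m \<and> real m \<le> real N * \<beta> - real n}"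
      hence "f (x n m) = 0" by (intro fx) auto
      thus "a n * b m * f (x n m) = 0" by simp
    qed
  qed simp
  have "?S = (\<Sum>n | 0 < n \<and> real n \<le> real N * \<beta>. \<Sum>m=1..K. a n * b m * f (x n m))"
    unfolding inner[symmetric] by (simp add: x_def)
  also have "\<dots> = (\<Sum>n=1..K. \<Sum>m=1..K. a n * b m * f (x n m))"
  proof (rule sum.mono_neutral_left)
    show "{n. 0 < n \<and> real n \<le> real N * \<beta>} \<subseteq> {1..K}"
    proof clarify
      fix n :: nat assume n: "0 < n" "real n \<le> real N * \<beta>"
      hence "real n \<le> real K" using K by linarith
      thus "n \<in> {1..K}" using n by simp
    qed
    show "\<forall>n\<in>{1..K} - {n. 0 < n \<and> real n \<le> real N * \<beta>}. (\<Sum>m=1..K. a n * b m * f (x n m)) = 0"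
    proof
      fix n assume "n \<in> {1..K} - {n. 0 < n \<and> real n \<le> real N * \<beta>}"
      hence "f (x n m) = 0" for m by (intro fx) auto
      thus "(\<Sum>m=1..K. a n * b m * f (x n m)) = 0" by simp
    qed
  qed simp
  finally have S: "?S = (\<Sum>n=1..K. \<Sum>m=1..K. a n * b m * f (x n m))" .
  have hbi: "has_bochner_integral lebesgue G (\<Sum>n=1..K. \<Sum>m=1..K. a n * b m * f (x n m))"
    unfolding G_def
  proof (intro has_bochner_integral_sum has_bochner_integral_mult_right)
    fix n m assume "n \<in> {1..K}" "m \<in> {1..K}"
    hence "x n m > 0" using N by (simp add: x_def)
    from f_representation[OF this]
    show "has_bochner_integral lebesgue (\<lambda>w. indicator I w *\<^sub>R (max 0 (w - x n m) *\<^sub>R f'' w)) (f (x n m))"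
      by (simp add: has_bochner_integral_iff set_integrable_def set_lebesgue_integral_def I_def)
  qed
  have Wi: "integrable lebesgue (\<lambda>w. A * B * real N powr (2 * \<alpha>) * (indicator I w *\<^sub>R W w))"
    using weight_integrable[of p] p \<alpha> by (simp add: set_integrable_def I_def W_def)
  have pt: "norm (G w) \<le> A * B * real N powr (2 * \<alpha>) * (indicator I w *\<^sub>R W w)" for w
  proof (cases "w \<in> I")
    case True
    hence w: "0 < w" "w < \<beta>" by (auto simp: I_def)
    define Y where "Y = real N * w"
    have Y: "0 < Y" "Y \<le> real K"
    proof -
      show "0 < Y" using N w by (simp add: Y_def)
      have "Y \<le> real N * \<beta>" unfolding Y_def using w by (intro mult_left_mono) auto
      thus "Y \<le> real K" using K by linarith
    qed
    have mx: "max 0 (w - x n m) = max 0 (Y - real n - real m) / real N" for n m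
      using N by (auto simp: max_def Y_def x_def field_simps)
    have "G w = (f'' w / of_nat N) * (\<Sum>n=1..K. \<Sum>m=1..K. a n * b m * of_real (max 0 (Y - real n - real m)))"
      using True unfolding G_def sum_distrib_left mx
      by (intro sum.cong refl) (simp add: scaleR_conv_of_real)
    also have "norm \<dots> \<le> norm (f'' w) / real N * (A * B * Y powr (1 + 2 * \<alpha>))"
      unfolding norm_mult norm_divide norm_of_nat
      by (intro mult_left_mono riesz_double_sum_bound A B \<alpha> Y) auto
    also have "Y powr (1 + 2 * \<alpha>) = real N * real N powr (2 * \<alpha>) * w powr (1 + 2 * \<alpha>)"
      using N w by (simp add: Y_def powr_mult powr_add)
    also have "norm (f'' w) / real N * (A * B * (real N * real N powr (2 * \<alpha>) * w powr (1 + 2 * \<alpha>)))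
        = A * B * real N powr (2 * \<alpha>) * (norm (f'' w) * w powr (1 + 2 * \<alpha>))"
      using N by (simp add: field_simps)
    also have "\<dots> \<le> A * B * real N powr (2 * \<alpha>) * W w"
    proof -
      have "w powr (1 + 2 * \<alpha>) \<le> 1 + w powr p"
      proof (cases "w \<le> 1")
        case True
        thus ?thesis using powr_le1[of "1 + 2 * \<alpha>" w] w \<alpha> powr_ge_zero[of w p] by linarith
      next
        case False
        thus ?thesis using powr_mono[OF p, of w] by linarith
      qed
      also have "\<dots> \<le> (1 + \<bar>ln w\<bar> ^ 3) * (1 + w powr p)"
        using mult_right_mono[of 1 "1 + \<bar>ln w\<bar> ^ 3" "1 + w powr p"] by simp
      finally have "norm (f'' w) * w powr (1 + 2 * \<alpha>) \<le> W w"
        unfolding W_def mult.assoc by (intro mult_left_mono) auto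
      thus ?thesis using A(2) B(2) by (intro mult_left_mono) auto
    qed
    finally show ?thesis using True by simp
  qed (simp add: G_def)
  have "norm ?S = norm (\<integral>w. G w \<partial>lebesgue)"
    unfolding S using hbi by (simp add: has_bochner_integral_iff)
  also have "\<dots> \<le> (\<integral>w. A * B * real N powr (2 * \<alpha>) * (indicator I w *\<^sub>R W w) \<partial>lebesgue)"
    by (rule Bochner_Integration.integral_norm_bound_integral[OF _ Wi pt])
       (use hbi in \<open>simp add: has_bochner_integral_iff\<close>)
  also have "\<dots> = A * B * real N powr (2 * \<alpha>) * (LINT w:I|lebesgue. W w)"
    unfolding set_lebesgue_integral_def by (rule integral_mult_right_zero)
  finally show ?thesis unfolding I_def W_def .
qed

theorem theorem26:
  fixes \<epsilon> :: real
  assumes "0 < \<epsilon>" and "\<epsilon> < 1 / 2"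
    and "generalized_riemann_hypothesis"
    and "weak_gonek_hejhal"
  shows "\<exists>C>0. \<forall>(N::nat) (\<beta>::real) (f :: real \<Rightarrow> complex) f' f''.
    N \<ge> 4 \<and> \<beta> > 0 \<and> admissible \<beta> f f' f'' \<longrightarrow>
    (\<Sum>q | 1 < q \<and> real q \<le> real N powr (1 - 2 * \<epsilon>) \<and> coprime N q.
       1 / real (totient q) *
       cmod (\<Sum>chi | dirichlet_character q chi \<and> chi \<noteq> principal_character q.
         cnj (primitive_inducing q chi N) *
         (\<Sum>n | 0 < n \<and> real n \<le> real N * \<beta>.
            \<Sum>m | 0 < m \<and> real m \<le> real N * \<beta> - real n.
              mangoldt n * primitive_inducing q chi n * moebius_mu m *
              complex_of_real (ln (real m)) * f (real (n + m) / real N))))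
    \<le> C * real N powr (2 - \<epsilon>) * E1 \<epsilon> \<beta> f''"
proof -
  \<comment> \<open>The final exponent is at most 2 - 2 \<epsilon> + 9 \<eta>, so any \<eta> up to
    \<epsilon> / 9 would keep it below 2 - \<epsilon>.\<close>
  define \<eta> where "\<eta> = \<epsilon> / 16"
  have \<eta>: "0 < \<eta>" "\<eta> < 1 / 8" using assms(1,2) by (auto simp: \<eta>_def)
  define \<alpha> where "\<alpha> = 1 / 2 + 4 * \<eta>"
  have \<alpha>: "\<alpha> \<ge> 0" "1 + 2 * \<alpha> \<le> 5 / 2 + \<epsilon>" using \<eta> by (auto simp: \<alpha>_def \<eta>_def)
  obtain C1 where C1: "C1 > 0" "\<And>q chi k. dirichlet_character q chi \<Longrightarrow> chi \<noteq> principal_character q \<Longrightarrow> k \<ge> 1 \<Longrightarrow>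
    norm (\<Sum>n=1..k. mangoldt n * chi n) \<le> C1 * real q powr \<eta> * real k powr \<alpha>"
    using mangoldt_character_sum_bound[OF assms(3) \<eta>] unfolding \<alpha>_def by blast
  obtain C2 where C2: "C2 > 0"
    "\<And>k. k \<ge> 1 \<Longrightarrow> norm (\<Sum>m=1..k. complex_of_real (ln (real m)) * moebius_mu m) \<le> C2 * real k powr \<alpha>"
    using moebius_ln_sum_bound[OF assms(3) \<eta>] unfolding \<alpha>_def by blast
  have main: "(\<Sum>q | 1 < q \<and> real q \<le> real N powr (1 - 2 * \<epsilon>) \<and> coprime N q.
       1 / real (totient q) *
       cmod (\<Sum>chi | dirichlet_character q chi \<and> chi \<noteq> principal_character q.
         cnj (primitive_inducing q chi N) *
         (\<Sum>n | 0 < n \<and> real n \<le> real N * \<beta>.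
            \<Sum>m | 0 < m \<and> real m \<le> real N * \<beta> - real n.
              mangoldt n * primitive_inducing q chi n * moebius_mu m *
              complex_of_real (ln (real m)) * f (real (n + m) / real N))))
    \<le> C1 * C2 * real N powr (2 - \<epsilon>) * E1 \<epsilon> \<beta> f''"
    if N: "N \<ge> 4" and beta: "\<beta> > 0" and adm: "admissible \<beta> f f' f''" for N \<beta> and f f' f'' :: "real \<Rightarrow> complex"
  proof -
    interpret admissible_weight \<beta> f f' f'' using beta adm by unfold_locales
    define T where "T = (\<lambda>\<psi>. \<Sum>n | 0 < n \<and> real n \<le> real N * \<beta>. \<Sum>m | 0 < m \<and> real m \<le> real N * \<beta> - real n.
              mangoldt n * \<psi> n * moebius_mu m * complex_of_real (ln (real m)) * f (real (n + m) / real N))"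
    define Q where "Q = {q. 1 < q \<and> real q \<le> real N powr (1 - 2 * \<epsilon>) \<and> coprime N q}"
    define X where "X = (\<lambda>q. {chi. dirichlet_character q chi \<and> chi \<noteq> principal_character q})"
    define M where "M = real N powr (1 - 2 * \<epsilon>)"
    define R where "R = C1 * M powr \<eta> * C2 * real N powr (2 * \<alpha>) * E1 \<epsilon> \<beta> f''"
    have E0: "E1 \<epsilon> \<beta> f'' \<ge> 0"
      unfolding E1_def set_lebesgue_integral_def by (intro Bochner_Integration.integral_nonneg) (auto simp: indicator_def)
    have R0: "R \<ge> 0" using C1(1) C2(1) E0 by (simp add: R_def)
    have T: "norm (cnj (primitive_inducing q chi N) * T (primitive_inducing q chi)) \<le> R"
      if q: "q \<in> Q" and chi: "chi \<in> X q" for q chi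
    proof -
      define \<psi> where "\<psi> = primitive_inducing q chi"
      from chi have "dirichlet_character q chi" "chi \<noteq> principal_character q" by (auto simp: X_def)
      then obtain d where d: "d \<le> q" "dirichlet_character d \<psi>" "\<psi> \<noteq> principal_character d"
        unfolding \<psi>_def by (rule primitive_inducing_character)
      \<comment> \<open>The conductor d may be smaller than q; the bound is monotone in the modulus,
        and M dominates the whole range of q.\<close>
      have dM: "real d powr \<eta> \<le> M powr \<eta>"
        using q d(1) \<eta> by (intro powr_mono2) (auto simp: Q_def M_def)
      have T_eq: "T \<psi> = (\<Sum>n | 0 < n \<and> real n \<le> real N * \<beta>. \<Sum>m | 0 < m \<and> real m \<le> real N * \<beta> - real n.
          (mangoldt n * \<psi> n) * (complex_of_real (ln (real m)) * moebius_mu m) * f (real (n + m) / real N))"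
        unfolding T_def by (intro sum.cong refl) (simp add: mult_ac)
      have "norm (T \<psi>) \<le> C1 * M powr \<eta> * C2 * real N powr (2 * \<alpha>) *
          (LINT w:{0<..<\<beta>}|lebesgue. norm (f'' w) * (1 + \<bar>ln w\<bar> ^ 3) * (1 + w powr (5 / 2 + \<epsilon>)))"
        unfolding T_eq
      proof (rule additive_convolution_bound[OF _ _ C2(2) _ \<alpha>])
        fix k :: nat assume k: "k \<ge> 1"
        have "norm (\<Sum>n=1..k. mangoldt n * \<psi> n) \<le> C1 * real d powr \<eta> * real k powr \<alpha>"
          by (rule C1(2)[OF d(2,3) k])
        also have "\<dots> \<le> C1 * M powr \<eta> * real k powr \<alpha>"
          using dM C1(1) by (intro mult_right_mono mult_left_mono) auto
        finally show "norm (\<Sum>n=1..k. mangoldt n * \<psi> n) \<le> C1 * M powr \<eta> * real k powr \<alpha>" .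
      qed (use C1(1) C2(1) N in auto)
      hence TR: "norm (T \<psi>) \<le> R" by (simp add: R_def E1_def)
      have "norm (cnj (\<psi> N) * T \<psi>) \<le> 1 * R"
        unfolding norm_mult complex_mod_cnj
        by (intro mult_mono dirichlet_character_norm_le[OF d(2)] TR) auto
      thus ?thesis by (simp add: \<psi>_def)
    qed
    have term_le: "1 / real (totient q) * norm (\<Sum>chi\<in>X q. cnj (primitive_inducing q chi N) * T (primitive_inducing q chi)) \<le> R"
      if q: "q \<in> Q" for q
    proof (cases "finite (X q)")
      \<comment> \<open>Over an infinite set the sum would be 0 by convention, so the other case
        follows from R >= 0 and the cardinality bound is applied to a finite set.\<close>
      case True
      have q0: "q > 0" using q by (simp add: Q_def)
      have "norm (\<Sum>chi\<in>X q. cnj (primitive_inducing q chi N) * T (primitive_inducing q chi)) \<le> (\<Sum>chi\<in>X q. R)"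
        by (intro sum_norm_le T q)
      also have "\<dots> = real (card (X q)) * R" by simp
      \<comment> \<open>The number of characters cancels the weight 1 / totient q, so every modulus
        costs R once.\<close>
      also have "\<dots> \<le> real (totient q) * R"
        using card_characters_le[OF True _ q0] R0 by (intro mult_right_mono) (auto simp: X_def)
      finally show ?thesis using q0 by (simp add: field_simps)
    qed (use R0 in simp)
    have "(\<Sum>q\<in>Q. 1 / real (totient q) * norm (\<Sum>chi\<in>X q. cnj (primitive_inducing q chi N) * T (primitive_inducing q chi))) \<le> (\<Sum>q\<in>Q. R)"
      by (intro sum_mono term_le)
    also have "\<dots> = real (card Q) * R" by simp
    also have "\<dots> \<le> M * R"
    proof (rule mult_right_mono[OF _ R0])
      have "Q \<subseteq> {1..nat \<lfloor>M\<rfloor>}" by (auto simp: Q_def M_def le_nat_iff le_floor_iff)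
      hence "card Q \<le> nat \<lfloor>M\<rfloor>" using card_mono[of "{1..nat \<lfloor>M\<rfloor>}" Q] by simp
      moreover have "real (nat \<lfloor>M\<rfloor>) \<le> M" by (simp add: M_def)
      ultimately show "real (card Q) \<le> M" by linarith
    qed
    also have "M * R = C1 * C2 * real N powr ((1 - 2 * \<epsilon>) + (1 - 2 * \<epsilon>) * \<eta> + 2 * \<alpha>) * E1 \<epsilon> \<beta> f''"
      by (simp add: R_def M_def powr_powr powr_add)
    also have "\<dots> \<le> C1 * C2 * real N powr (2 - \<epsilon>) * E1 \<epsilon> \<beta> f''"
    proof -
      have "(1 - 2 * \<epsilon>) * \<eta> \<le> 1 * \<eta>" using assms(1) \<eta> by (intro mult_right_mono) auto
      hence "(1 - 2 * \<epsilon>) + (1 - 2 * \<epsilon>) * \<eta> + 2 * \<alpha> \<le> 2 - \<epsilon>"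
        using assms(1) \<alpha>_def \<eta>_def by linarith
      hence "real N powr ((1 - 2 * \<epsilon>) + (1 - 2 * \<epsilon>) * \<eta> + 2 * \<alpha>) \<le> real N powr (2 - \<epsilon>)"
        using N by (intro powr_mono) auto
      thus ?thesis using C1(1) C2(1) E0 by (intro mult_right_mono mult_left_mono) auto
    qed
    finally show ?thesis unfolding Q_def X_def T_def .
  qed
  show ?thesis
    using mult_pos_pos[OF C1(1) C2(1)] main by (intro exI[of _ "C1 * C2"]) blast
qed

end
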